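(* Let $k$ be a field, $\Psi$ a set, and $k(\Psi)$ the field of rational functions over $k$ in the variables indexed by $\Psi$, with the group $\mathfrak S_\Psi$ of all permutations of $\Psi$ acting by permuting the variables. For each $d\in\mathbb Z$ let $V_d\subseteq k(\Psi)$ be the subset of homogeneous rational functions of degree $d$; thus $V_0$ is an $\mathfrak S_\Psi$-invariant subfield and each $V_d$ is an $\mathfrak S_\Psi$-invariant $V_0$-vector subspace. Then the objects $V_d$, $d\in\mathbb Z$, form a system of injective cogenerators of the category of smooth $V_0$-semilinear representations of $\mathfrak S_\Psi$, i.e. they are injective and any smooth $V_0$-semilinear representation $V$ of $\mathfrak S_\Psi$ can be embedded into a direct product of cartesian powers of the $V_d$. In particular, any smooth $V_0$-semilinear representation of $\mathfrak S_\Psi$ of finite length is isomorphic to $\bigoplus_{d\in\mathbb Z}V_d^{m(d)}$ for a function $m:\mathbb Z\to\mathbb Z_{\ge 0}$ with finite support, and $m$ is unique if the set $\Psi$ is infinite.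
   Context: $\mathfrak S_\Psi$ carries the topology in which the pointwise stabilizers of finite subsets of $\Psi$ form a base of neighbourhoods of the identity. A representation is smooth if the stabilizer of every vector is open. For a field $K$ with an action of a group $G$, a $K$-semilinear representation of $G$ is a $K$-vector space $V$ with an additive $G$-action such that $g(av)=a^g\,g(v)$ for $g\in G$, $a\in K$, $v\in V$; morphisms are $K$-linear $G$-equivariant maps. A rational function is homogeneous of degree $d$ if it is $0$ or a ratio of homogeneous polynomials $P/Q$ with $\deg P-\deg Q=d$ (each variable having degree $1$). *)

theory Defs
  imports
    "HOL-Analysis.Abstract_Topology"
    "HOL-Library.Poly_Mapping"
    "HOL-Computational_Algebra.Fraction_Field"
    "HOL-Combinatorics.Permutations"
    "HOL-Algebra.Module"
    "HOL-Algebra.Group_Action"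
begin

section \<open>Polynomials in arbitrarily many variables\<close>

text \<open>
  The type \<open>('p \<Rightarrow>\<^sub>0 nat) \<Rightarrow>\<^sub>0 'k\<close> is an instance of \<open>idom\<close> only for linearly ordered
  \<open>'p\<close>; the copy below is an integral domain for every type \<open>'p\<close> of variables, so that its type
  of fractions is available.
\<close>

typedef (overloaded) ('p, 'k) mpoly = "UNIV :: (('p \<Rightarrow>\<^sub>0 nat) \<Rightarrow>\<^sub>0 'k::zero) set"
  morphisms mcoeffs Abs_mpoly
  by simp

setup_lifting type_definition_mpoly

instantiation mpoly :: (type, comm_ring_1) comm_ring_1
begin

lift_definition zero_mpoly :: "('p, 'k::comm_ring_1) mpoly" is 0 .
lift_definition one_mpoly :: "('p, 'k::comm_ring_1) mpoly" is 1 .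
lift_definition plus_mpoly :: "('p, 'k::comm_ring_1) mpoly \<Rightarrow> ('p, 'k) mpoly \<Rightarrow> ('p, 'k) mpoly"
  is "(+)" .
lift_definition minus_mpoly :: "('p, 'k::comm_ring_1) mpoly \<Rightarrow> ('p, 'k) mpoly \<Rightarrow> ('p, 'k) mpoly"
  is "(-)" .
lift_definition uminus_mpoly :: "('p, 'k::comm_ring_1) mpoly \<Rightarrow> ('p, 'k) mpoly" is uminus .
lift_definition times_mpoly :: "('p, 'k::comm_ring_1) mpoly \<Rightarrow> ('p, 'k) mpoly \<Rightarrow> ('p, 'k) mpoly"
  is "(*)" .

instance
  by intro_classes (transfer, simp add: algebra_simps)+

end

lemma unique_product_partial:
  fixes A B :: "('p \<Rightarrow>\<^sub>0 nat) set"
  assumes "finite S" "finite A" "finite B" "A \<noteq> {}" "B \<noteq> {}"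
  shows "\<exists>A' B'. A' \<subseteq> A \<and> B' \<subseteq> B \<and> A' \<noteq> {} \<and> B' \<noteq> {} \<and>
    (\<forall>a\<in>A'. \<forall>a'\<in>A'. \<forall>x\<in>S. Poly_Mapping.lookup a x = Poly_Mapping.lookup a' x) \<and>
    (\<forall>a\<in>B'. \<forall>a'\<in>B'. \<forall>x\<in>S. Poly_Mapping.lookup a x = Poly_Mapping.lookup a' x) \<and>
    (\<forall>a\<in>A'. \<forall>b\<in>B'. \<forall>a'\<in>A. \<forall>b'\<in>B. a + b = a' + b' \<longrightarrow> a' \<in> A' \<and> b' \<in> B')"
  using assms(1)
proof (induction S rule: finite_induct)
  case empty
  show ?case using assms by (intro exI[of _ A] exI[of _ B]) auto
next
  case (insert x S)
  from insert.IH obtain A' B' where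
    AB: "A' \<subseteq> A" "B' \<subseteq> B" "A' \<noteq> {}" "B' \<noteq> {}"
    "\<forall>a\<in>A'. \<forall>a'\<in>A'. \<forall>x\<in>S. Poly_Mapping.lookup a x = Poly_Mapping.lookup a' x"
    "\<forall>a\<in>B'. \<forall>a'\<in>B'. \<forall>x\<in>S. Poly_Mapping.lookup a x = Poly_Mapping.lookup a' x"
    "\<forall>a\<in>A'. \<forall>b\<in>B'. \<forall>a'\<in>A. \<forall>b'\<in>B. a + b = a' + b' \<longrightarrow> a' \<in> A' \<and> b' \<in> B'"
    by (elim exE conjE) (rule that)
  have fin: "finite A'" "finite B'"
    using AB(1,2) assms(2,3) finite_subset by blast+
  let ?l = "\<lambda>m. Poly_Mapping.lookup m x"
  let ?A = "{a \<in> A'. ?l a = Max (?l ` A')}"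
  let ?B = "{b \<in> B'. ?l b = Max (?l ` B')}"
  have "Max (?l ` A') \<in> ?l ` A'" "Max (?l ` B') \<in> ?l ` B'"
    using fin AB(3,4) by (simp_all add: Max_in)
  then have ne: "?A \<noteq> {}" "?B \<noteq> {}"
    by fastforce+
  have cl: "a' \<in> ?A \<and> b' \<in> ?B"
    if "a \<in> ?A" "b \<in> ?B" "a' \<in> A" "b' \<in> B" "a + b = a' + b'" for a b a' b'
  proof -
    have in': "a' \<in> A'" "b' \<in> B'" using AB(7) that by auto
    have "?l a' \<le> ?l a" "?l b' \<le> ?l b"
      using in' that(1,2) fin by (auto intro: Max_ge)
    moreover have "?l a + ?l b = ?l a' + ?l b'"
      using that(5) by (metis lookup_add)
    ultimately show ?thesis using in' that(1,2) by auto
  qed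
  have sub: "?A \<subseteq> A" "?B \<subseteq> B" using AB(1,2) by blast+
  have agree: "\<forall>a\<in>?A. \<forall>a'\<in>?A. \<forall>x\<in>insert x S. Poly_Mapping.lookup a x = Poly_Mapping.lookup a' x"
    "\<forall>a\<in>?B. \<forall>a'\<in>?B. \<forall>x\<in>insert x S. Poly_Mapping.lookup a x = Poly_Mapping.lookup a' x"
    using AB(5,6) by auto
  have "\<forall>a\<in>?A. \<forall>b\<in>?B. \<forall>a'\<in>A. \<forall>b'\<in>B. a + b = a' + b' \<longrightarrow> a' \<in> ?A \<and> b' \<in> ?B"
    by (intro ballI impI) (rule cl)
  with sub ne agree show ?case
    by (intro exI[of _ ?A] exI[of _ ?B] conjI)
qed

lemma unique_product:
  fixes A B :: "('p \<Rightarrow>\<^sub>0 nat) set"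
  assumes "finite A" "finite B" "A \<noteq> {}" "B \<noteq> {}"
  obtains a b where "a \<in> A" "b \<in> B"
    "\<And>a' b'. a' \<in> A \<Longrightarrow> b' \<in> B \<Longrightarrow> a + b = a' + b' \<Longrightarrow> a' = a \<and> b' = b"
proof -
  define S where "S = (\<Union>m\<in>A \<union> B. Poly_Mapping.keys m)"
  have "finite S" using assms by (auto simp: S_def)
  from unique_product_partial[OF this assms] obtain A' B' where
    AB: "A' \<subseteq> A" "B' \<subseteq> B" "A' \<noteq> {}" "B' \<noteq> {}"
    "\<forall>a\<in>A'. \<forall>a'\<in>A'. \<forall>x\<in>S. Poly_Mapping.lookup a x = Poly_Mapping.lookup a' x"
    "\<forall>a\<in>B'. \<forall>a'\<in>B'. \<forall>x\<in>S. Poly_Mapping.lookup a x = Poly_Mapping.lookup a' x"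
    "\<forall>a\<in>A'. \<forall>b\<in>B'. \<forall>a'\<in>A. \<forall>b'\<in>B. a + b = a' + b' \<longrightarrow> a' \<in> A' \<and> b' \<in> B'"
    by (elim exE conjE) (rule that)
  have out: "Poly_Mapping.lookup m x = 0" if "m \<in> A \<union> B" "x \<notin> S" for m x
    using that unfolding S_def by (auto simp: in_keys_iff)
  have eqA: "a = a'" if "a \<in> A'" "a' \<in> A'" for a a'
  proof (rule poly_mapping_eqI)
    fix x show "Poly_Mapping.lookup a x = Poly_Mapping.lookup a' x"
    proof (cases "x \<in> S")
      case True
      then show ?thesis using AB(5) that by blast
    next
      case False
      moreover have "a \<in> A \<union> B" "a' \<in> A \<union> B" using that AB(1) by auto
      ultimately show ?thesis using out by simp
    qed
  qed
  have eqB: "a = a'" if "a \<in> B'" "a' \<in> B'" for a a'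
  proof (rule poly_mapping_eqI)
    fix x show "Poly_Mapping.lookup a x = Poly_Mapping.lookup a' x"
    proof (cases "x \<in> S")
      case True
      then show ?thesis using AB(6) that by blast
    next
      case False
      moreover have "a \<in> A \<union> B" "a' \<in> A \<union> B" using that AB(2) by auto
      ultimately show ?thesis using out by simp
    qed
  qed
  from AB(3,4) obtain a b where ab: "a \<in> A'" "b \<in> B'" by blast
  show thesis
  proof (rule that)
    show "a \<in> A" "b \<in> B" using ab AB(1,2) by auto
    fix a' b' assume "a' \<in> A" "b' \<in> B" "a + b = a' + b'"
    with AB(7) ab have "a' \<in> A' \<and> b' \<in> B'" by metis
    then show "a' = a \<and> b' = b" using eqA[of a' a] eqB[of b' b] ab by simp
  qed
qed

lemma mpoly_no_zero_divisors:
  fixes f g :: "('p \<Rightarrow>\<^sub>0 nat) \<Rightarrow>\<^sub>0 'k::idom"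
  assumes "f \<noteq> 0" "g \<noteq> 0"
  shows "f * g \<noteq> 0"
proof -
  have "Poly_Mapping.keys f \<noteq> {}" "Poly_Mapping.keys g \<noteq> {}" using assms by auto
  then obtain a b where ab: "a \<in> Poly_Mapping.keys f" "b \<in> Poly_Mapping.keys g"
    "\<And>a' b'. a' \<in> Poly_Mapping.keys f \<Longrightarrow> b' \<in> Poly_Mapping.keys g \<Longrightarrow> a + b = a' + b' \<Longrightarrow> a' = a \<and> b' = b"
    using unique_product[of "Poly_Mapping.keys f" "Poly_Mapping.keys g"] by auto
  have "Poly_Mapping.lookup (f * g) (a + b) =
      (\<Sum>(a', b'). Poly_Mapping.lookup f a' * Poly_Mapping.lookup g b' when a + b = a' + b')"
    unfolding times_poly_mapping.rep_eq by (rule prod_fun_unfold_prod) simp_all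
  also have "(\<lambda>(a', b'). Poly_Mapping.lookup f a' * Poly_Mapping.lookup g b' when a + b = a' + b') =
      (\<lambda>p. (\<lambda>(a', b'). Poly_Mapping.lookup f a' * Poly_Mapping.lookup g b') p when p = (a, b))"
  proof (rule ext, clarify)
    fix a' b'
    show "(Poly_Mapping.lookup f a' * Poly_Mapping.lookup g b' when a + b = a' + b') =
      (Poly_Mapping.lookup f a' * Poly_Mapping.lookup g b' when (a', b') = (a, b))"
      using ab(3)[of a' b'] by (auto simp: when_def in_keys_iff)
  qed
  also have "(\<Sum>p. (\<lambda>(a', b'). Poly_Mapping.lookup f a' * Poly_Mapping.lookup g b') p when p = (a, b)) =
      Poly_Mapping.lookup f a * Poly_Mapping.lookup g b"
    by simp
  also have "\<dots> \<noteq> 0" using ab(1,2) by (simp add: in_keys_iff)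
  finally show ?thesis by auto
qed

instance mpoly :: (type, idom) idom
  by intro_classes (transfer, rule mpoly_no_zero_divisors)

lift_definition mvar :: "'p \<Rightarrow> ('p, 'k::comm_ring_1) mpoly"
  is "\<lambda>x. Poly_Mapping.single (Poly_Mapping.single x 1) 1" .

lift_definition mconst :: "'k \<Rightarrow> ('p, 'k::comm_ring_1) mpoly"
  is "\<lambda>c. Poly_Mapping.single 0 c" .

definition mvars :: "('p, 'k::zero) mpoly \<Rightarrow> 'p set"
  where "mvars P = (\<Union>m\<in>Poly_Mapping.keys (mcoeffs P). Poly_Mapping.keys m)"

definition mpolys :: "'p set \<Rightarrow> ('p, 'k::zero) mpoly set"
  where "mpolys \<Psi> = {P. mvars P \<subseteq> \<Psi>}"

definition mdeg :: "('p \<Rightarrow>\<^sub>0 nat) \<Rightarrow> nat"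
  where "mdeg m = (\<Sum>x\<in>Poly_Mapping.keys m. Poly_Mapping.lookup m x)"

definition mhomogeneous :: "nat \<Rightarrow> ('p, 'k::zero) mpoly \<Rightarrow> bool"
  where "mhomogeneous n P \<longleftrightarrow> (\<forall>m\<in>Poly_Mapping.keys (mcoeffs P). mdeg m = n)"

text \<open>
  For a bijection \<open>g\<close>, \<open>mperm g\<close> substitutes the variable \<open>g x\<close> for \<open>x\<close>: the coefficient
  of \<open>mperm g P\<close> at a monomial with exponents \<open>m\<close> is that of \<open>P\<close> at \<open>m \<circ> g\<close>. The lemmas
  \<open>mperm_mvar\<close>, \<open>mperm_mconst\<close>, \<open>mperm_add\<close> and \<open>mperm_mult\<close> below confirm this.
\<close>

lift_definition mperm :: "('p \<Rightarrow> 'p) \<Rightarrow> ('p, 'k::zero) mpoly \<Rightarrow> ('p, 'k) mpoly"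
  is "\<lambda>g. Poly_Mapping.map_key (Poly_Mapping.map_key g)" .


section \<open>Rational functions\<close>

type_synonym ('p, 'k) ratfun = "('p, 'k) mpoly fract"

definition ratfuns :: "'p set \<Rightarrow> ('p, 'k::field) ratfun set"
  where "ratfuns \<Psi> = {Fract P Q | P Q. P \<in> mpolys \<Psi> \<and> Q \<in> mpolys \<Psi> \<and> Q \<noteq> 0}"

text \<open>Well defined for bijections \<open>g\<close> by \<open>rf_perm_Fract\<close> below.\<close>

definition rf_perm :: "('p \<Rightarrow> 'p) \<Rightarrow> ('p, 'k::field) ratfun \<Rightarrow> ('p, 'k) ratfun"
  where "rf_perm g q =
    (THE r. \<exists>P Q. Q \<noteq> 0 \<and> q = Fract P Q \<and> r = Fract (mperm g P) (mperm g Q))"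

definition hom_ratfuns :: "'p set \<Rightarrow> int \<Rightarrow> ('p, 'k::field) ratfun set"
  where "hom_ratfuns \<Psi> d = {q \<in> ratfuns \<Psi>. q = 0 \<or>
    (\<exists>P\<in>mpolys \<Psi>. \<exists>Q\<in>mpolys \<Psi>. \<exists>m n. Q \<noteq> 0 \<and> mhomogeneous m P \<and> mhomogeneous n Q \<and>
      int m - int n = d \<and> q = Fract P Q)}"


section \<open>Semilinear representations\<close>

text \<open>
  A representation is a module record extended by the action of the group; the fields \<open>mult\<close>
  and \<open>one\<close>, which module records inherit from ring records, play no role.
\<close>

record ('r, 'g, 'm) rep = "('r, 'm) module" +
  gact :: "'g \<Rightarrow> 'm \<Rightarrow> 'm"

locale field_action = G: Group.group G + K: Ring.field K
  for G :: "('g, 'x) monoid_scheme" and K :: "('r, 'y) ring_scheme"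
    and \<sigma> :: "'g \<Rightarrow> 'r \<Rightarrow> 'r" +
  assumes act_ring_hom: "g \<in> carrier G \<Longrightarrow> \<sigma> g \<in> ring_hom K K"
    and act_field_one: "a \<in> carrier K \<Longrightarrow> \<sigma> \<one>\<^bsub>G\<^esub> a = a"
    and act_field_mult: "\<lbrakk>g \<in> carrier G; h \<in> carrier G; a \<in> carrier K\<rbrakk> \<Longrightarrow>
      \<sigma> (g \<otimes>\<^bsub>G\<^esub> h) a = \<sigma> g (\<sigma> h a)"

locale semilinear_rep = field_action G K \<sigma> + Module.module K V
  for G :: "('g, 'x) monoid_scheme" and K :: "('r, 'y) ring_scheme"
    and \<sigma> :: "'g \<Rightarrow> 'r \<Rightarrow> 'r" and V :: "('r, 'g, 'v) rep" +
  assumes gact_closed: "\<lbrakk>g \<in> carrier G; v \<in> carrier V\<rbrakk> \<Longrightarrow> gact V g v \<in> carrier V"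
    and gact_one: "v \<in> carrier V \<Longrightarrow> gact V \<one>\<^bsub>G\<^esub> v = v"
    and gact_mult: "\<lbrakk>g \<in> carrier G; h \<in> carrier G; v \<in> carrier V\<rbrakk> \<Longrightarrow>
      gact V (g \<otimes>\<^bsub>G\<^esub> h) v = gact V g (gact V h v)"
    and gact_add: "\<lbrakk>g \<in> carrier G; v \<in> carrier V; w \<in> carrier V\<rbrakk> \<Longrightarrow>
      gact V g (v \<oplus>\<^bsub>V\<^esub> w) = gact V g v \<oplus>\<^bsub>V\<^esub> gact V g w"
    and gact_smult: "\<lbrakk>g \<in> carrier G; a \<in> carrier K; v \<in> carrier V\<rbrakk> \<Longrightarrow>
      gact V g (a \<odot>\<^bsub>V\<^esub> v) = \<sigma> g a \<odot>\<^bsub>V\<^esub> gact V g v"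

locale smooth_semilinear_rep = semilinear_rep G K \<sigma> V
  for G :: "('g, 'x) monoid_scheme" and T :: "'g topology" and K :: "('r, 'y) ring_scheme"
    and \<sigma> :: "'g \<Rightarrow> 'r \<Rightarrow> 'r" and V :: "('r, 'g, 'v) rep" +
  assumes smooth: "v \<in> carrier V \<Longrightarrow> openin T (stabilizer G (gact V) v)"

definition rep_hom :: "('g, 'x) monoid_scheme \<Rightarrow> ('r, 'y) ring_scheme \<Rightarrow>
    ('r, 'g, 'v) rep \<Rightarrow> ('r, 'g, 'w) rep \<Rightarrow> ('v \<Rightarrow> 'w) set"
  where "rep_hom G K V W = {f \<in> carrier V \<rightarrow> carrier W.
    (\<forall>v\<in>carrier V. \<forall>v'\<in>carrier V. f (v \<oplus>\<^bsub>V\<^esub> v') = f v \<oplus>\<^bsub>W\<^esub> f v') \<and>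
    (\<forall>a\<in>carrier K. \<forall>v\<in>carrier V. f (a \<odot>\<^bsub>V\<^esub> v) = a \<odot>\<^bsub>W\<^esub> f v) \<and>
    (\<forall>g\<in>carrier G. \<forall>v\<in>carrier V. f (gact V g v) = gact W g (f v))}"

definition rep_mono :: "('g, 'x) monoid_scheme \<Rightarrow> ('r, 'y) ring_scheme \<Rightarrow>
    ('r, 'g, 'v) rep \<Rightarrow> ('r, 'g, 'w) rep \<Rightarrow> ('v \<Rightarrow> 'w) set"
  where "rep_mono G K V W = {f \<in> rep_hom G K V W. inj_on f (carrier V)}"

definition rep_iso :: "('g, 'x) monoid_scheme \<Rightarrow> ('r, 'y) ring_scheme \<Rightarrow>
    ('r, 'g, 'v) rep \<Rightarrow> ('r, 'g, 'w) rep \<Rightarrow> bool"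
  where "rep_iso G K V W \<longleftrightarrow> (\<exists>f\<in>rep_hom G K V W. bij_betw f (carrier V) (carrier W))"

definition subrep :: "('g, 'x) monoid_scheme \<Rightarrow> ('r, 'y) ring_scheme \<Rightarrow>
    ('r, 'g, 'v) rep \<Rightarrow> 'v set \<Rightarrow> bool"
  where "subrep G K V U \<longleftrightarrow> submodule U K V \<and> (\<forall>g\<in>carrier G. \<forall>u\<in>U. gact V g u \<in> U)"

text \<open>
  Finite length means that there is a composition series \<open>0 = U 0 \<subset> U 1 \<subset> \<dots> \<subset> U n = V\<close>;
  the quotient \<open>U (i+1) / U i\<close> is simple iff no subrepresentation lies strictly in between.
\<close>

definition finite_length :: "('g, 'x) monoid_scheme \<Rightarrow> ('r, 'y) ring_scheme \<Rightarrow>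
    ('r, 'g, 'v) rep \<Rightarrow> bool"
  where "finite_length G K V \<longleftrightarrow>
    (\<exists>n U. U 0 = {\<zero>\<^bsub>V\<^esub>} \<and> U n = carrier V \<and> (\<forall>i\<le>n. subrep G K V (U i)) \<and>
      (\<forall>i<n. U i \<subset> U (Suc i) \<and> \<not> (\<exists>W. subrep G K V W \<and> U i \<subset> W \<and> W \<subset> U (Suc i))))"

definition rep_prod :: "'i set \<Rightarrow> ('i \<Rightarrow> ('r, 'g, 'v) rep) \<Rightarrow> ('r, 'g, 'i \<Rightarrow> 'v) rep"
  where "rep_prod I R =
    \<lparr>carrier = (\<Pi>\<^sub>E i\<in>I. carrier (R i)), mult = undefined, one = undefined,
     zero = (\<lambda>i\<in>I. \<zero>\<^bsub>R i\<^esub>), add = (\<lambda>u v. \<lambda>i\<in>I. u i \<oplus>\<^bsub>R i\<^esub> v i),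
     smult = (\<lambda>a v. \<lambda>i\<in>I. a \<odot>\<^bsub>R i\<^esub> v i), gact = (\<lambda>g v. \<lambda>i\<in>I. gact (R i) g (v i))\<rparr>"

definition rep_power :: "('r, 'g, 'v) rep \<Rightarrow> 'i set \<Rightarrow> ('r, 'g, 'i \<Rightarrow> 'v) rep"
  where "rep_power R I = rep_prod I (\<lambda>_. R)"

definition rep_dsum :: "'i set \<Rightarrow> ('i \<Rightarrow> ('r, 'g, 'v) rep) \<Rightarrow> ('r, 'g, 'i \<Rightarrow> 'v) rep"
  where "rep_dsum I R = (rep_prod I R)
    \<lparr>carrier := {v \<in> carrier (rep_prod I R). finite {i \<in> I. v i \<noteq> \<zero>\<^bsub>R i\<^esub>}}\<rparr>"


section \<open>The symmetric group and the representations of homogeneous rational functions\<close>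

definition Sym :: "'p set \<Rightarrow> ('p \<Rightarrow> 'p) monoid"
  where "Sym \<Psi> = \<lparr>carrier = {g. g permutes \<Psi>}, mult = (\<circ>), one = id\<rparr>"

definition pointwise_stabilizer :: "'p set \<Rightarrow> 'p set \<Rightarrow> ('p \<Rightarrow> 'p) set"
  where "pointwise_stabilizer \<Psi> F = {g \<in> carrier (Sym \<Psi>). \<forall>x\<in>F. g x = x}"

text \<open>
  The group topology in which the pointwise stabilizers of finite subsets form a base of
  neighbourhoods of the identity; \<open>openin_Sym_topology\<close> shows that the predicate is a topology.
\<close>

definition Sym_topology :: "'p set \<Rightarrow> ('p \<Rightarrow> 'p) topology"
  where "Sym_topology \<Psi> = topology (\<lambda>U. U \<subseteq> carrier (Sym \<Psi>) \<and>
    (\<forall>g\<in>U. \<exists>F. finite F \<and> F \<subseteq> \<Psi> \<and> (\<lambda>h. g \<circ> h) ` pointwise_stabilizer \<Psi> F \<subseteq> U))"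

definition V0_field :: "'p set \<Rightarrow> ('p, 'k::field) ratfun ring"
  where "V0_field \<Psi> = \<lparr>carrier = hom_ratfuns \<Psi> 0, mult = (*), one = 1, zero = 0, add = (+)\<rparr>"

definition V_rep :: "'p set \<Rightarrow> int \<Rightarrow> (('p, 'k::field) ratfun, 'p \<Rightarrow> 'p, ('p, 'k) ratfun) rep"
  where "V_rep \<Psi> d = \<lparr>carrier = hom_ratfuns \<Psi> d, mult = undefined, one = undefined,
    zero = 0, add = (+), smult = (*), gact = rf_perm\<rparr>"

definition smooth_V0_rep :: "'p set \<Rightarrow> (('p, 'k::field) ratfun, 'p \<Rightarrow> 'p, 'v) rep \<Rightarrow> bool"
  where "smooth_V0_rep \<Psi> V \<longleftrightarrow>
    smooth_semilinear_rep (Sym \<Psi>) (Sym_topology \<Psi>) (V0_field \<Psi>) rf_perm V"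


section \<open>The field \<open>V\<^sub>0\<close> and its smooth representations \<open>V\<^sub>d\<close>\<close>

lemma lookup_map_key: "inj f \<Longrightarrow> Poly_Mapping.lookup (Poly_Mapping.map_key f p) x = Poly_Mapping.lookup p (f x)"
  by (simp add: map_key.rep_eq)

lemma bij_map_key:
  fixes g :: "'p \<Rightarrow> 'p"
  assumes "bij g"
  shows "bij (Poly_Mapping.map_key g :: ('p \<Rightarrow>\<^sub>0 'c::zero) \<Rightarrow> _)"
proof (rule o_bij)
  have i: "inj g" "inj (inv_into UNIV g)" using assms by (auto simp: bij_is_inj bij_imp_bij_inv)
  have s: "surj g" using assms by (rule bij_is_surj)
  show "Poly_Mapping.map_key (inv_into UNIV g) \<circ> Poly_Mapping.map_key g = id"
    by (rule ext, rule poly_mapping_eqI) (simp add: lookup_map_key i surj_f_inv_f[OF s])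
  show "Poly_Mapping.map_key g \<circ> Poly_Mapping.map_key (inv_into UNIV g) = id"
    by (rule ext, rule poly_mapping_eqI) (simp add: lookup_map_key i)
qed

lemma lookup_mperm:
  assumes "bij g"
  shows "Poly_Mapping.lookup (mcoeffs (mperm g P)) m =
    Poly_Mapping.lookup (mcoeffs P) (Poly_Mapping.map_key g m)"
  using bij_is_inj[OF bij_map_key[OF assms, where 'c = nat]] by (simp add: mperm.rep_eq lookup_map_key)

lemma mpoly_eqI:
  "(\<And>m. Poly_Mapping.lookup (mcoeffs P) m = Poly_Mapping.lookup (mcoeffs Q) m) \<Longrightarrow> P = Q"
  by (simp add: mcoeffs_inject[symmetric] poly_mapping_eqI)

lemma mperm_mult:
  fixes P Q :: "('p, 'k::comm_ring_1) mpoly"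
  assumes "bij g"
  shows "mperm g (P * Q) = mperm g P * mperm g Q"
proof (rule mpoly_eqI)
  fix m :: "'p \<Rightarrow>\<^sub>0 nat"
  let ?k = "Poly_Mapping.map_key g :: ('p \<Rightarrow>\<^sub>0 nat) \<Rightarrow> _"
  have b: "bij ?k" by (rule bij_map_key[OF assms])
  have i: "inj g" using assms by (rule bij_is_inj)
  have b2: "bij (map_prod ?k ?k)" using b by (auto simp: bij_def map_prod_surj prod.inj_map)
  have "Poly_Mapping.lookup (mcoeffs (mperm g (P * Q))) m =
    (\<Sum>(a, b). Poly_Mapping.lookup (mcoeffs P) a * Poly_Mapping.lookup (mcoeffs Q) b when ?k m = a + b)"
    unfolding lookup_mperm[OF assms] times_mpoly.rep_eq times_poly_mapping.rep_eq
    by (rule prod_fun_unfold_prod) simp_all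
  also have "\<dots> = (\<Sum>(a, b). Poly_Mapping.lookup (mcoeffs P) (?k a) * Poly_Mapping.lookup (mcoeffs Q) (?k b) when m = a + b)"
    by (rule Sum_any.reindex_cong[where l = "map_prod ?k ?k"])
       (use b2 b in \<open>auto simp: fun_eq_iff bij_is_surj map_key_plus[OF i, symmetric] inj_eq[OF bij_is_inj[OF b]] intro: bij_is_inj\<close>)
  also have "\<dots> = Poly_Mapping.lookup (mcoeffs (mperm g P * mperm g Q)) m"
    unfolding times_mpoly.rep_eq times_poly_mapping.rep_eq lookup_mperm[OF assms, symmetric]
    by (rule prod_fun_unfold_prod[symmetric]) simp_all
  finally show "Poly_Mapping.lookup (mcoeffs (mperm g (P * Q))) m =
    Poly_Mapping.lookup (mcoeffs (mperm g P * mperm g Q)) m" .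
qed

lemma mperm_add:
  "bij g \<Longrightarrow> mperm g (P + Q) = mperm g P + mperm g (Q :: ('p, 'k::comm_ring_1) mpoly)"
  by (rule mpoly_eqI) (simp add: lookup_mperm plus_mpoly.rep_eq lookup_add)

lemma mperm_inj: "bij g \<Longrightarrow> inj (mperm g :: ('p, 'k::zero) mpoly \<Rightarrow> _)"
proof (rule injI)
  fix P Q :: "('p, 'k) mpoly"
  assume g: "bij g" and e: "mperm g P = mperm g Q"
  show "P = Q"
  proof (rule mpoly_eqI)
    fix m :: "'p \<Rightarrow>\<^sub>0 nat"
    obtain m' where "m = Poly_Mapping.map_key g m'" using bij_map_key[OF g] by (metis bij_pointE)
    then show "Poly_Mapping.lookup (mcoeffs P) m = Poly_Mapping.lookup (mcoeffs Q) m"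
      using lookup_mperm[OF g] e by metis
  qed
qed

lemma mperm_zero [simp]: "bij g \<Longrightarrow> mperm g (0 :: ('p, 'k::comm_ring_1) mpoly) = 0"
  by (rule mpoly_eqI) (simp add: lookup_mperm zero_mpoly.rep_eq)

lemma mperm_eq_zero_iff [simp]: "bij g \<Longrightarrow> mperm g P = 0 \<longleftrightarrow> P = (0 :: ('p, 'k::comm_ring_1) mpoly)"
  by (metis mperm_zero mperm_inj injD)

lemma mperm_mconst [simp]:
  assumes "bij g" shows "mperm g (mconst c) = mconst c"
proof -
  have "Poly_Mapping.map_key g m = 0 \<longleftrightarrow> m = 0" for m :: "'a \<Rightarrow>\<^sub>0 nat"
    using bij_map_key[OF assms] map_key_zero[OF bij_is_inj[OF assms]]
    by (metis bij_is_inj injD)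
  then show ?thesis
    by (intro mpoly_eqI) (simp add: lookup_mperm assms mconst.rep_eq lookup_single when_def eq_commute[of 0])
qed

lemma mconst_one: "mconst 1 = 1"
  by transfer simp

lemma mperm_one [simp]: "bij g \<Longrightarrow> mperm g (1 :: ('p, 'k::comm_ring_1) mpoly) = 1"
  by (metis mperm_mconst mconst_one)

lemma mperm_mvar [simp]:
  assumes "bij g" shows "mperm g (mvar x) = mvar (g x)"
proof (rule mpoly_eqI)
  fix m :: "'a \<Rightarrow>\<^sub>0 nat"
  have "Poly_Mapping.map_key g (Poly_Mapping.single (g x) 1) = Poly_Mapping.single x (1::nat)"
    by (rule map_key_single[OF bij_is_inj[OF assms]])
  then have "Poly_Mapping.map_key g m = Poly_Mapping.single x 1 \<longleftrightarrow> m = Poly_Mapping.single (g x) 1"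
    using bij_map_key[OF assms] by (metis bij_is_inj injD)
  then show "Poly_Mapping.lookup (mcoeffs (mperm g (mvar x))) m = Poly_Mapping.lookup (mcoeffs (mvar (g x))) m"
    by (simp add: lookup_mperm assms mvar.rep_eq lookup_single when_def eq_commute[of "Poly_Mapping.single _ _"])
qed

lemma mperm_comp: "bij g \<Longrightarrow> bij h \<Longrightarrow> mperm (g \<circ> h) P = mperm g (mperm h P)"
  by (rule mpoly_eqI) (simp add: lookup_mperm bij_comp map_key_compose bij_is_inj)

lemma mperm_id [simp]: "mperm id P = P"
  by (rule mpoly_eqI) (simp add: lookup_mperm map_key_id[folded id_def])

lemma rf_perm_Fract:
  assumes g: "bij g" and Q: "Q \<noteq> 0"
  shows "rf_perm g (Fract P Q) = Fract (mperm g P) (mperm g Q)"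
  unfolding rf_perm_def
proof (rule the_equality)
  show "\<exists>P' Q'. Q' \<noteq> 0 \<and> Fract P Q = Fract P' Q' \<and> Fract (mperm g P) (mperm g Q) = Fract (mperm g P') (mperm g Q')"
    using Q by blast
next
  fix r assume "\<exists>P' Q'. Q' \<noteq> 0 \<and> Fract P Q = Fract P' Q' \<and> r = Fract (mperm g P') (mperm g Q')"
  then obtain P' Q' where *: "Q' \<noteq> 0" "P * Q' = P' * Q" "r = Fract (mperm g P') (mperm g Q')"
    using Q by (auto simp: eq_fract)
  then have "mperm g P * mperm g Q' = mperm g P' * mperm g Q"
    by (metis mperm_mult[OF g])
  then show "r = Fract (mperm g P) (mperm g Q)"
    using * Q g by (simp add: eq_fract)
qed

lemma rf_perm_add: "bij g \<Longrightarrow> rf_perm g (p + q) = rf_perm g p + rf_perm g q"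
  by (cases p; cases q) (simp add: rf_perm_Fract mperm_mult mperm_add)

lemma rf_perm_mult: "bij g \<Longrightarrow> rf_perm g (p * q) = rf_perm g p * rf_perm g q"
  by (cases p; cases q) (simp add: rf_perm_Fract mperm_mult)

lemma rf_perm_one: "bij g \<Longrightarrow> rf_perm g 1 = 1"
  by (simp add: One_fract_def rf_perm_Fract)

lemma rf_perm_zero: "bij g \<Longrightarrow> rf_perm g 0 = 0"
  by (simp add: Zero_fract_def rf_perm_Fract)

lemma rf_perm_comp: "bij g \<Longrightarrow> bij h \<Longrightarrow> rf_perm (g \<circ> h) q = rf_perm g (rf_perm h q)"
  by (cases q) (simp add: rf_perm_Fract mperm_comp bij_comp)

lemma rf_perm_id: "rf_perm id q = q"
  by (cases q) (simp add: rf_perm_Fract)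

lemma keys_mperm:
  "bij g \<Longrightarrow> m \<in> Poly_Mapping.keys (mcoeffs (mperm g P)) \<longleftrightarrow> Poly_Mapping.map_key g m \<in> Poly_Mapping.keys (mcoeffs P)"
  by (simp add: in_keys_iff lookup_mperm)

lemma mperm_in_mpolys:
  assumes "g permutes \<Psi>" "P \<in> mpolys \<Psi>"
  shows "mperm g P \<in> mpolys \<Psi>"
  unfolding mpolys_def mvars_def mem_Collect_eq
proof (intro UN_least subsetI)
  fix m x assume m: "m \<in> Poly_Mapping.keys (mcoeffs (mperm g P))" and x: "x \<in> Poly_Mapping.keys m"
  have g: "bij g" using assms(1) by (rule permutes_bij)
  obtain y where y: "x = g y" using g by (metis bij_pointE)
  have "y \<in> Poly_Mapping.keys (Poly_Mapping.map_key g m)"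
    using x y by (simp add: in_keys_iff lookup_map_key bij_is_inj[OF g])
  then have "y \<in> \<Psi>" using m assms(2) unfolding mpolys_def mvars_def keys_mperm[OF g] by blast
  then show "x \<in> \<Psi>" using y permutes_in_image[OF assms(1)] by simp
qed

lemma mdeg_superset:
  "finite S \<Longrightarrow> Poly_Mapping.keys m \<subseteq> S \<Longrightarrow> mdeg m = (\<Sum>x\<in>S. Poly_Mapping.lookup m x)"
  unfolding mdeg_def by (rule sum.mono_neutral_left) (auto simp: in_keys_iff)

lemma mdeg_add: "mdeg (a + b) = mdeg a + mdeg b"
proof -
  let ?S = "Poly_Mapping.keys a \<union> Poly_Mapping.keys b"
  have "Poly_Mapping.keys (a + b) \<subseteq> ?S" by (rule Poly_Mapping.keys_add)
  then show ?thesis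
    by (simp add: mdeg_superset[of ?S] lookup_add sum.distrib)
qed

lemma mdeg_map_key:
  assumes g: "bij g" shows "mdeg (Poly_Mapping.map_key g m) = mdeg m"
proof -
  have b: "bij_betw g (g -` Poly_Mapping.keys m) (Poly_Mapping.keys m)"
    using g by (simp add: bij_betw_def surj_image_vimage_eq inj_on_subset[OF _ subset_UNIV])
  show ?thesis
    unfolding mdeg_def keys_map_key[OF bij_is_inj[OF g]]
    using sum.reindex_bij_betw[OF b, of "Poly_Mapping.lookup m"]
    by (simp add: lookup_map_key[OF bij_is_inj[OF g]])
qed

lemma mhomogeneous_mperm: "bij g \<Longrightarrow> mhomogeneous n P \<Longrightarrow> mhomogeneous n (mperm g P)"
  unfolding mhomogeneous_def using keys_mperm mdeg_map_key by metis

lemma mhomogeneous_mult: "mhomogeneous m P \<Longrightarrow> mhomogeneous n Q \<Longrightarrow> mhomogeneous (m + n) (P * Q)"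
  unfolding mhomogeneous_def times_mpoly.rep_eq
  using Poly_Mapping.keys_mult[of "mcoeffs P" "mcoeffs Q"] by (fastforce simp: mdeg_add)

lemma mhomogeneous_add: "mhomogeneous n P \<Longrightarrow> mhomogeneous n Q \<Longrightarrow> mhomogeneous n (P + Q)"
  unfolding mhomogeneous_def plus_mpoly.rep_eq
  using Poly_Mapping.keys_add[of "mcoeffs P" "mcoeffs Q"] by blast

lemma mhomogeneous_uminus: "mhomogeneous n P \<Longrightarrow> mhomogeneous n (- P :: ('p, 'k::comm_ring_1) mpoly)"
  unfolding mhomogeneous_def uminus_mpoly.rep_eq by (simp add: in_keys_iff)

lemma mhomogeneous_one: "mhomogeneous 0 1"
  unfolding mhomogeneous_def one_mpoly.rep_eq by (simp add: in_keys_iff lookup_one mdeg_def)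

lemma mpolys_closed:
  fixes P Q :: "('p, 'k::comm_ring_1) mpoly"
  shows "P \<in> mpolys \<Psi> \<Longrightarrow> Q \<in> mpolys \<Psi> \<Longrightarrow> P + Q \<in> mpolys \<Psi>"
    and "P \<in> mpolys \<Psi> \<Longrightarrow> Q \<in> mpolys \<Psi> \<Longrightarrow> P * Q \<in> mpolys \<Psi>"
    and "P \<in> mpolys \<Psi> \<Longrightarrow> - P \<in> mpolys \<Psi>"
    and "(1 :: ('p, 'k) mpoly) \<in> mpolys \<Psi>" and "(0 :: ('p, 'k) mpoly) \<in> mpolys \<Psi>"
proof -
  assume P: "P \<in> mpolys \<Psi>"
  then have P': "Poly_Mapping.keys m \<subseteq> \<Psi>" if "m \<in> Poly_Mapping.keys (mcoeffs P)" for m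
    using that unfolding mpolys_def mvars_def by blast
  { assume "Q \<in> mpolys \<Psi>"
    then have Q': "Poly_Mapping.keys m \<subseteq> \<Psi>" if "m \<in> Poly_Mapping.keys (mcoeffs Q)" for m
      using that unfolding mpolys_def mvars_def by blast
    show "P + Q \<in> mpolys \<Psi>"
      unfolding mpolys_def mvars_def plus_mpoly.rep_eq mem_Collect_eq
      using P' Q' Poly_Mapping.keys_add[of "mcoeffs P" "mcoeffs Q"] by blast
    show "P * Q \<in> mpolys \<Psi>"
      unfolding mpolys_def mvars_def times_mpoly.rep_eq mem_Collect_eq
    proof (rule UN_least)
      fix m assume "m \<in> Poly_Mapping.keys (mcoeffs P * mcoeffs Q)"
      then obtain a b where "a \<in> Poly_Mapping.keys (mcoeffs P)" "b \<in> Poly_Mapping.keys (mcoeffs Q)" "m = a + b"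
        using Poly_Mapping.keys_mult[of "mcoeffs P" "mcoeffs Q"] by blast
      then show "Poly_Mapping.keys m \<subseteq> \<Psi>"
        using P' Q' Poly_Mapping.keys_add[of a b] by blast
    qed }
  have "Poly_Mapping.keys (mcoeffs (- P)) = Poly_Mapping.keys (mcoeffs P)"
    by (simp add: uminus_mpoly.rep_eq Poly_Mapping.keys_eq_empty set_eq_iff in_keys_iff)
  then show "- P \<in> mpolys \<Psi>" using P unfolding mpolys_def mvars_def by simp
next
  show "(1 :: ('p, 'k) mpoly) \<in> mpolys \<Psi>" "(0 :: ('p, 'k) mpoly) \<in> mpolys \<Psi>"
    by (auto simp: mpolys_def mvars_def one_mpoly.rep_eq zero_mpoly.rep_eq)
qed

lemma hom_ratfuns_iff:
  "q \<in> hom_ratfuns \<Psi> d \<longleftrightarrow> q = 0 \<or> (\<exists>P\<in>mpolys \<Psi>. \<exists>Q\<in>mpolys \<Psi>. \<exists>m n. Q \<noteq> 0 \<and> mhomogeneous m P \<and> mhomogeneous n Q \<and>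
      int m - int n = d \<and> q = Fract P Q)"
proof -
  have "0 \<in> ratfuns \<Psi>"
    unfolding ratfuns_def Zero_fract_def using mpolys_closed(4,5) one_neq_zero by blast
  then show ?thesis unfolding hom_ratfuns_def ratfuns_def by blast
qed

lemma hom_ratfunsE:
  assumes "q \<in> hom_ratfuns \<Psi> d"
  obtains "q = 0" | P Q m n where "q \<noteq> 0" "P \<noteq> 0" "P \<in> mpolys \<Psi>" "Q \<in> mpolys \<Psi>" "Q \<noteq> 0" "mhomogeneous m P"
    "mhomogeneous n Q" "int m - int n = d" "q = Fract P Q"
  using assms that unfolding hom_ratfuns_iff by (metis fract_collapse(1))

lemma hom_ratfunsI:
  "P \<in> mpolys \<Psi> \<Longrightarrow> Q \<in> mpolys \<Psi> \<Longrightarrow> Q \<noteq> 0 \<Longrightarrow> mhomogeneous m P \<Longrightarrow> mhomogeneous n Q \<Longrightarrow>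
    int m - int n = d \<Longrightarrow> Fract P Q \<in> hom_ratfuns \<Psi> d"
  unfolding hom_ratfuns_iff by blast

lemma hom_zero: "0 \<in> hom_ratfuns \<Psi> d"
  by (simp add: hom_ratfuns_iff)

lemma hom_one: "1 \<in> hom_ratfuns \<Psi> 0"
  unfolding One_fract_def
  by (rule hom_ratfunsI[where m = 0 and n = 0]) (auto simp: mpolys_closed mhomogeneous_one)

lemma hom_add:
  assumes "p \<in> hom_ratfuns \<Psi> d" "q \<in> hom_ratfuns \<Psi> d" shows "p + q \<in> hom_ratfuns \<Psi> d"
  using assms(1)
proof (cases rule: hom_ratfunsE)
  case 1 then show ?thesis using assms by simp
next
  case p: (2 P Q m n)
  show ?thesis using assms(2)
  proof (cases rule: hom_ratfunsE)
    case 1 then show ?thesis using assms by simp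
  next
    case q: (2 P' Q' m' n')
    have "m' + n = m + n'" using p(8) q(8) by linarith
    then have "mhomogeneous (m + n') (P * Q' + P' * Q)"
      using mhomogeneous_mult[OF p(6) q(7)] mhomogeneous_mult[OF q(6) p(7)] by (simp add: mhomogeneous_add)
    moreover have "mhomogeneous (n + n') (Q * Q')" using p(7) q(7) by (rule mhomogeneous_mult)
    ultimately have "Fract (P * Q' + P' * Q) (Q * Q') \<in> hom_ratfuns \<Psi> d"
      using p q by (intro hom_ratfunsI[where m = "m + n'" and n = "n + n'"]) (auto simp: mpolys_closed)
    then show ?thesis using p q by simp
  qed
qed

lemma hom_mult:
  assumes "p \<in> hom_ratfuns \<Psi> d" "q \<in> hom_ratfuns \<Psi> e" shows "p * q \<in> hom_ratfuns \<Psi> (d + e)"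
  using assms(1)
proof (cases rule: hom_ratfunsE)
  case 1 then show ?thesis by (simp add: hom_zero)
next
  case p: (2 P Q m n)
  show ?thesis using assms(2)
  proof (cases rule: hom_ratfunsE)
    case 1 then show ?thesis by (simp add: hom_zero)
  next
    case q: (2 P' Q' m' n')
    have "Fract (P * P') (Q * Q') \<in> hom_ratfuns \<Psi> (d + e)"
      using p q mhomogeneous_mult[OF p(6) q(6)] mhomogeneous_mult[OF p(7) q(7)]
      by (intro hom_ratfunsI[where m = "m + m'" and n = "n + n'"]) (auto simp: mpolys_closed)
    then show ?thesis using p q by simp
  qed
qed

lemma hom_uminus: "p \<in> hom_ratfuns \<Psi> d \<Longrightarrow> - p \<in> hom_ratfuns \<Psi> d"
  by (erule hom_ratfunsE) (auto simp: hom_zero mpolys_closed mhomogeneous_uminus intro!: hom_ratfunsI)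

lemma hom_inverse: "p \<in> hom_ratfuns \<Psi> d \<Longrightarrow> inverse p \<in> hom_ratfuns \<Psi> (- d)"
  by (erule hom_ratfunsE) (auto simp: hom_zero intro!: hom_ratfunsI)

lemma hom_perm: "g permutes \<Psi> \<Longrightarrow> p \<in> hom_ratfuns \<Psi> d \<Longrightarrow> rf_perm g p \<in> hom_ratfuns \<Psi> d"
  by (erule hom_ratfunsE)
     (auto simp: hom_zero rf_perm_zero permutes_bij rf_perm_Fract mperm_in_mpolys mhomogeneous_mperm intro!: hom_ratfunsI)

lemma istopology_Sym:
  "istopology (\<lambda>U. U \<subseteq> carrier (Sym \<Psi>) \<and>
    (\<forall>g\<in>U. \<exists>F. finite F \<and> F \<subseteq> \<Psi> \<and> (\<lambda>h. g \<circ> h) ` pointwise_stabilizer \<Psi> F \<subseteq> U))"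
  unfolding istopology_def
proof (intro conjI allI impI)
  fix S T :: "('a \<Rightarrow> 'a) set"
  assume S: "S \<subseteq> carrier (Sym \<Psi>) \<and>
    (\<forall>g\<in>S. \<exists>F. finite F \<and> F \<subseteq> \<Psi> \<and> (\<lambda>h. g \<circ> h) ` pointwise_stabilizer \<Psi> F \<subseteq> S)"
   and T: "T \<subseteq> carrier (Sym \<Psi>) \<and>
    (\<forall>g\<in>T. \<exists>F. finite F \<and> F \<subseteq> \<Psi> \<and> (\<lambda>h. g \<circ> h) ` pointwise_stabilizer \<Psi> F \<subseteq> T)"
  show "S \<inter> T \<subseteq> carrier (Sym \<Psi>)" using S by auto
  show "\<forall>g\<in>S \<inter> T. \<exists>F. finite F \<and> F \<subseteq> \<Psi> \<and> (\<lambda>h. g \<circ> h) ` pointwise_stabilizer \<Psi> F \<subseteq> S \<inter> T"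
  proof
    fix g assume "g \<in> S \<inter> T"
    then obtain F F' where "finite F" "F \<subseteq> \<Psi>" "(\<lambda>h. g \<circ> h) ` pointwise_stabilizer \<Psi> F \<subseteq> S"
      "finite F'" "F' \<subseteq> \<Psi>" "(\<lambda>h. g \<circ> h) ` pointwise_stabilizer \<Psi> F' \<subseteq> T"
      using S T by (meson IntD1 IntD2)
    then show "\<exists>F. finite F \<and> F \<subseteq> \<Psi> \<and> (\<lambda>h. g \<circ> h) ` pointwise_stabilizer \<Psi> F \<subseteq> S \<inter> T"
      by (intro exI[of _ "F \<union> F'"]) (auto simp: pointwise_stabilizer_def image_subset_iff)
  qed
next
  fix \<K> :: "('a \<Rightarrow> 'a) set set"
  assume K: "\<forall>K\<in>\<K>. K \<subseteq> carrier (Sym \<Psi>) \<and>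
    (\<forall>g\<in>K. \<exists>F. finite F \<and> F \<subseteq> \<Psi> \<and> (\<lambda>h. g \<circ> h) ` pointwise_stabilizer \<Psi> F \<subseteq> K)"
  show "\<Union> \<K> \<subseteq> carrier (Sym \<Psi>)" using K by blast
  show "\<forall>g\<in>\<Union> \<K>. \<exists>F. finite F \<and> F \<subseteq> \<Psi> \<and> (\<lambda>h. g \<circ> h) ` pointwise_stabilizer \<Psi> F \<subseteq> \<Union> \<K>"
    using K by (meson UnionE Union_upper order_trans)
qed

lemma openin_Sym_topology:
  "openin (Sym_topology \<Psi>) U \<longleftrightarrow> U \<subseteq> carrier (Sym \<Psi>) \<and>
    (\<forall>g\<in>U. \<exists>F. finite F \<and> F \<subseteq> \<Psi> \<and> (\<lambda>h. g \<circ> h) ` pointwise_stabilizer \<Psi> F \<subseteq> U)"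
  unfolding Sym_topology_def topology_inverse'[OF istopology_Sym] ..


lemma group_Sym: "Group.group (Sym \<Psi>)"
proof (rule groupI)
  fix x assume "x \<in> carrier (Sym \<Psi>)"
  then show "\<exists>y\<in>carrier (Sym \<Psi>). y \<otimes>\<^bsub>Sym \<Psi>\<^esub> x = \<one>\<^bsub>Sym \<Psi>\<^esub>"
    by (intro bexI[of _ "inv_into UNIV x"]) (auto simp: Sym_def permutes_inv permutes_inv_o)
qed (auto simp: Sym_def permutes_compose permutes_id o_assoc)

lemma abelian_group_hom_ratfuns:
  assumes "carrier R = hom_ratfuns \<Psi> d" "add R = (+)" "zero R = 0"
  shows "abelian_group R"
proof (rule abelian_groupI)
  fix x assume "x \<in> carrier R"
  then show "\<exists>y\<in>carrier R. y \<oplus>\<^bsub>R\<^esub> x = \<zero>\<^bsub>R\<^esub>"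
    using assms hom_uminus by (intro bexI[of _ "- x"]) auto
qed (use assms in \<open>auto simp: hom_add hom_zero algebra_simps\<close>)

lemma cring_V0_field: "cring (V0_field \<Psi>)"
proof (rule cringI)
  show "abelian_group (V0_field \<Psi>)"
    by (rule abelian_group_hom_ratfuns) (auto simp: V0_field_def)
  show "Group.comm_monoid (V0_field \<Psi>)"
    by (rule comm_monoidI) (use hom_mult[of _ \<Psi> 0 _ 0] in \<open>auto simp: V0_field_def hom_one\<close>)
qed (auto simp: V0_field_def algebra_simps)

lemma field_V0_field: "Ring.field (V0_field \<Psi>)"
proof (rule cring.cring_fieldI[OF cring_V0_field])
  show "Units (V0_field \<Psi>) = carrier (V0_field \<Psi>) - {\<zero>\<^bsub>V0_field \<Psi>\<^esub>}"
  proof (intro Set.set_eqI iffI)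
    fix x assume "x \<in> carrier (V0_field \<Psi>) - {\<zero>\<^bsub>V0_field \<Psi>\<^esub>}"
    then show "x \<in> Units (V0_field \<Psi>)"
      unfolding Units_def V0_field_def using hom_inverse[of x \<Psi> 0]
      by (auto intro!: bexI[of _ "inverse x"])
  qed (auto simp: Units_def V0_field_def)
qed

lemma field_action_V0: "field_action (Sym \<Psi>) (V0_field \<Psi>) rf_perm"
proof (intro field_action.intro group_Sym field_V0_field field_action_axioms.intro)
  fix g assume "g \<in> carrier (Sym \<Psi>)"
  then show "rf_perm g \<in> ring_hom (V0_field \<Psi>) (V0_field \<Psi>)"
    by (intro ring_hom_memI)
       (auto simp: Sym_def V0_field_def hom_perm permutes_bij rf_perm_add rf_perm_mult rf_perm_one)
qed (auto simp: Sym_def permutes_bij rf_perm_id rf_perm_comp)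

lemma semilinear_rep_V_rep: "semilinear_rep (Sym \<Psi>) (V0_field \<Psi>) rf_perm (V_rep \<Psi> d)"
proof (intro semilinear_rep.intro field_action_V0 semilinear_rep_axioms.intro)
  show "Module.module (V0_field \<Psi>) (V_rep \<Psi> d)"
  proof (rule moduleI)
    show "abelian_group (V_rep \<Psi> d)"
      by (rule abelian_group_hom_ratfuns) (auto simp: V_rep_def)
    show "cring (V0_field \<Psi>)" by (rule cring_V0_field)
  qed (use hom_mult[of _ \<Psi> 0 _ d] in \<open>auto simp: V0_field_def V_rep_def algebra_simps\<close>)
qed (auto simp: Sym_def V_rep_def V0_field_def permutes_bij rf_perm_id rf_perm_comp hom_perm rf_perm_add rf_perm_mult)

lemma mperm_fix:
  assumes "bij h" "\<forall>x\<in>mvars P. h x = x"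
  shows "mperm h P = P"
proof (rule mpoly_eqI)
  fix m
  have i: "inj h" using assms(1) by (rule bij_is_inj)
  have eq: "Poly_Mapping.map_key h n = n" if "n \<in> Poly_Mapping.keys (mcoeffs P)" for n
  proof (rule poly_mapping_eqI)
    fix x
    have fx: "h y = y" if "y \<in> Poly_Mapping.keys n" for y
      using assms(2) that \<open>n \<in> _\<close> unfolding mvars_def by blast
    have "Poly_Mapping.lookup n (h x) = Poly_Mapping.lookup n x"
    proof (cases "x \<in> Poly_Mapping.keys n \<or> h x \<in> Poly_Mapping.keys n")
      case True
      then have "h x = x" using fx i by (metis injD)
      then show ?thesis by simp
    next
      case False
      then show ?thesis by (simp add: in_keys_iff)
    qed
    then show "Poly_Mapping.lookup (Poly_Mapping.map_key h n) x = Poly_Mapping.lookup n x"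
      by (simp add: lookup_map_key i)
  qed
  show "Poly_Mapping.lookup (mcoeffs (mperm h P)) m = Poly_Mapping.lookup (mcoeffs P) m"
  proof (cases "m \<in> Poly_Mapping.keys (mcoeffs P) \<or> Poly_Mapping.map_key h m \<in> Poly_Mapping.keys (mcoeffs P)")
    case True
    then have "Poly_Mapping.map_key h m = m"
      using eq bij_is_inj[OF bij_map_key[OF assms(1), where 'c = nat]] by (metis injD)
    then show ?thesis by (simp add: lookup_mperm assms(1))
  next
    case False
    then show ?thesis by (simp add: in_keys_iff lookup_mperm assms(1))
  qed
qed

lemma smooth_V0_rep_V_rep: "smooth_V0_rep \<Psi> (V_rep \<Psi> d)"
  unfolding smooth_V0_rep_def
proof (intro smooth_semilinear_rep.intro semilinear_rep_V_rep smooth_semilinear_rep_axioms.intro)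
  fix v :: "('a, 'b) ratfun" assume v: "v \<in> carrier (V_rep \<Psi> d)"
  obtain P Q where PQ: "P \<in> mpolys \<Psi>" "Q \<in> mpolys \<Psi>" "Q \<noteq> 0" "v = Fract P Q"
    using v unfolding V_rep_def hom_ratfuns_def ratfuns_def by auto
  let ?F = "mvars P \<union> mvars Q"
  have F: "finite ?F" "?F \<subseteq> \<Psi>" using PQ(1,2) by (auto simp: mpolys_def mvars_def)
  have fx: "rf_perm h v = v" if "h \<in> pointwise_stabilizer \<Psi> ?F" for h
  proof -
    have "bij h" "\<forall>x\<in>?F. h x = x" using that by (auto simp: pointwise_stabilizer_def Sym_def permutes_bij)
    then show ?thesis using PQ by (simp add: rf_perm_Fract mperm_fix)
  qed
  show "openin (Sym_topology \<Psi>) (stabilizer (Sym \<Psi>) (gact (V_rep \<Psi> d)) v)"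
    unfolding openin_Sym_topology
  proof (intro conjI ballI)
    fix g assume g: "g \<in> stabilizer (Sym \<Psi>) (gact (V_rep \<Psi> d)) v"
    have "(\<lambda>h. g \<circ> h) ` pointwise_stabilizer \<Psi> ?F \<subseteq> stabilizer (Sym \<Psi>) (gact (V_rep \<Psi> d)) v"
    proof (rule image_subsetI)
      fix h assume h: "h \<in> pointwise_stabilizer \<Psi> ?F"
      then have "g permutes \<Psi>" "h permutes \<Psi>" "rf_perm g v = v"
        using g by (auto simp: pointwise_stabilizer_def stabilizer_def Sym_def V_rep_def)
      then show "g \<circ> h \<in> stabilizer (Sym \<Psi>) (gact (V_rep \<Psi> d)) v"
        using fx[OF h] by (simp add: stabilizer_def Sym_def V_rep_def permutes_compose rf_perm_comp permutes_bij)
    qed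
    with F show "\<exists>F. finite F \<and> F \<subseteq> \<Psi> \<and> (\<lambda>h. g \<circ> h) ` pointwise_stabilizer \<Psi> F \<subseteq> stabilizer (Sym \<Psi>) (gact (V_rep \<Psi> d)) v"
      by blast
  qed (auto simp: stabilizer_def)
qed

end

theory Submission
  imports Defs "HOL-Computational_Algebra.Formal_Laurent_Series"
begin

text \<open>
  Write \<open>H\<^sub>S\<close> for the pointwise stabilizer of a finite set \<open>S\<close> of variables. A \<open>V\<^sub>0\<close>-linear
  functional into \<open>V\<^sub>d\<close> that is equivariant under \<open>H\<^bsub>S \<union> {t}\<^esub>\<close> only can be made equivariant under
  \<open>H\<^sub>S\<close>: by smoothness its conjugates, indexed by the position \<open>u\<close> of \<open>t\<close>, take on each vector a
  value that is one fixed rational function of \<open>u\<close> for all but finitely many \<open>u\<close>, and the constant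
  term of its Laurent expansion in \<open>u\<close> is the desired functional. It agrees with the original one
  wherever that was already \<open>H\<^sub>S\<close>-equivariant.

  Injectivity: a maximal partial \<open>H\<^sub>S\<close>-functional on \<open>A\<close> contains in its domain every vector \<open>v\<close>
  fixed by \<open>H\<^bsub>S \<union> T\<^esub>\<close>, by induction on the size of \<open>T\<close>. By Artin's independence of characters one
  may take \<open>v\<close> invariant under the permutations of \<open>T\<close>, so that \<open>g v\<close> depends only on the set \<open>g T\<close>.
  Either the span of these translates meets \<open>A\<close> trivially and the functional extends by zero, or a
  relation expresses one translate through others; after adding the other variables of the relation
  to \<open>S\<close> all translates involve fewer new variables, the induction hypothesis applies, and the
  constant term construction leads back to \<open>S\<close>.

  Cogeneration is a similar induction: if the generic value of the conjugates of a functional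
  vanishes on \<open>v\<close>, only finitely many conjugates are nonzero on \<open>v\<close>, and a sum of them weighted by
  \<open>u\<^sup>e\<close> extends by injectivity; otherwise some Laurent coefficient is nonzero. For finite \<open>\<Psi>\<close>,
  averaging over the group replaces the constant term construction.
\<close>

section \<open>Laurent expansion in one variable\<close>

unbundle fps_syntax

text \<open>Over an infinite set of variables the conjugates of a functional can be neither averaged
  nor summed. What they offer instead is uniformity: up to finitely many positions \<open>u\<close>,
  their values on one vector differ only by the name of a variable, so any recipe that removes
  \<open>u\<close> from a rational function, compatibly with renaming, yields a single value. The
  constant Laurent term fits: it is additive, it is linear over functions without \<open>u\<close>
  and fixes them, and since \<open>u\<close> has degree one, the coefficient of \<open>u ^ n\<close>
  of a function of degree \<open>d\<close> has degree \<open>d - n\<close>, so that only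
  \<open>n = 0\<close> stays in \<open>V\<^sub>d\<close>. Its weakness is that it may vanish on a
  nonzero function. This is harmless for injectivity, where only the values on the old domain
  matter; for cogeneration it is the reason why all degrees occur, since a power of the variable
  first has to move a nonzero coefficient to index zero and thereby changes \<open>d\<close>.
  Everything is formulated relative to a finite set \<open>S\<close> because each step of the
  inductions freezes or releases variables.\<close>

definition mmon :: "('p \<Rightarrow>\<^sub>0 nat) \<Rightarrow> 'k \<Rightarrow> ('p, 'k::comm_ring_1) mpoly"
  where "mmon m c = Abs_mpoly (Poly_Mapping.single m c)"

lemma mcoeffs_mmon [simp]: "mcoeffs (mmon m c) = Poly_Mapping.single m c"
  by (simp add: mmon_def Abs_mpoly_inverse)

lemma mmon_zero [simp]: "mmon m 0 = 0"
  by (simp add: mmon_def zero_mpoly_def)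

lemma mmon_mult: "mmon a c * mmon b e = mmon (a + b) (c * e)"
  by (rule mpoly_eqI) (simp add: times_mpoly.rep_eq mult_single)

text \<open>Reduces additive statements, in particular multiplicativity of the expansion, to single
  monomials.\<close>

lemma mpoly_induct [case_names mon add]:
  fixes P :: "('p, 'k::comm_ring_1) mpoly"
  assumes mon: "\<And>m c. p (mmon m c)" and add: "\<And>P Q. p P \<Longrightarrow> p Q \<Longrightarrow> p (P + Q)"
  shows "p P"
proof -
  have "p (Abs_mpoly f)" for f :: "('p \<Rightarrow>\<^sub>0 nat) \<Rightarrow>\<^sub>0 'k"
  proof (induction f rule: update_induct)
    case const
    then show ?case using mon[of 0 0] by (simp add: zero_mpoly_def)
  next
    case (update f a b)
    have "Poly_Mapping.update a b f = Poly_Mapping.single a b + f"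
      by (rule poly_mapping_eqI) (use update in \<open>auto simp: lookup_update lookup_add lookup_single in_keys_iff when_def\<close>)
    then have "Abs_mpoly (Poly_Mapping.update a b f) = mmon a b + Abs_mpoly f"
      by (metis Abs_mpoly_inverse UNIV_I mcoeffs_inverse mcoeffs_mmon plus_mpoly.rep_eq)
    then show ?case using update add mon by simp
  qed
  then show ?thesis by (metis mcoeffs_inverse)
qed

text \<open>The test on \<open>Poly_Mapping.lookup m u\<close> keeps only cofactors free of
  \<open>u\<close>; otherwise \<open>u ^ n\<close> would also be split off from monomials with a
  higher power of \<open>u\<close>.\<close>

lift_definition pslice :: "'p \<Rightarrow> nat \<Rightarrow> (('p \<Rightarrow>\<^sub>0 nat) \<Rightarrow>\<^sub>0 'k::zero) \<Rightarrow> (('p \<Rightarrow>\<^sub>0 nat) \<Rightarrow>\<^sub>0 'k)"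
  is "\<lambda>u n P m. if Poly_Mapping.lookup m u = 0 then P (m + Poly_Mapping.single u n) else 0"
proof -
  fix u :: 'p and n and P :: "('p \<Rightarrow>\<^sub>0 nat) \<Rightarrow> 'k"
  assume "finite {m. P m \<noteq> 0}"
  then have "finite ((\<lambda>m. m + Poly_Mapping.single u n) -` {m. P m \<noteq> 0})"
    by (rule finite_vimageI) (simp add: inj_on_def)
  then show "finite {m. (if Poly_Mapping.lookup m u = 0 then P (m + Poly_Mapping.single u n) else 0) \<noteq> 0}"
    by (rule finite_subset[rotated]) auto
qed

text \<open>\<open>mslice u n P\<close> is the coefficient of \<open>u ^ n\<close> in \<open>P\<close>.\<close>

definition mslice :: "'p \<Rightarrow> nat \<Rightarrow> ('p, 'k::comm_ring_1) mpoly \<Rightarrow> ('p, 'k) mpoly"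
  where "mslice u n P = Abs_mpoly (pslice u n (mcoeffs P))"

lemma lookup_mslice: "Poly_Mapping.lookup (mcoeffs (mslice u n P)) m =
    (if Poly_Mapping.lookup m u = 0 then Poly_Mapping.lookup (mcoeffs P) (m + Poly_Mapping.single u n) else 0)"
  by (simp add: mslice_def Abs_mpoly_inverse pslice.rep_eq)

lemma mslice_add: "mslice u n (P + Q) = mslice u n P + mslice u n Q"
  by (rule mpoly_eqI) (simp add: lookup_mslice plus_mpoly.rep_eq lookup_add)

lemma mslice_zero [simp]: "mslice u n 0 = 0"
  by (rule mpoly_eqI) (simp add: lookup_mslice zero_mpoly.rep_eq)

lemma mslice_mmon:
  "mslice u n (mmon (b + Poly_Mapping.single u j) c) = (if n = j then mmon b c else 0)"
  if "Poly_Mapping.lookup b u = 0"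
proof (rule mpoly_eqI)
  fix m
  have "b + Poly_Mapping.single u j = m + Poly_Mapping.single u n \<longleftrightarrow> b = m \<and> n = j"
    if "Poly_Mapping.lookup m u = 0"
  proof
    assume e: "b + Poly_Mapping.single u j = m + Poly_Mapping.single u n"
    have "Poly_Mapping.lookup (b + Poly_Mapping.single u j) u = Poly_Mapping.lookup (m + Poly_Mapping.single u n) u"
      using e by simp
    then have "n = j" using that \<open>Poly_Mapping.lookup b u = 0\<close> by (simp add: lookup_add)
    then show "b = m \<and> n = j" using e by simp
  qed simp
  then show "Poly_Mapping.lookup (mcoeffs (mslice u n (mmon (b + Poly_Mapping.single u j) c))) m =
    Poly_Mapping.lookup (mcoeffs (if n = j then mmon b c else 0)) m"
    using that by (auto simp: lookup_mslice lookup_single when_def zero_mpoly.rep_eq)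
qed

lemma monomial_split:
  obtains b where "m = b + Poly_Mapping.single u (Poly_Mapping.lookup m u)" "Poly_Mapping.lookup b u = (0::nat)"
proof
  show "m = Poly_Mapping.update u 0 m + Poly_Mapping.single u (Poly_Mapping.lookup m u)"
    by (rule poly_mapping_eqI) (auto simp: lookup_update lookup_add lookup_single when_def)
qed (simp add: lookup_update)

lemma mslice_mperm:
  assumes "bij g"
  shows "mslice (g u) n (mperm g P) = mperm g (mslice u n P)"
proof (rule mpoly_eqI)
  fix m
  have "Poly_Mapping.map_key g (m + Poly_Mapping.single (g u) n) =
      Poly_Mapping.map_key g m + Poly_Mapping.single u n"
    by (simp add: map_key_plus map_key_single bij_is_inj assms)
  then show "Poly_Mapping.lookup (mcoeffs (mslice (g u) n (mperm g P))) m = Poly_Mapping.lookup (mcoeffs (mperm g (mslice u n P))) m"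
    by (simp add: lookup_mslice lookup_mperm assms lookup_map_key bij_is_inj)
qed

lemma mslice_in_mpolys:
  assumes "P \<in> mpolys (insert u T)"
  shows "mslice u n P \<in> mpolys T"
  unfolding mpolys_def mvars_def mem_Collect_eq
proof (intro UN_least subsetI)
  fix m x assume m: "m \<in> Poly_Mapping.keys (mcoeffs (mslice u n P))" and x: "x \<in> Poly_Mapping.keys m"
  then have "Poly_Mapping.lookup m u = 0" "m + Poly_Mapping.single u n \<in> Poly_Mapping.keys (mcoeffs P)"
    by (auto simp: in_keys_iff lookup_mslice split: if_splits)
  moreover from this have "x \<in> Poly_Mapping.keys (m + Poly_Mapping.single u n)" "x \<noteq> u"
    using x by (auto simp: in_keys_iff lookup_add)
  ultimately show "x \<in> T" using assms unfolding mpolys_def mvars_def by blast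
qed

lemma mdeg_single: "mdeg (Poly_Mapping.single u n) = n"
  by (cases "n = 0") (auto simp: mdeg_def)

text \<open>A nonzero slice has a monomial, and its cofactor \<open>u ^ n\<close> forces
  \<open>n \<le> d\<close>; hence the subtraction of naturals is genuine.\<close>

lemma mhomogeneous_mslice:
  assumes "mhomogeneous d P" "mslice u n P \<noteq> 0"
  shows "n \<le> d \<and> mhomogeneous (d - n) (mslice u n P)"
proof -
  have *: "mdeg m + n = d" if "m \<in> Poly_Mapping.keys (mcoeffs (mslice u n P))" for m
  proof -
    have "m + Poly_Mapping.single u n \<in> Poly_Mapping.keys (mcoeffs P)"
      using that by (auto simp: in_keys_iff lookup_mslice split: if_splits)
    then show ?thesis using assms(1) unfolding mhomogeneous_def by (metis mdeg_add mdeg_single)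
  qed
  moreover obtain m where "m \<in> Poly_Mapping.keys (mcoeffs (mslice u n P))"
    using assms(2) by (metis all_not_in_conv mcoeffs_inject keys_eq_empty zero_mpoly.rep_eq)
  ultimately show ?thesis unfolding mhomogeneous_def by fastforce
qed

lemma mslice_free:
  assumes "P \<in> mpolys T" "u \<notin> T"
  shows "mslice u n P = (if n = 0 then P else 0)"
proof (rule mpoly_eqI)
  fix m
  have "Poly_Mapping.lookup (mcoeffs P) m' = 0" if "Poly_Mapping.lookup m' u \<noteq> 0" for m'
  proof (rule ccontr)
    assume "Poly_Mapping.lookup (mcoeffs P) m' \<noteq> 0"
    then have "m' \<in> Poly_Mapping.keys (mcoeffs P)" "u \<in> Poly_Mapping.keys m'"
      using that by (simp_all add: in_keys_iff)
    then have "u \<in> T" using assms(1) unfolding mpolys_def mvars_def by blast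
    then show False using assms by simp
  qed
  then show "Poly_Mapping.lookup (mcoeffs (mslice u n P)) m = Poly_Mapping.lookup (mcoeffs (if n = 0 then P else 0)) m"
    by (auto simp: lookup_mslice lookup_add zero_mpoly.rep_eq)
qed

text \<open>The coefficients are free of \<open>u\<close>, yet they are taken in the field of all
  rational functions: this is a type, so that Laurent series over it form a field in which
  expansions can be divided.\<close>

definition mpoly_fls :: "'p \<Rightarrow> ('p, 'k::field) mpoly \<Rightarrow> ('p, 'k) ratfun fls"
  where "mpoly_fls u P = fps_to_fls (Abs_fps (\<lambda>n. Fract (mslice u n P) 1))"

lemma mpoly_fls_nth: "mpoly_fls u P $$ n = (if n < 0 then 0 else Fract (mslice u (nat n) P) 1)"
  by (simp add: mpoly_fls_def)

lemma mpoly_fls_add: "mpoly_fls u (P + Q) = mpoly_fls u P + mpoly_fls u Q"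
  by (rule fls_eqI) (simp add: mpoly_fls_nth mslice_add)

lemma mpoly_fls_mmon:
  assumes "Poly_Mapping.lookup b u = 0"
  shows "mpoly_fls u (mmon (b + Poly_Mapping.single u j) c) =
    fls_shift (- int j) (fls_const (Fract (mmon b c) 1))"
proof (rule fls_eqI)
  fix n
  have "n = int j \<longleftrightarrow> 0 \<le> n \<and> nat n = j" by auto
  then show "mpoly_fls u (mmon (b + Poly_Mapping.single u j) c) $$ n =
    fls_shift (- int j) (fls_const (Fract (mmon b c) 1)) $$ n"
    by (auto simp: mpoly_fls_nth mslice_mmon[OF assms] fract_collapse)
qed

lemma mpoly_fls_mult: "mpoly_fls u (P * Q) = mpoly_fls u P * mpoly_fls u Q"
proof (induction P rule: mpoly_induct)
  case (add P P')
  then show ?case by (simp add: distrib_right mpoly_fls_add)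
next
  case (mon a c)
  show ?case
  proof (induction Q rule: mpoly_induct)
    case (add Q Q')
    then show ?case by (simp add: distrib_left mpoly_fls_add)
  next
    case (mon b e)
    define i j where "i = Poly_Mapping.lookup a u" and "j = Poly_Mapping.lookup b u"
    obtain a' where a: "a = a' + Poly_Mapping.single u i" "Poly_Mapping.lookup a' u = 0"
      unfolding i_def by (rule monomial_split[of a u])
    obtain b' where b: "b = b' + Poly_Mapping.single u j" "Poly_Mapping.lookup b' u = 0"
      unfolding j_def by (rule monomial_split[of b u])
    have ab: "a + b = (a' + b') + Poly_Mapping.single u (i + j)" "Poly_Mapping.lookup (a' + b') u = 0"
      unfolding a(1) b(1) using a(2) b(2) by (simp_all add: single_add lookup_add ac_simps)
    have "mpoly_fls u (mmon a c) = fls_shift (- int i) (fls_const (Fract (mmon a' c) 1))"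
      unfolding a(1) by (rule mpoly_fls_mmon[OF a(2)])
    moreover have "mpoly_fls u (mmon b e) = fls_shift (- int j) (fls_const (Fract (mmon b' e) 1))"
      unfolding b(1) by (rule mpoly_fls_mmon[OF b(2)])
    moreover have "mpoly_fls u (mmon a c * mmon b e) = fls_shift (- int (i + j)) (fls_const (Fract (mmon a' c * mmon b' e) 1))"
      unfolding mmon_mult ab(1) using mpoly_fls_mmon[OF ab(2)] .
    ultimately show ?case by (simp add: fls_times_both_shifted_simp)
  qed
qed

lemma mpoly_fls_free:
  assumes "P \<in> mpolys T" "u \<notin> T"
  shows "mpoly_fls u P = fls_const (Fract P 1)"
  by (rule fls_eqI) (auto simp: mpoly_fls_nth mslice_free[OF assms] fract_collapse)

lemma mpoly_fls_eq_zero_iff [simp]: "mpoly_fls u P = 0 \<longleftrightarrow> P = 0"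
proof
  assume z: "mpoly_fls u P = 0"
  have s: "mslice u n P = 0" for n
    using arg_cong[OF z, of "\<lambda>f. f $$ int n"] by (simp add: mpoly_fls_nth Zero_fract_def eq_fract)
  show "P = 0"
  proof (rule mpoly_eqI)
    fix m :: "_ \<Rightarrow>\<^sub>0 nat"
    obtain b where b: "m = b + Poly_Mapping.single u (Poly_Mapping.lookup m u)" "Poly_Mapping.lookup b u = 0"
      by (rule monomial_split[of m u])
    have "Poly_Mapping.lookup (mcoeffs (mslice u (Poly_Mapping.lookup m u) P)) b = Poly_Mapping.lookup (mcoeffs P) m"
      using b by (simp add: lookup_mslice)
    then show "Poly_Mapping.lookup (mcoeffs P) m = Poly_Mapping.lookup (mcoeffs 0) m"
      by (simp add: s zero_mpoly.rep_eq)
  qed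
next
  assume "P = 0" then show "mpoly_fls u P = 0"
    by (intro fls_eqI) (simp add: mpoly_fls_nth fract_collapse)
qed

section \<open>Expansion of rational functions, its grading and its behaviour under renaming\<close>

definition laurent :: "'p \<Rightarrow> ('p, 'k::field) ratfun \<Rightarrow> ('p, 'k) ratfun fls"
  where "laurent u f = (THE r. \<exists>P Q. Q \<noteq> 0 \<and> f = Fract P Q \<and> r = mpoly_fls u P / mpoly_fls u Q)"

text \<open>The expansion of polynomials is multiplicative and vanishes only at zero, so it turns
  \<open>P * Q' = P' * Q\<close> with nonzero denominators into an equality of quotients.\<close>

lemma laurent_Fract:
  assumes Q: "Q \<noteq> 0"
  shows "laurent u (Fract P Q) = mpoly_fls u P / mpoly_fls u Q"
  unfolding laurent_def
proof (rule the_equality)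
  fix r assume "\<exists>P' Q'. Q' \<noteq> 0 \<and> Fract P Q = Fract P' Q' \<and> r = mpoly_fls u P' / mpoly_fls u Q'"
  then obtain P' Q' where *: "Q' \<noteq> 0" "P * Q' = P' * Q" "r = mpoly_fls u P' / mpoly_fls u Q'"
    using Q by (auto simp: eq_fract)
  then have "mpoly_fls u P * mpoly_fls u Q' = mpoly_fls u P' * mpoly_fls u Q"
    by (metis mpoly_fls_mult)
  then show "r = mpoly_fls u P / mpoly_fls u Q"
    using * Q by (simp add: frac_eq_eq)
qed (use Q in blast)

lemma laurent_add: "laurent u (f + g) = laurent u f + laurent u g"
  by (cases f; cases g) (simp add: laurent_Fract mpoly_fls_add mpoly_fls_mult add_frac_eq)

lemma laurent_mult: "laurent u (f * g) = laurent u f * laurent u g"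
  by (cases f; cases g) (simp add: laurent_Fract mpoly_fls_mult)

lemma laurent_free:
  assumes "f \<in> hom_ratfuns T d" "u \<notin> T"
  shows "laurent u f = fls_const f"
proof -
  from assms(1) obtain P Q where PQ: "P \<in> mpolys T" "Q \<in> mpolys T" "Q \<noteq> 0" "f = Fract P Q"
    unfolding hom_ratfuns_def ratfuns_def by blast
  have "f * Fract Q 1 = Fract P 1" using PQ by (simp add: eq_fract)
  then have "fls_const f * mpoly_fls u Q = mpoly_fls u P"
    using PQ assms(2) by (simp add: mpoly_fls_free)
  then show ?thesis using PQ by (simp add: laurent_Fract divide_eq_eq)
qed

lemma laurent_eq_zero_iff [simp]: "laurent u f = 0 \<longleftrightarrow> f = 0"
  by (cases f) (simp add: laurent_Fract Zero_fract_def eq_fract)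

lemma hom_sum: "(\<And>i. i \<in> I \<Longrightarrow> f i \<in> hom_ratfuns T d) \<Longrightarrow> sum f I \<in> hom_ratfuns T d"
  by (induction I rule: infinite_finite_induct) (auto simp: hom_zero hom_add)

text \<open>The coefficients of a quotient are found by recursion from the lowest one upwards,
  dividing by the leading coefficient of \<open>b\<close> only; these operations stay among
  functions in \<open>T\<close> and respect the grading.\<close>

lemma fls_quotient_graded:
  assumes prod: "c * b = a" and b: "b \<noteq> 0"
    and ga: "\<And>n. a $$ n \<in> hom_ratfuns T (p - n)" and gb: "\<And>n. b $$ n \<in> hom_ratfuns T (q - n)"
  shows "c $$ n \<in> hom_ratfuns T (p - q - n)"
proof (induction "nat (n - fls_subdegree c)" arbitrary: n rule: less_induct)
  case less
  let ?s = "fls_subdegree b" and ?r = "fls_subdegree c"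
  show ?case
  proof (cases "n < ?r")
    case True
    then show ?thesis by (simp add: hom_zero)
  next
    case False
    \<comment> \<open>At index \<open>n + ?s\<close> the new unknown \<open>c $$ n\<close> meets
      exactly the leading coefficient of \<open>b\<close>.\<close>
    have "a $$ (n + ?s) = (\<Sum>i=?r..n. c $$ i * b $$ (n + ?s - i))"
      using fls_times_nth(2)[of c b "n + ?s"] prod by simp
    also have "{?r..n} = insert n {?r..<n}" using False by auto
    finally have e: "c $$ n = (a $$ (n + ?s) + - (\<Sum>i\<in>{?r..<n}. c $$ i * b $$ (n + ?s - i))) * inverse (b $$ ?s)"
      using b by (simp add: field_simps)
    have "c $$ i * b $$ (n + ?s - i) \<in> hom_ratfuns T (p - (n + ?s))" if "i \<in> {?r..<n}" for i
    proof -
      have "c $$ i \<in> hom_ratfuns T (p - q - i)" using that by (intro less) auto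
      from hom_mult[OF this gb[of "n + ?s - i"]] show ?thesis by (simp add: algebra_simps)
    qed
    then have "(\<Sum>i\<in>{?r..<n}. c $$ i * b $$ (n + ?s - i)) \<in> hom_ratfuns T (p - (n + ?s))"
      by (rule hom_sum)
    then have "a $$ (n + ?s) + - (\<Sum>i\<in>{?r..<n}. c $$ i * b $$ (n + ?s - i)) \<in> hom_ratfuns T (p - (n + ?s))"
      by (intro hom_add ga hom_uminus)
    from hom_mult[OF this hom_inverse[OF gb[of ?s]]] show ?thesis
      unfolding e by (simp add: algebra_simps)
  qed
qed

lemma mpoly_fls_graded:
  assumes "P \<in> mpolys (insert u T)" "mhomogeneous d P"
  shows "mpoly_fls u P $$ n \<in> hom_ratfuns T (int d - n)"
proof (cases "n < 0 \<or> mslice u (nat n) P = 0")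
  case True
  then show ?thesis by (auto simp: mpoly_fls_nth hom_zero fract_collapse)
next
  case False
  then have "nat n \<le> d \<and> mhomogeneous (d - nat n) (mslice u (nat n) P)"
    using mhomogeneous_mslice[OF assms(2)] by blast
  then have "Fract (mslice u (nat n) P) 1 \<in> hom_ratfuns T (int d - n)"
    using mslice_in_mpolys[OF assms(1)] False
    by (intro hom_ratfunsI[where m = "d - nat n" and n = 0]) (auto simp: mpolys_closed mhomogeneous_one)
  then show ?thesis using False by (simp add: mpoly_fls_nth)
qed

text \<open>Expanding eliminates \<open>u\<close> from the coefficients, and each power of
  \<open>u\<close> carries away one unit of degree.\<close>

lemma laurent_graded:
  assumes "f \<in> hom_ratfuns (insert u T) d"
  shows "laurent u f $$ n \<in> hom_ratfuns T (d - n)"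
  using assms
proof (cases rule: hom_ratfunsE)
  case 1
  then show ?thesis by (metis laurent_eq_zero_iff fls_zero_nth hom_zero)
next
  case (2 P Q p q)
  have "laurent u f * mpoly_fls u Q = mpoly_fls u P" using 2 by (simp add: laurent_Fract)
  from fls_quotient_graded[OF this _ mpoly_fls_graded mpoly_fls_graded] show ?thesis
    using 2 by auto
qed

text \<open>Meant for \<open>\<sigma> 0 = 0\<close>, which keeps the coefficients zero far to the
  left, as \<open>Abs_fls\<close> requires.\<close>

definition fls_map :: "('a \<Rightarrow> 'b) \<Rightarrow> 'a::zero fls \<Rightarrow> 'b::zero fls"
  where "fls_map \<sigma> f = Abs_fls (\<lambda>n. \<sigma> (f $$ n))"

lemma fls_map_nth: "\<sigma> 0 = 0 \<Longrightarrow> fls_map \<sigma> f $$ n = \<sigma> (f $$ n)"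
  unfolding fls_map_def by (rule nth_Abs_fls_lower_bound[of "fls_subdegree f"]) auto

lemma rf_perm_eq_zero_iff: "bij g \<Longrightarrow> rf_perm g f = 0 \<longleftrightarrow> f = 0"
  by (cases f) (simp add: rf_perm_Fract Zero_fract_def eq_fract)

lemma rf_perm_sum: "bij g \<Longrightarrow> rf_perm g (\<Sum>i\<in>I. f i) = (\<Sum>i\<in>I. rf_perm g (f i))"
  by (induction I rule: infinite_finite_induct) (auto simp: rf_perm_zero rf_perm_add)

text \<open>The formula for products starts its sum at the subdegrees, which do not change because a
  permutation kills no nonzero coefficient.\<close>

lemma fls_map_rf_perm_mult:
  assumes g: "bij g"
  shows "fls_map (rf_perm g) (a * b) = fls_map (rf_perm g) a * fls_map (rf_perm g) b"
proof (rule fls_eqI)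
  fix n
  have z: "rf_perm g 0 = 0" by (rule rf_perm_zero[OF g])
  have s: "fls_subdegree (fls_map (rf_perm g) f) = fls_subdegree f" for f :: "('a, 'b) ratfun fls"
  proof (cases "f = 0")
    case True
    then have "fls_map (rf_perm g) f = 0" by (intro fls_eqI) (simp add: fls_map_nth z)
    then show ?thesis using True by simp
  next
    case False
    then show ?thesis
      by (intro fls_subdegree_eqI) (auto simp: fls_map_nth z rf_perm_eq_zero_iff[OF g])
  qed
  show "fls_map (rf_perm g) (a * b) $$ n = (fls_map (rf_perm g) a * fls_map (rf_perm g) b) $$ n"
    unfolding fls_times_nth(2)[of "fls_map (rf_perm g) a"] s fls_map_nth[of "rf_perm g", OF z]
    by (simp add: fls_times_nth(2) rf_perm_sum[OF g] rf_perm_mult[OF g])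
qed

text \<open>This compatibility with renaming is what makes the constant terms at different positions
  comparable.\<close>

lemma laurent_rf_perm:
  assumes g: "bij g"
  shows "laurent (g u) (rf_perm g f) = fls_map (rf_perm g) (laurent u f)"
proof (cases f)
  case (Fract P Q)
  have p: "fls_map (rf_perm g) (mpoly_fls u R) = mpoly_fls (g u) (mperm g R)" for R
    by (rule fls_eqI) (simp add: fls_map_nth rf_perm_zero g mpoly_fls_nth rf_perm_Fract mslice_mperm)
  have "laurent u f * mpoly_fls u Q = mpoly_fls u P" using Fract by (simp add: laurent_Fract)
  then have "fls_map (rf_perm g) (laurent u f) * mpoly_fls (g u) (mperm g Q) = mpoly_fls (g u) (mperm g P)"
    using fls_map_rf_perm_mult[OF g] p by metis
  then show ?thesis using Fract g by (simp add: rf_perm_Fract laurent_Fract divide_eq_eq)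
qed

definition rf_var :: "'p \<Rightarrow> ('p, 'k::field) ratfun"
  where "rf_var x = Fract (mvar x) 1"

lemma mvar_mmon: "mvar x = mmon (Poly_Mapping.single x 1) 1"
  by (simp add: mmon_def mvar_def)

lemma mvar_neq_zero [simp]: "mvar x \<noteq> (0 :: ('p, 'k::field) mpoly)"
proof
  assume "mvar x = (0 :: ('p, 'k) mpoly)"
  then have "mcoeffs (mvar x) = (0 :: _ \<Rightarrow>\<^sub>0 'k)" by (simp add: zero_mpoly.rep_eq)
  then have "Poly_Mapping.lookup (mcoeffs (mvar x)) (Poly_Mapping.single x 1) = (0::'k)" by simp
  then show False by (simp add: mvar.rep_eq)
qed

lemma rf_var_neq_zero [simp]: "rf_var x \<noteq> 0"
  by (simp add: rf_var_def Zero_fract_def eq_fract)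

lemma rf_var_hom: "x \<in> T \<Longrightarrow> rf_var x \<in> hom_ratfuns T 1"
  unfolding rf_var_def
  by (rule hom_ratfunsI[where m = 1 and n = 0])
     (auto simp: mpolys_closed(4) mhomogeneous_one, auto simp: mpolys_def mvars_def mhomogeneous_def mvar.rep_eq mdeg_single)

lemma rf_perm_var [simp]: "bij g \<Longrightarrow> rf_perm g (rf_var x) = rf_var (g x)"
  by (simp add: rf_var_def rf_perm_Fract)

lemma laurent_rf_var: "laurent u (rf_var u :: ('p, 'k::field) ratfun) = fls_X"
proof -
  have "mmon 0 1 = (1 :: ('p, 'k) mpoly)" by (simp add: mmon_def one_mpoly_def)
  moreover have "mpoly_fls u (1 :: ('p, 'k) mpoly) = 1"
    using mpoly_fls_free[of 1 "{}" u] by (simp add: mpolys_closed One_fract_def[symmetric])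
  ultimately show ?thesis
    using mpoly_fls_mmon[of 0 u 1 "1::'k"]
    by (simp add: rf_var_def laurent_Fract mvar_mmon One_fract_def[symmetric] fls_X_conv_shift_1)
qed

lemma laurent_powi:
  "laurent u (rf_var u powi j) = fls_X powi j"
proof -
  have l1: "laurent u 1 = 1" using laurent_free[of 1 "{}" 0 u] by (simp add: hom_one)
  have pw: "laurent u (f ^ n) = laurent u f ^ n" for f n
    by (induction n) (auto simp: l1 laurent_mult)
  have iv: "laurent u (inverse f) = inverse (laurent u f)" if "f \<noteq> 0" for f
  proof (rule inverse_unique[symmetric])
    show "laurent u f * laurent u (inverse f) = 1"
      using that l1 by (simp add: laurent_mult[symmetric])
  qed
  show ?thesis
    unfolding power_int_def by (auto simp: pw iv laurent_rf_var)
qed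

section \<open>The constant term\<close>

definition const_term :: "'p \<Rightarrow> ('p, 'k::field) ratfun \<Rightarrow> ('p, 'k) ratfun"
  where "const_term u f = laurent u f $$ 0"

lemma const_term_add: "const_term u (f + g) = const_term u f + const_term u g"
  by (simp add: const_term_def laurent_add)

lemma const_term_mult_free:
  "a \<in> hom_ratfuns T d \<Longrightarrow> u \<notin> T \<Longrightarrow> const_term u (a * f) = a * const_term u f"
  by (simp add: const_term_def laurent_mult laurent_free)

lemma const_term_free: "a \<in> hom_ratfuns T d \<Longrightarrow> u \<notin> T \<Longrightarrow> const_term u a = a"
  by (simp add: const_term_def laurent_free)

lemma const_term_hom: "f \<in> hom_ratfuns (insert u T) d \<Longrightarrow> const_term u f \<in> hom_ratfuns T d"
  using laurent_graded[of f u T d 0] by (simp add: const_term_def)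

lemma const_term_rf_perm: "bij g \<Longrightarrow> const_term (g u) (rf_perm g f) = rf_perm g (const_term u f)"
  by (simp add: const_term_def laurent_rf_perm fls_map_nth rf_perm_zero)

text \<open>Multiplying by \<open>u\<close> to the power \<open>- n\<close> moves a nonzero
  coefficient with index \<open>n\<close> to index zero.\<close>

lemma const_term_powi_neq_zero:
  assumes "f \<noteq> 0"
  obtains j :: int where "const_term u (f * rf_var u powi j) \<noteq> 0"
proof -
  have "laurent u f \<noteq> 0" using assms by simp
  then obtain n where n: "laurent u f $$ n \<noteq> 0" unfolding fls_nonzero_nth by blast
  have "laurent u (f * rf_var u powi (- n)) = fls_shift n (laurent u f)"
    by (simp add: laurent_mult laurent_powi fls_shifted_times_simps)
  then have "const_term u (f * rf_var u powi (- n)) \<noteq> 0" using n by (simp add: const_term_def)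
  then show ?thesis by (rule that)
qed

section \<open>Subspaces and equivariant functionals\<close>

lemma hom_mono: "T \<subseteq> T' \<Longrightarrow> hom_ratfuns T d \<subseteq> hom_ratfuns T' d"
  unfolding hom_ratfuns_iff[abs_def] subset_iff hom_ratfuns_iff mpolys_def by blast

text \<open>A single function leaves all but finitely many variables fresh, and
  \<open>const_term\<close> at a fresh variable treats it as a constant.\<close>

lemma hom_support:
  assumes "f \<in> hom_ratfuns \<Psi> d"
  obtains T where "finite T" "T \<subseteq> \<Psi>" "f \<in> hom_ratfuns T d"
  using assms
proof (cases rule: hom_ratfunsE)
  case 1
  then show ?thesis using that[of "{}"] by (simp add: hom_zero)
next
  case (2 P Q m n)
  show ?thesis
  proof (rule that[of "mvars P \<union> mvars Q"])
    show "finite (mvars P \<union> mvars Q)" "mvars P \<union> mvars Q \<subseteq> \<Psi>"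
      using 2 by (auto simp: mpolys_def mvars_def)
    show "f \<in> hom_ratfuns (mvars P \<union> mvars Q) d"
      unfolding \<open>f = _\<close> using 2 by (intro hom_ratfunsI[where m = m and n = n]) (auto simp: mpolys_def)
  qed
qed

lemma rf_perm_fix:
  assumes "bij g" "f \<in> hom_ratfuns T d" "\<forall>x\<in>T. g x = x"
  shows "rf_perm g f = f"
proof -
  from assms(2) obtain P Q where "P \<in> mpolys T" "Q \<in> mpolys T" "Q \<noteq> 0" "f = Fract P Q"
    unfolding hom_ratfuns_def ratfuns_def by blast
  then show ?thesis using assms mperm_fix[of g P] mperm_fix[of g Q]
    by (auto simp: rf_perm_Fract mpolys_def subset_iff)
qed

lemma stab_iff: "g \<in> pointwise_stabilizer \<Psi> S \<longleftrightarrow> g permutes \<Psi> \<and> (\<forall>x\<in>S. g x = x)"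
  by (simp add: pointwise_stabilizer_def Sym_def)

lemma stab_bij: "g \<in> pointwise_stabilizer \<Psi> S \<Longrightarrow> bij g"
  using permutes_bij by (auto simp: stab_iff)

lemma stab_comp:
  "g \<in> pointwise_stabilizer \<Psi> S \<Longrightarrow> h \<in> pointwise_stabilizer \<Psi> S \<Longrightarrow> g \<circ> h \<in> pointwise_stabilizer \<Psi> S"
  by (auto simp: stab_iff permutes_compose)

lemma stab_inv:
  "g \<in> pointwise_stabilizer \<Psi> S \<Longrightarrow> inv_into UNIV g \<in> pointwise_stabilizer \<Psi> S"
  by (auto simp: stab_iff permutes_inv permutes_inv_eq)

lemma stab_antimono: "S \<subseteq> S' \<Longrightarrow> pointwise_stabilizer \<Psi> S' \<subseteq> pointwise_stabilizer \<Psi> S"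
  by (auto simp: stab_iff subset_iff)

lemma stab_id: "id \<in> pointwise_stabilizer \<Psi> S"
  by (simp add: stab_iff permutes_id)

lemma stab_transpose:
  "x \<in> \<Psi> - S \<Longrightarrow> y \<in> \<Psi> - S \<Longrightarrow> transpose x y \<in> pointwise_stabilizer \<Psi> S"
  by (auto simp: stab_iff intro!: permutes_swap_id) (metis transpose_apply_other)

lemma stab_permutes: "\<tau> permutes T \<Longrightarrow> T \<subseteq> \<Psi> - S \<Longrightarrow> \<tau> \<in> pointwise_stabilizer \<Psi> S"
  by (auto simp: stab_iff intro: permutes_subset) (metis DiffE permutes_not_in subsetD)

lemma stab_all: "g \<in> pointwise_stabilizer \<Psi> \<Psi> \<longleftrightarrow> g = id"
  by (auto simp: stab_iff permutes_id fun_eq_iff permutes_def)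

lemma hom_stab:
  "g \<in> pointwise_stabilizer \<Psi> S \<Longrightarrow> f \<in> hom_ratfuns \<Psi> d \<Longrightarrow> rf_perm g f \<in> hom_ratfuns \<Psi> d"
  by (simp add: stab_iff hom_perm)

section \<open>Smooth representations, stable subspaces and functionals\<close>

locale V0_rep = smooth_semilinear_rep "Sym \<Psi>" "Sym_topology \<Psi>" "V0_field \<Psi>" rf_perm V
  for \<Psi> :: "'p set" and V :: "(('p, 'k::field) ratfun, 'p \<Rightarrow> 'p, 'v) rep" (structure)
begin

abbreviation act :: "('p \<Rightarrow> 'p) \<Rightarrow> 'v \<Rightarrow> 'v" where "act \<equiv> gact V"

abbreviation stab :: "'p set \<Rightarrow> ('p \<Rightarrow> 'p) set" where "stab \<equiv> pointwise_stabilizer \<Psi>"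

abbreviation K :: "('p, 'k) ratfun set" where "K \<equiv> hom_ratfuns \<Psi> 0"

lemma K_mult: "a \<in> K \<Longrightarrow> b \<in> K \<Longrightarrow> a * b \<in> K"
  using hom_mult[of a \<Psi> 0 b 0] by simp

lemma K_inverse: "a \<in> K \<Longrightarrow> inverse a \<in> K"
  using hom_inverse[of a \<Psi> 0] by simp

lemma K_diff: "a \<in> K \<Longrightarrow> b \<in> K \<Longrightarrow> a - b \<in> K"
  using hom_add[OF _ hom_uminus, of a \<Psi> 0 b] by simp

lemma smul_closed [simp]: "a \<in> K \<Longrightarrow> v \<in> carrier V \<Longrightarrow> a \<odot> v \<in> carrier V"
  using smult_closed by (simp add: V0_field_def)

lemma smul_ladd: "a \<in> K \<Longrightarrow> b \<in> K \<Longrightarrow> v \<in> carrier V \<Longrightarrow> (a + b) \<odot> v = a \<odot> v \<oplus> b \<odot> v"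
  using smult_l_distr by (simp add: V0_field_def)

lemma smul_radd: "a \<in> K \<Longrightarrow> v \<in> carrier V \<Longrightarrow> w \<in> carrier V \<Longrightarrow> a \<odot> (v \<oplus> w) = a \<odot> v \<oplus> a \<odot> w"
  using smult_r_distr by (simp add: V0_field_def)

lemma smul_assoc: "a \<in> K \<Longrightarrow> b \<in> K \<Longrightarrow> v \<in> carrier V \<Longrightarrow> (a * b) \<odot> v = a \<odot> (b \<odot> v)"
  using smult_assoc1 by (simp add: V0_field_def)

lemma smul_one [simp]: "v \<in> carrier V \<Longrightarrow> 1 \<odot> v = v"
  using smult_one by (simp add: V0_field_def)

lemma smul_zero [simp]: "v \<in> carrier V \<Longrightarrow> 0 \<odot> v = \<zero>"
  using smult_l_null by (simp add: V0_field_def)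

lemma smul_rzero [simp]: "a \<in> K \<Longrightarrow> a \<odot> \<zero> = \<zero>"
  using smult_r_null by (simp add: V0_field_def)

lemma act_closed [simp]: "g \<in> stab S \<Longrightarrow> v \<in> carrier V \<Longrightarrow> act g v \<in> carrier V"
  using gact_closed by (simp add: pointwise_stabilizer_def)

lemma act_id [simp]: "v \<in> carrier V \<Longrightarrow> act id v = v"
  using gact_one by (simp add: Sym_def)

lemma act_comp: "g \<in> stab S \<Longrightarrow> h \<in> stab S \<Longrightarrow> v \<in> carrier V \<Longrightarrow> act (g \<circ> h) v = act g (act h v)"
  using gact_mult by (simp add: Sym_def stab_iff)

lemma act_add: "g \<in> stab S \<Longrightarrow> v \<in> carrier V \<Longrightarrow> w \<in> carrier V \<Longrightarrow> act g (v \<oplus> w) = act g v \<oplus> act g w"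
  using gact_add by (simp add: pointwise_stabilizer_def)

lemma act_smul: "g \<in> stab S \<Longrightarrow> a \<in> K \<Longrightarrow> v \<in> carrier V \<Longrightarrow> act g (a \<odot> v) = rf_perm g a \<odot> act g v"
  using gact_smult by (simp add: pointwise_stabilizer_def V0_field_def)

lemma act_zero [simp]: "g \<in> stab S \<Longrightarrow> act g \<zero> = \<zero>"
proof -
  assume g: "g \<in> stab S"
  have "act g (0 \<odot> \<zero>) = rf_perm g 0 \<odot> act g \<zero>" using g by (intro act_smul) (auto simp: hom_zero)
  then show ?thesis using act_closed[OF g, of \<zero>] by (simp add: rf_perm_zero stab_bij[OF g])
qed

lemma act_inv [simp]:
  assumes "g \<in> stab S" "v \<in> carrier V"
  shows "act (inv_into UNIV g) (act g v) = v" "act g (act (inv_into UNIV g) v) = v"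
proof -
  have "g permutes \<Psi>" using assms(1) by (simp add: stab_iff)
  then have "inv_into UNIV g \<circ> g = id" "g \<circ> inv_into UNIV g = id"
    by (simp_all add: permutes_inv_o)
  then show "act (inv_into UNIV g) (act g v) = v" "act g (act (inv_into UNIV g) v) = v"
    using assms stab_inv[OF assms(1)] act_comp[of g S "inv_into UNIV g" v]
      act_comp[of "inv_into UNIV g" S g v] by simp_all
qed

lemma smooth_support:
  assumes "v \<in> carrier V"
  obtains F where "finite F" "F \<subseteq> \<Psi>" "\<And>g. g \<in> stab F \<Longrightarrow> act g v = v"
proof -
  have "id \<in> stabilizer (Sym \<Psi>) (gact V) v"
    using assms by (simp add: stabilizer_def Sym_def permutes_id)
  then obtain F where "finite F" "F \<subseteq> \<Psi>" "(\<lambda>h. id \<circ> h) ` stab F \<subseteq> stabilizer (Sym \<Psi>) (gact V) v"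
    using smooth[OF assms] unfolding openin_Sym_topology by blast
  then show thesis by (intro that[of F]) (auto simp: stabilizer_def image_subset_iff)
qed

lemma minus_smul: "v \<in> carrier V \<Longrightarrow> \<ominus> v = (- 1) \<odot> v"
proof -
  assume v: "v \<in> carrier V"
  have "(1 + - 1) \<odot> v = v \<oplus> (- 1) \<odot> v"
    using v by (subst smul_ladd) (auto simp: hom_one hom_uminus)
  then show ?thesis using v by (intro minus_equality) (auto simp: hom_one hom_uminus a_comm)
qed

text \<open>Only the group shrinks with \<open>S\<close>; the scalars remain all of
  \<open>V\<^sub>0\<close>. For \<open>S = {}\<close> these are the subrepresentations, and the
  functionals \<open>shom\<close> on the whole space are the morphisms to
  \<open>V\<^sub>d\<close>.\<close>

definition subsp :: "'p set \<Rightarrow> 'v set \<Rightarrow> bool"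
  where "subsp S U \<longleftrightarrow> U \<subseteq> carrier V \<and> \<zero> \<in> U \<and> (\<forall>v\<in>U. \<forall>w\<in>U. v \<oplus> w \<in> U) \<and>
    (\<forall>a\<in>K. \<forall>v\<in>U. a \<odot> v \<in> U) \<and> (\<forall>g\<in>stab S. \<forall>v\<in>U. act g v \<in> U)"

definition shom :: "'p set \<Rightarrow> int \<Rightarrow> 'v set \<Rightarrow> ('v \<Rightarrow> ('p, 'k) ratfun) \<Rightarrow> bool"
  where "shom S d U h \<longleftrightarrow> (\<forall>v\<in>U. h v \<in> hom_ratfuns \<Psi> d) \<and>
    (\<forall>v\<in>U. \<forall>w\<in>U. h (v \<oplus> w) = h v + h w) \<and> (\<forall>a\<in>K. \<forall>v\<in>U. h (a \<odot> v) = a * h v) \<and>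
    (\<forall>g\<in>stab S. \<forall>v\<in>U. h (act g v) = rf_perm g (h v))"

lemma subspI:
  "\<lbrakk>U \<subseteq> carrier V; \<zero> \<in> U; \<And>v w. v \<in> U \<Longrightarrow> w \<in> U \<Longrightarrow> v \<oplus> w \<in> U;
    \<And>a v. a \<in> K \<Longrightarrow> v \<in> U \<Longrightarrow> a \<odot> v \<in> U; \<And>g v. g \<in> stab S \<Longrightarrow> v \<in> U \<Longrightarrow> act g v \<in> U\<rbrakk> \<Longrightarrow> subsp S U"
  by (simp add: subsp_def)

lemma subspD:
  assumes "subsp S U"
  shows "v \<in> U \<Longrightarrow> v \<in> carrier V" "\<zero> \<in> U" "v \<in> U \<Longrightarrow> w \<in> U \<Longrightarrow> v \<oplus> w \<in> U"
    "a \<in> K \<Longrightarrow> v \<in> U \<Longrightarrow> a \<odot> v \<in> U" "g \<in> stab S \<Longrightarrow> v \<in> U \<Longrightarrow> act g v \<in> U"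
  using assms by (auto simp: subsp_def)

lemma shomI:
  "\<lbrakk>\<And>v. v \<in> U \<Longrightarrow> h v \<in> hom_ratfuns \<Psi> d; \<And>v w. v \<in> U \<Longrightarrow> w \<in> U \<Longrightarrow> h (v \<oplus> w) = h v + h w;
    \<And>a v. a \<in> K \<Longrightarrow> v \<in> U \<Longrightarrow> h (a \<odot> v) = a * h v;
    \<And>g v. g \<in> stab S \<Longrightarrow> v \<in> U \<Longrightarrow> h (act g v) = rf_perm g (h v)\<rbrakk> \<Longrightarrow> shom S d U h"
  by (simp add: shom_def)

lemma shomD:
  assumes "shom S d U h"
  shows "v \<in> U \<Longrightarrow> h v \<in> hom_ratfuns \<Psi> d" "v \<in> U \<Longrightarrow> w \<in> U \<Longrightarrow> h (v \<oplus> w) = h v + h w"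
    "a \<in> K \<Longrightarrow> v \<in> U \<Longrightarrow> h (a \<odot> v) = a * h v" "g \<in> stab S \<Longrightarrow> v \<in> U \<Longrightarrow> h (act g v) = rf_perm g (h v)"
  using assms by (auto simp: shom_def)

lemma subsp_antimono: "S \<subseteq> S' \<Longrightarrow> subsp S U \<Longrightarrow> subsp S' U"
  using stab_antimono[of S S' \<Psi>] unfolding subsp_def by blast

lemma shom_antimono: "S \<subseteq> S' \<Longrightarrow> shom S d U h \<Longrightarrow> shom S' d U h"
  using stab_antimono[of S S' \<Psi>] unfolding shom_def by blast

lemma shom_subset: "U' \<subseteq> U \<Longrightarrow> shom S d U h \<Longrightarrow> shom S d U' h"
  unfolding shom_def by blast

lemma shom_cong:
  assumes "\<And>v. v \<in> U \<Longrightarrow> h' v = h v" "subsp S U" "shom S d U h"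
  shows "shom S d U h'"
  by (rule shomI) (simp_all add: assms(1) subspD[OF assms(2)] shomD[OF assms(3)])

lemma subsp_carrier: "subsp S (carrier V)"
  by (rule subspI) auto

lemma subsp_minus: "subsp S U \<Longrightarrow> v \<in> U \<Longrightarrow> w \<in> U \<Longrightarrow> v \<ominus> w \<in> U"
  unfolding a_minus_def
  by (subst minus_smul) (auto intro!: subspD(3,4) intro: subspD(1) simp: hom_uminus hom_one)

lemma subsp_cancel: "subsp S U \<Longrightarrow> v \<oplus> w \<in> U \<Longrightarrow> w \<in> U \<Longrightarrow> v \<in> carrier V \<Longrightarrow> v \<in> U"
proof -
  assume a: "subsp S U" "v \<oplus> w \<in> U" "w \<in> U" "v \<in> carrier V"
  have "w \<in> carrier V" using a subspD(1) by blast
  then have "(v \<oplus> w) \<ominus> w = v" using a(4) by (simp add: a_minus_def a_assoc r_neg)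
  then show "v \<in> U" using subsp_minus[OF a(1-3)] by simp
qed

lemma subsp_smul_cancel:
  assumes "subsp S U" "a \<odot> v \<in> U" "a \<in> K" "a \<noteq> 0" "v \<in> carrier V"
  shows "v \<in> U"
proof -
  have "inverse a \<odot> (a \<odot> v) = v"
    using assms(3-5) by (simp add: smul_assoc[symmetric] K_inverse)
  then show ?thesis using subspD(4)[OF assms(1) K_inverse[OF assms(3)] assms(2)] by simp
qed

lemma subsp_finsum:
  assumes "subsp S U" "finite I" "\<And>i. i \<in> I \<Longrightarrow> w i \<in> U"
  shows "(\<Oplus>i\<in>I. w i) \<in> U"
  using assms(2,3)
proof (induction I rule: finite_induct)
  case empty
  then show ?case using assms(1) by (simp add: subspD(2))
next
  case (insert x F)
  have "w \<in> F \<rightarrow> carrier V" "w x \<in> carrier V"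
    using insert.prems subspD(1)[OF assms(1)] by auto
  then have "(\<Oplus>i\<in>insert x F. w i) = w x \<oplus> (\<Oplus>i\<in>F. w i)"
    by (intro finsum_insert insert.hyps)
  then show ?case using insert subspD(3)[OF assms(1)] by simp
qed

text \<open>Artin's elimination with vectors as coefficients and modulo a subspace: the sum at
  \<open>mul c e\<close> minus \<open>\<chi> j e\<close> times the sum at \<open>c\<close> no longer
  involves \<open>j\<close>, and the factors \<open>\<chi> i e - \<chi> j e\<close> left on the
  \<open>w i\<close> are nonzero for a suitable \<open>e\<close> and can be cancelled.\<close>

lemma characters_indep:
  assumes U: "subsp S U" and I: "finite I" and w: "\<And>i. i \<in> I \<Longrightarrow> w i \<in> carrier V"
    and \<chi>K: "\<And>i c. i \<in> I \<Longrightarrow> c \<in> M \<Longrightarrow> \<chi> i c \<in> K"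
    and M: "\<And>c e. c \<in> M \<Longrightarrow> e \<in> M \<Longrightarrow> mul c e \<in> M" "e\<^sub>0 \<in> M"
    and \<chi>mult: "\<And>i c e. i \<in> I \<Longrightarrow> c \<in> M \<Longrightarrow> e \<in> M \<Longrightarrow> \<chi> i (mul c e) = \<chi> i c * \<chi> i e"
    and \<chi>1: "\<And>i. i \<in> I \<Longrightarrow> \<chi> i e\<^sub>0 = 1"
    and dist: "\<And>i j. i \<in> I \<Longrightarrow> j \<in> I \<Longrightarrow> i \<noteq> j \<Longrightarrow> \<exists>c\<in>M. \<chi> i c \<noteq> \<chi> j c"
    and sums: "\<And>c. c \<in> M \<Longrightarrow> (\<Oplus>i\<in>I. \<chi> i c \<odot> w i) \<in> U"
  shows "i \<in> I \<Longrightarrow> w i \<in> U"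
  using I w \<chi>K \<chi>mult \<chi>1 dist sums
proof (induction I arbitrary: w i rule: finite_induct)
  case empty
  then show ?case by simp
next
  case (insert j I)
  note wj = insert.prems(2) and \<chi>K = insert.prems(3) and \<chi>mult = insert.prems(4)
    and dist = insert.prems(6) and sums = insert.prems(7)
  have split: "(\<Oplus>i\<in>insert j I. f i) = f j \<oplus> (\<Oplus>i\<in>I. f i)"
    if "\<And>i. i \<in> insert j I \<Longrightarrow> f i \<in> carrier V" for f
    using insert.hyps that by (intro finsum_insert) auto
  have fin: "(\<Oplus>i\<in>I. f i) \<in> carrier V" if "\<And>i. i \<in> I \<Longrightarrow> f i \<in> carrier V" for f
    using that by (intro finsum_closed) auto
  have "(\<Oplus>i\<in>I. \<chi> i c \<odot> ((\<chi> i e - \<chi> j e) \<odot> w i)) \<in> U" if c: "c \<in> M" and e: "e \<in> M" for c e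
  proof -
    let ?d = "\<lambda>i. \<chi> i c \<odot> ((\<chi> i e - \<chi> j e) \<odot> w i)" and ?s = "\<lambda>i. \<chi> j e \<odot> (\<chi> i c \<odot> w i)"
    have cl: "\<chi> i c \<in> K" "\<chi> i e \<in> K" "\<chi> i e - \<chi> j e \<in> K" "w i \<in> carrier V" if "i \<in> insert j I" for i
      using that c e \<chi>K wj by (auto simp: K_diff)
    have jK: "\<chi> j e \<in> K" using \<chi>K e by simp
    have t: "\<chi> i (mul c e) \<odot> w i = ?d i \<oplus> ?s i" if "i \<in> insert j I" for i
    proof -
      have "\<chi> i (mul c e) = \<chi> i c * (\<chi> i e - \<chi> j e) + \<chi> j e * \<chi> i c"
        using \<chi>mult[OF that c e] by (simp add: algebra_simps)
      then show ?thesis using cl[OF that] jK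
        by (simp add: smul_ladd smul_assoc K_mult)
    qed
    have dK: "?d i \<in> carrier V" "?s i \<in> carrier V" if "i \<in> insert j I" for i
      using cl[OF that] jK by auto
    have "(\<Oplus>i\<in>insert j I. \<chi> i (mul c e) \<odot> w i) = (\<Oplus>i\<in>insert j I. ?d i \<oplus> ?s i)"
      by (rule finsum_cong') (use dK t in \<open>blast intro: a_closed\<close>)+
    also have "\<dots> = (\<Oplus>i\<in>insert j I. ?d i) \<oplus> (\<Oplus>i\<in>insert j I. ?s i)"
      by (rule finsum_addf) (use dK in blast)+
    also have "(\<Oplus>i\<in>insert j I. ?d i) = (\<Oplus>i\<in>I. ?d i)"
      using split[of ?d] dK cl(1,4)[of j] fin[of ?d] by simp
    also have "(\<Oplus>i\<in>insert j I. ?s i) = \<chi> j e \<odot> (\<Oplus>i\<in>insert j I. \<chi> i c \<odot> w i)"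
      using finsum_smult_ldistr[of "insert j I" "\<chi> j e" "\<lambda>i. \<chi> i c \<odot> w i"] insert.hyps(1) jK cl
      by (simp add: V0_field_def Pi_iff)
    finally have "(\<Oplus>i\<in>I. ?d i) \<oplus> \<chi> j e \<odot> (\<Oplus>i\<in>insert j I. \<chi> i c \<odot> w i) \<in> U"
      using sums[of "mul c e"] M c e by simp
    then show ?thesis
      by (rule subsp_cancel[OF U]) (use subspD(4)[OF U jK sums[OF c]] fin dK in auto)
  qed
  then have step: "(\<chi> i e - \<chi> j e) \<odot> w i \<in> U" if "e \<in> M" "i \<in> I" for e i
    using insert.IH[of i "\<lambda>i. (\<chi> i e - \<chi> j e) \<odot> w i"] that insert.prems by (simp add: K_diff)
  have wI: "w i \<in> U" if "i \<in> I" for i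
  proof -
    have "i \<noteq> j" using that insert.hyps by blast
    then obtain e where e: "e \<in> M" "\<chi> i e \<noteq> \<chi> j e" using dist[of i j] \<open>i \<in> I\<close> by auto
    show ?thesis
      by (rule subsp_smul_cancel[OF U step[OF e(1) that]]) (use e \<chi>K wj that in \<open>auto simp: K_diff\<close>)
  qed
  have "(\<Oplus>i\<in>insert j I. w i) = (\<Oplus>i\<in>insert j I. \<chi> i e\<^sub>0 \<odot> w i)"
    using insert.prems(5) wj M(2) \<chi>K by (intro finsum_cong') auto
  then have "w j \<oplus> (\<Oplus>i\<in>I. w i) \<in> U"
    using sums[OF M(2)] split[of w] wj by simp
  then have "w j \<in> U"
    by (rule subsp_cancel[OF U]) (use wI wj subsp_finsum[OF U insert.hyps(1)] in auto)
  then show ?case using insert.prems(1) wI by blast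
qed

section \<open>Linear spans\<close>

inductive_set lspan :: "'v set \<Rightarrow> 'v set" for Y where
  zero: "\<zero> \<in> lspan Y"
| step: "y \<in> Y \<Longrightarrow> a \<in> K \<Longrightarrow> w \<in> lspan Y \<Longrightarrow> a \<odot> y \<oplus> w \<in> lspan Y"

lemma lspan_closed: "Y \<subseteq> carrier V \<Longrightarrow> w \<in> lspan Y \<Longrightarrow> w \<in> carrier V"
  by (rotate_tac, induction rule: lspan.induct) auto

lemma lspan_incl: "Y \<subseteq> carrier V \<Longrightarrow> y \<in> Y \<Longrightarrow> y \<in> lspan Y"
  using lspan.step[OF _ hom_one lspan.zero, of y Y] by auto

lemma lspan_subset: "subsp S U \<Longrightarrow> Y \<subseteq> U \<Longrightarrow> lspan Y \<subseteq> U"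
proof
  fix w assume U: "subsp S U" "Y \<subseteq> U" and "w \<in> lspan Y"
  from this(3) show "w \<in> U"
    by induction (use U in \<open>auto intro!: subspD(3,4)[OF U(1)] subspD(2)[OF U(1)]\<close>)
qed

lemma lspan_subsp:
  assumes Y: "Y \<subseteq> carrier V" and inv: "\<And>g y. g \<in> stab S \<Longrightarrow> y \<in> Y \<Longrightarrow> act g y \<in> Y"
  shows "subsp S (lspan Y)"
proof (rule subspI)
  fix v w assume "v \<in> lspan Y" and w: "w \<in> lspan Y"
  from this(1) show "v \<oplus> w \<in> lspan Y"
  proof induction
    case zero
    then show ?case using w lspan_closed[OF Y] by simp
  next
    case (step y a v)
    have "a \<odot> y \<oplus> v \<oplus> w = a \<odot> y \<oplus> (v \<oplus> w)"
      using step w lspan_closed[OF Y] Y by (intro a_assoc) auto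
    then show ?case using step lspan.step by simp
  qed
next
  fix a v assume a: "a \<in> K" and "v \<in> lspan Y"
  from this(2) show "a \<odot> v \<in> lspan Y"
  proof induction
    case (step y b v)
    have "a \<odot> (b \<odot> y \<oplus> v) = (a * b) \<odot> y \<oplus> a \<odot> v"
      using step a lspan_closed[OF Y] Y by (simp add: smul_radd smul_assoc subset_iff)
    then show ?case using step a by (simp add: lspan.step K_mult)
  qed (use a in \<open>simp add: lspan.zero\<close>)
next
  fix g v assume g: "g \<in> stab S" and "v \<in> lspan Y"
  from this(2) show "act g v \<in> lspan Y"
  proof induction
    case (step y b v)
    have "act g (b \<odot> y \<oplus> v) = rf_perm g b \<odot> act g y \<oplus> act g v"
      using step g lspan_closed[OF Y] Y by (simp add: act_add[OF g] act_smul[OF g] subset_iff)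
    moreover have "act g y \<in> Y" "rf_perm g b \<in> K" using step g inv hom_stab[OF g] by auto
    ultimately show ?case using step by (simp add: lspan.step)
  qed (use g in \<open>simp add: lspan.zero\<close>)
qed (use lspan_closed[OF Y] in \<open>auto intro: lspan.zero\<close>)

lemma lspan_mono: "Y \<subseteq> Y' \<Longrightarrow> w \<in> lspan Y \<Longrightarrow> w \<in> lspan Y'"
proof -
  assume "Y \<subseteq> Y'" "w \<in> lspan Y"
  from this(2) show ?thesis
    by induction (use \<open>Y \<subseteq> Y'\<close> in \<open>auto intro: lspan.intros\<close>)
qed

lemma lspan_finite: "w \<in> lspan Y \<Longrightarrow> \<exists>Y'. finite Y' \<and> Y' \<subseteq> Y \<and> w \<in> lspan Y'"
proof (induction rule: lspan.induct)
  case zero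
  then show ?case using lspan.zero by blast
next
  case (step y a w)
  then obtain Y' where "finite Y'" "Y' \<subseteq> Y" "w \<in> lspan Y'" by blast
  then show ?case using step lspan.step[of y "insert y Y'" a w] lspan_mono[of Y' "insert y Y'" w]
    by (intro exI[of _ "insert y Y'"]) auto
qed

text \<open>Occurrences of \<open>y\<close> may be scattered over the derivation of
  \<open>w\<close>; collecting them gives the coefficient of \<open>y\<close> in a relation.\<close>

lemma lspan_insert:
  assumes "insert y Y \<subseteq> carrier V" "w \<in> lspan (insert y Y)"
  shows "\<exists>a\<in>K. \<exists>w'\<in>lspan Y. w = a \<odot> y \<oplus> w'"
  using assms(2)
proof induction
  case zero
  show ?case using assms(1) by (intro bexI[of _ 0] bexI[of _ \<zero>]) (auto simp: hom_zero lspan.zero)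
next
  case (step z b w)
  then obtain a w' where aw: "a \<in> K" "w' \<in> lspan Y" "w = a \<odot> y \<oplus> w'" by blast
  have w': "w' \<in> carrier V" "y \<in> carrier V" "z \<in> carrier V"
    using aw lspan_closed assms(1) step by auto
  show ?case
  proof (cases "z = y")
    case True
    then have "b \<odot> z \<oplus> w = (b + a) \<odot> y \<oplus> w'"
      using aw step w' by (simp add: smul_ladd a_assoc)
    then show ?thesis using aw step hom_add[of b \<Psi> 0 a] by blast
  next
    case False
    then have "b \<odot> z \<oplus> w' \<in> lspan Y" using step aw by (auto intro: lspan.step)
    moreover have "b \<odot> z \<oplus> w = a \<odot> y \<oplus> (b \<odot> z \<oplus> w')"
      using aw step w' by (simp add: a_lcomm)
    ultimately show ?thesis using aw by blast
  qed
qed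

section \<open>Maximal partial functionals\<close>

definition maxhom :: "'p set \<Rightarrow> int \<Rightarrow> 'v set \<Rightarrow> ('v \<Rightarrow> ('p, 'k) ratfun) \<Rightarrow> bool"
  where "maxhom S d A \<phi> \<longleftrightarrow> subsp S A \<and> shom S d A \<phi> \<and>
    (\<forall>B \<psi>. subsp S B \<longrightarrow> shom S d B \<psi> \<longrightarrow> A \<subseteq> B \<longrightarrow> (\<forall>v\<in>A. \<psi> v = \<phi> v) \<longrightarrow> B = A)"

text \<open>Zorn's lemma for graphs: inclusion of graphs means at once that the domain grows and
  that the old values persist.\<close>

lemma maxhom_exists:
  assumes A0: "subsp S A\<^sub>0" "shom S d A\<^sub>0 \<phi>\<^sub>0"
  obtains A \<phi> where "maxhom S d A \<phi>" "A\<^sub>0 \<subseteq> A" "\<And>v. v \<in> A\<^sub>0 \<Longrightarrow> \<phi> v = \<phi>\<^sub>0 v"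
proof -
  define good where "good A \<phi> \<longleftrightarrow> subsp S A \<and> shom S d A \<phi> \<and> A\<^sub>0 \<subseteq> A \<and> (\<forall>v\<in>A\<^sub>0. \<phi> v = \<phi>\<^sub>0 v)" for A \<phi>
  define gr where "gr A \<phi> = (\<lambda>v. (v, \<phi> v)) ` A" for A and \<phi> :: "'v \<Rightarrow> ('p, 'k) ratfun"
  define \<G> where "\<G> = {gr A \<phi> | A \<phi>. good A \<phi>}"
  have "\<exists>M\<in>\<G>. \<forall>X\<in>\<G>. M \<subseteq> X \<longrightarrow> X = M"
  proof (rule subset_Zorn_nonempty)
    show "\<G> \<noteq> {}" using A0 unfolding \<G>_def good_def by blast
    fix C assume C: "C \<noteq> {}" "subset.chain \<G> C"
    define A where "A = fst ` \<Union> C"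
    define \<phi> where "\<phi> v = (THE a. (v, a) \<in> \<Union> C)" for v
    \<comment> \<open>Two vectors of the union already lie in one member of the chain, so every
      closure and linearity condition can be checked inside that member.\<close>
    have sub: "\<exists>B \<psi>. good B \<psi> \<and> gr B \<psi> \<in> C \<and> v \<in> B \<and> w \<in> B" if vw: "v \<in> A" "w \<in> A" for v w
    proof -
      obtain X Y where X: "X \<in> C" "v \<in> fst ` X" and Y: "Y \<in> C" "w \<in> fst ` Y"
        using vw unfolding A_def by blast
      have "X \<subseteq> Y \<or> Y \<subseteq> X" using C(2) X(1) Y(1) unfolding subset.chain_def by blast
      then obtain Z where Z: "Z \<in> C" "v \<in> fst ` Z" "w \<in> fst ` Z" using X Y by blast
      then obtain B \<psi> where "Z = gr B \<psi>" "good B \<psi>" using C(2) unfolding \<G>_def subset.chain_def by blast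
      then show ?thesis using Z by (intro exI[of _ B] exI[of _ \<psi>]) (auto simp: gr_def)
    qed
    have val: "B \<subseteq> A \<and> (\<forall>v\<in>B. \<phi> v = \<psi> v)" if "gr B \<psi> \<in> C" for B \<psi>
    proof (intro conjI ballI)
      show "B \<subseteq> A" using that unfolding A_def gr_def by force
      fix v assume v: "v \<in> B"
      show "\<phi> v = \<psi> v" unfolding \<phi>_def
      proof (rule the_equality)
        show "(v, \<psi> v) \<in> \<Union> C" using that v unfolding gr_def by blast
        fix a assume "(v, a) \<in> \<Union> C"
        then obtain X where X: "X \<in> C" "(v, a) \<in> X" by blast
        have cmp: "X \<subseteq> gr B \<psi> \<or> gr B \<psi> \<subseteq> X" using C(2) X(1) that unfolding subset.chain_def by blast
        obtain B' \<psi>' where X': "X = gr B' \<psi>'" using X(1) C(2) unfolding \<G>_def subset.chain_def by blast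
        have "a = \<psi>' v" using X(2) unfolding X' gr_def by auto
        from cmp show "a = \<psi> v"
        proof
          assume "X \<subseteq> gr B \<psi>"
          then have "(v, a) \<in> gr B \<psi>" using X(2) by blast
          then show ?thesis unfolding gr_def by auto
        next
          assume "gr B \<psi> \<subseteq> X"
          then have "(v, \<psi> v) \<in> X" using v unfolding gr_def by blast
          then show ?thesis unfolding X' \<open>a = \<psi>' v\<close> gr_def by auto
        qed
      qed
    qed
    have "\<Union> C = gr A \<phi>"
    proof (intro Set.set_eqI iffI)
      fix p assume p: "p \<in> \<Union> C"
      then obtain B \<psi> where "gr B \<psi> \<in> C" "p \<in> gr B \<psi>"
        using C(2) unfolding \<G>_def subset.chain_def by blast
      then show "p \<in> gr A \<phi>" using val[of B \<psi>] unfolding gr_def by auto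
    next
      fix p assume "p \<in> gr A \<phi>"
      then obtain v where v: "v \<in> A" "p = (v, \<phi> v)" unfolding gr_def by blast
      then obtain B \<psi> where "gr B \<psi> \<in> C" "v \<in> B" using sub by blast
      then show "p \<in> \<Union> C" using val[of B \<psi>] v unfolding gr_def by blast
    qed
    moreover have "good A \<phi>"
      unfolding good_def
    proof (intro conjI ballI)
      obtain X where "X \<in> C" using C(1) by blast
      then obtain B \<psi> where B: "gr B \<psi> \<in> C" "good B \<psi>" using C(2) unfolding \<G>_def subset.chain_def by blast
      then show "A\<^sub>0 \<subseteq> A" using val[of B \<psi>] unfolding good_def by blast
      show "\<phi> v = \<phi>\<^sub>0 v" if "v \<in> A\<^sub>0" for v using that B val[of B \<psi>] unfolding good_def by (metis subsetD)
      have z: "\<zero> \<in> A" using B val[of B \<psi>] subspD(2) unfolding good_def by blast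
      show "subsp S A"
      proof (rule subspI)
        show "A \<subseteq> carrier V" using sub subspD(1) unfolding good_def by blast
        show "\<zero> \<in> A" by (rule z)
        show "v \<oplus> w \<in> A" if vw: "v \<in> A" "w \<in> A" for v w
          using sub[OF vw] val subspD(3) unfolding good_def by blast
        show "a \<odot> v \<in> A" if "a \<in> K" "v \<in> A" for a v
          using sub[OF that(2,2)] val subspD(4) that(1) unfolding good_def by blast
        show "act g v \<in> A" if "g \<in> stab S" "v \<in> A" for g v
          using sub[OF that(2,2)] val subspD(5) that(1) unfolding good_def by blast
      qed
      show "shom S d A \<phi>"
      proof (rule shomI)
        fix v w assume vw: "v \<in> A" "w \<in> A"
        obtain B \<psi> where B: "good B \<psi>" "gr B \<psi> \<in> C" "v \<in> B" "w \<in> B" using sub[OF vw] by blast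
        then have h: "shom S d B \<psi>" "subsp S B" by (auto simp: good_def)
        have e: "\<phi> x = \<psi> x" if "x \<in> B" for x using val[OF B(2)] that by blast
        show "\<phi> v \<in> hom_ratfuns \<Psi> d" using e[OF B(3)] shomD(1)[OF h(1) B(3)] by simp
        show "\<phi> (v \<oplus> w) = \<phi> v + \<phi> w"
          using e[OF B(3)] e[OF B(4)] e[OF subspD(3)[OF h(2) B(3,4)]] shomD(2)[OF h(1) B(3,4)] by simp
        show "\<phi> (a \<odot> v) = a * \<phi> v" if "a \<in> K" for a
          using e[OF B(3)] e[OF subspD(4)[OF h(2) that B(3)]] shomD(3)[OF h(1) that B(3)] by simp
        show "\<phi> (act g v) = rf_perm g (\<phi> v)" if "g \<in> stab S" for g
          using e[OF B(3)] e[OF subspD(5)[OF h(2) that B(3)]] shomD(4)[OF h(1) that B(3)] by simp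
      qed
    qed
    ultimately show "\<Union> C \<in> \<G>" unfolding \<G>_def by blast
  qed
  then obtain M where M: "M \<in> \<G>" "\<And>X. X \<in> \<G> \<Longrightarrow> M \<subseteq> X \<Longrightarrow> X = M" by blast
  obtain A \<phi> where A1: "good A \<phi>" "M = gr A \<phi>" using M(1) unfolding \<G>_def by blast
  have A2: "gr B \<psi> = gr A \<phi>" if "good B \<psi>" "gr A \<phi> \<subseteq> gr B \<psi>" for B \<psi>
    using M(2)[of "gr B \<psi>"] that A1(2) unfolding \<G>_def by blast
  note A = A1(1) A2
  show thesis
  proof (rule that[of A \<phi>])
    show "A\<^sub>0 \<subseteq> A" "\<And>v. v \<in> A\<^sub>0 \<Longrightarrow> \<phi> v = \<phi>\<^sub>0 v" using A(1) by (auto simp: good_def)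
    show "maxhom S d A \<phi>"
      unfolding maxhom_def
    proof (intro conjI allI impI)
      show "subsp S A" "shom S d A \<phi>" using A(1) by (auto simp: good_def)
      fix B \<psi> assume B: "subsp S B" "shom S d B \<psi>" "A \<subseteq> B" "\<forall>v\<in>A. \<psi> v = \<phi> v"
      have "good B \<psi>" using A(1) B unfolding good_def by (metis subset_trans subsetD)
      moreover have "gr A \<phi> \<subseteq> gr B \<psi>" using B(3,4) unfolding gr_def by force
      ultimately have "gr B \<psi> = gr A \<phi>" by (rule A(2))
      then have "fst ` gr B \<psi> = fst ` gr A \<phi>" by simp
      then show "B = A" unfolding gr_def by (simp add: image_image)
    qed
  qed
qed

end

text \<open>Scalar version of the elimination, for characters on any set with an operation: it
  serves the powers of distinct variables as well as distinct permutations acting on the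
  field.\<close>

lemma characters_indep_field:
  fixes w :: "'i \<Rightarrow> 'f::field"
  assumes I: "finite I"
    and M: "\<And>c e. c \<in> M \<Longrightarrow> e \<in> M \<Longrightarrow> mul c e \<in> M" "e\<^sub>0 \<in> M"
    and \<chi>mult: "\<And>i c e. i \<in> I \<Longrightarrow> c \<in> M \<Longrightarrow> e \<in> M \<Longrightarrow> \<chi> i (mul c e) = \<chi> i c * \<chi> i e"
    and \<chi>1: "\<And>i. i \<in> I \<Longrightarrow> \<chi> i e\<^sub>0 = 1"
    and dist: "\<And>i j. i \<in> I \<Longrightarrow> j \<in> I \<Longrightarrow> i \<noteq> j \<Longrightarrow> \<exists>c\<in>M. \<chi> i c \<noteq> \<chi> j c"
    and sums: "\<And>c. c \<in> M \<Longrightarrow> (\<Sum>i\<in>I. \<chi> i c * w i) = 0"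
  shows "i \<in> I \<Longrightarrow> w i = 0"
  using I \<chi>mult \<chi>1 dist sums
proof (induction I arbitrary: w i rule: finite_induct)
  case (insert j I)
  have "(\<Sum>i\<in>I. \<chi> i c * ((\<chi> i e - \<chi> j e) * w i)) = 0" if "c \<in> M" "e \<in> M" for c e
  proof -
    have "(\<Sum>i\<in>I. \<chi> i c * ((\<chi> i e - \<chi> j e) * w i)) = (\<Sum>i\<in>insert j I. \<chi> i c * ((\<chi> i e - \<chi> j e) * w i))"
      using insert.hyps by simp
    also have "\<dots> = (\<Sum>i\<in>insert j I. \<chi> i (mul c e) * w i) - \<chi> j e * (\<Sum>i\<in>insert j I. \<chi> i c * w i)"
      unfolding sum_distrib_left sum_subtractf[symmetric] using insert.prems(2) that
      by (intro sum.cong) (auto simp: algebra_simps)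
    also have "\<dots> = 0"
      using insert.prems(5)[of c] insert.prems(5)[of "mul c e"] M(1) that by simp
    finally show ?thesis .
  qed
  then have step: "(\<chi> i e - \<chi> j e) * w i = 0" if "e \<in> M" "i \<in> I" for e i
    using insert.IH[of i "\<lambda>i. (\<chi> i e - \<chi> j e) * w i"] that insert.prems by auto
  have wI: "w i = 0" if "i \<in> I" for i
  proof -
    have "i \<noteq> j" using that insert.hyps by blast
    then obtain e where "e \<in> M" "\<chi> i e \<noteq> \<chi> j e" using insert.prems(4)[of i j] \<open>i \<in> I\<close> by auto
    then show ?thesis using step[of e i] \<open>i \<in> I\<close> by simp
  qed
  have "w j = 0" using insert.prems(5)[OF M(2)] insert.hyps insert.prems(3)[of j] wI by simp
  then show ?case using insert.prems(1) wI by blast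
qed simp

lemma rf_perm_inverse: "bij g \<Longrightarrow> rf_perm g (inverse f) = inverse (rf_perm g f)"
  by (cases "f = 0") (auto simp: rf_perm_zero rf_perm_one rf_perm_mult[symmetric] intro!: inverse_unique[symmetric])

lemma rf_perm_powi:
  fixes f :: "('p, 'k::field) ratfun"
  assumes g: "bij g"
  shows "rf_perm g (f powi j) = rf_perm g f powi j"
proof -
  have "rf_perm g (f ^ n) = rf_perm g f ^ n" for f :: "('p, 'k) ratfun" and n
    by (induction n) (auto simp: rf_perm_one rf_perm_mult g)
  then show ?thesis by (simp add: power_int_def rf_perm_inverse g)
qed

lemma rf_var_powi_hom: "x \<in> T \<Longrightarrow> rf_var x powi j \<in> hom_ratfuns T j"
proof -
  assume x: "x \<in> T"
  have p: "f ^ n \<in> hom_ratfuns T (int n * e)" if "f \<in> hom_ratfuns T e" for f n e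
  proof (induction n)
    case (Suc n)
    then show ?case using hom_mult[OF that Suc] by (simp add: distrib_right)
  qed (simp add: hom_one)
  show ?thesis
    using p[OF rf_var_hom[OF x], of "nat j"] p[OF hom_inverse[OF rf_var_hom[OF x]], of "nat (- j)"]
    by (auto simp: power_int_def)
qed

text \<open>Both sides are monomials, and the exponent of \<open>a\<close> is positive on the
  left.\<close>

lemma rf_var_mult_eq:
  assumes "rf_var a * rf_var b' = (rf_var a' * rf_var b :: ('p, 'k::field) ratfun)"
  shows "a = a' \<or> a = b"
proof (rule ccontr)
  assume n: "\<not> (a = a' \<or> a = b)"
  have "mvar a * mvar b' = (mvar a' * mvar b :: ('p, 'k) mpoly)"
    using assms by (simp add: rf_var_def eq_fract)
  then have "mmon (Poly_Mapping.single a 1 + Poly_Mapping.single b' 1) 1 =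
      (mmon (Poly_Mapping.single a' 1 + Poly_Mapping.single b 1) 1 :: ('p, 'k) mpoly)"
    by (simp add: mvar_mmon mmon_mult)
  then have "Poly_Mapping.single (Poly_Mapping.single a 1 + Poly_Mapping.single b' 1) (1::'k) =
      Poly_Mapping.single (Poly_Mapping.single a' 1 + Poly_Mapping.single b (1::nat)) 1"
    by (metis mcoeffs_mmon)
  then have "Poly_Mapping.keys (Poly_Mapping.single (Poly_Mapping.single a 1 + Poly_Mapping.single b' 1) (1::'k)) =
      Poly_Mapping.keys (Poly_Mapping.single (Poly_Mapping.single a' 1 + Poly_Mapping.single b (1::nat)) (1::'k))"
    by simp
  then have "Poly_Mapping.single a 1 + Poly_Mapping.single b' 1 = Poly_Mapping.single a' 1 + Poly_Mapping.single b (1::nat)"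
    by simp
  then have "Poly_Mapping.lookup (Poly_Mapping.single a 1 + Poly_Mapping.single b' 1) a =
      Poly_Mapping.lookup (Poly_Mapping.single a' 1 + Poly_Mapping.single b (1::nat)) a"
    by simp
  then show False using n by (auto simp: lookup_add lookup_single when_def split: if_splits)
qed

lemma rf_var_inj: "inj (rf_var :: 'p \<Rightarrow> ('p, 'k::field) ratfun)"
  using rf_var_mult_eq[where 'k = 'k] by (metis injI)

text \<open>A quotient of two variables has degree zero and tells the permutations apart: for
  \<open>x\<close> with \<open>\<tau> x \<noteq> \<tau>' x\<close>, equality of the images would
  make \<open>\<tau> x\<close> equal to \<open>\<tau>' x\<close> or to \<open>\<tau> y\<close>. A
  second variable \<open>y\<close> exists because both permutations would fix \<open>x\<close> if
  \<open>T = {x}\<close>.\<close>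

lemma permutations_separated:
  assumes "\<tau> permutes T" "\<tau>' permutes T" "\<tau> \<noteq> \<tau>'" "T \<subseteq> D"
  shows "\<exists>c\<in>hom_ratfuns D 0. rf_perm \<tau> c \<noteq> rf_perm \<tau>' (c :: ('p, 'k::field) ratfun)"
proof -
  from assms(3) obtain x where x: "\<tau> x \<noteq> \<tau>' x" by blast
  have xT: "x \<in> T" using x assms(1,2) by (metis permutes_not_in)
  obtain y where y: "y \<in> T" "y \<noteq> x"
    using x assms(1,2) xT permutes_in_image[OF assms(1), of x] permutes_in_image[OF assms(2), of x] by metis
  let ?c = "rf_var x * inverse (rf_var y) :: ('p, 'k) ratfun"
  have b: "bij \<tau>" "bij \<tau>'" using assms(1,2) by (auto simp: permutes_bij)
  have "?c \<in> hom_ratfuns D 0"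
    using hom_mult[OF rf_var_hom hom_inverse[OF rf_var_hom], of x D y] xT y assms(4) by auto
  moreover have "rf_perm \<tau> ?c \<noteq> rf_perm \<tau>' ?c"
  proof
    assume "rf_perm \<tau> ?c = rf_perm \<tau>' ?c"
    then have "rf_var (\<tau> x) * inverse (rf_var (\<tau> y)) = (rf_var (\<tau>' x) * inverse (rf_var (\<tau>' y)) :: ('p, 'k) ratfun)"
      using b by (simp add: rf_perm_mult rf_perm_inverse)
    then have "rf_var (\<tau> x) * rf_var (\<tau>' y) = (rf_var (\<tau>' x) * rf_var (\<tau> y) :: ('p, 'k) ratfun)"
      by (simp add: field_simps)
    then have "\<tau> x = \<tau>' x \<or> \<tau> x = \<tau> y" by (rule rf_var_mult_eq)
    then show False using x y(2) b(1) by (metis bij_is_inj injD)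
  qed
  ultimately show ?thesis by blast
qed

text \<open>A bijection from \<open>P\<close> to \<open>Q\<close> becomes a permutation of the union
  by sending \<open>Q - P\<close> back to \<open>P - Q\<close>, which has the same size.\<close>

lemma permutation_exists:
  assumes "finite P" "finite Q" "card P = card Q"
  obtains r where "r permutes (P \<union> Q)" "r ` P = Q"
proof -
  obtain f where f: "bij_betw f P Q" using assms by (metis finite_same_card_bij)
  have "card (Q - P) = card (P - Q)"
    using assms by (simp add: card_Diff_subset_Int Int_commute)
  then obtain e where e: "bij_betw e (Q - P) (P - Q)" using assms by (metis finite_same_card_bij finite_Diff)
  define r where "r x = (if x \<in> P then f x else if x \<in> Q then e x else x)" for x
  have rP: "bij_betw r P Q" using f by (rule bij_betw_cong[THEN iffD1, rotated]) (simp add: r_def)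
  have "bij_betw r (Q - P) (P - Q)" using e by (rule bij_betw_cong[THEN iffD1, rotated]) (simp add: r_def)
  then have "bij_betw r (P \<union> (Q - P)) (Q \<union> (P - Q))" by (intro bij_betw_combine rP) auto
  moreover have "P \<union> (Q - P) = P \<union> Q" "Q \<union> (P - Q) = P \<union> Q" by auto
  ultimately have "r permutes (P \<union> Q)" by (intro bij_imp_permutes) (auto simp: r_def)
  then show thesis using that rP by (auto simp: bij_betw_def)
qed

lemma stab_image_disjoint:
  "g \<in> pointwise_stabilizer \<Psi> S \<Longrightarrow> T \<subseteq> \<Psi> - S \<Longrightarrow> g ` T \<subseteq> \<Psi> - S"
  by (auto simp: stab_iff permutes_in_image) (metis DiffE permutes_inj injD subsetD)

section \<open>Injectivity\<close>

context V0_rep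
begin

text \<open>A transposition is its own inverse, so this conjugate of \<open>h\<close> plays for
  \<open>u\<close> the role of \<open>h\<close> for \<open>t\<close>. The transposition is merely a
  representative: if \<open>h\<close> respects the permutations fixing \<open>t\<close> and
  \<open>S\<close>, with \<open>t\<close> and \<open>u\<close> outside \<open>S\<close>, then any
  permutation in \<open>stab S\<close> taking \<open>t\<close> to \<open>u\<close> gives the same
  functional.\<close>

definition conjugate :: "'p \<Rightarrow> ('v \<Rightarrow> ('p, 'k) ratfun) \<Rightarrow> 'p \<Rightarrow> 'v \<Rightarrow> ('p, 'k) ratfun"
  where "conjugate t h u v = rf_perm (transpose t u) (h (act (transpose t u) v))"

text \<open>Both sides are conjugates of \<open>h\<close> to the position \<open>g u\<close>; they
  differ by \<open>k\<close>, which fixes \<open>t\<close> and \<open>S\<close> and therefore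
  commutes with \<open>h\<close>.\<close>

lemma conj_equivariant:
  assumes C: "subsp S C" and h: "shom (insert t S) d C h" and t: "t \<in> \<Psi> - S" and u: "u \<in> \<Psi> - S"
    and g: "g \<in> stab S" and v: "v \<in> C"
  shows "conjugate t h (g u) (act g v) = rf_perm g (conjugate t h u v)"
proof -
  define \<tau> \<tau>' k where "\<tau> = transpose t u" and "\<tau>' = transpose t (g u)" and "k = \<tau>' \<circ> g \<circ> \<tau>"
  have gu: "g u \<in> \<Psi> - S" using stab_image_disjoint[OF g, of "{u}"] u by auto
  have st: "\<tau> \<in> stab S" "\<tau>' \<in> stab S" unfolding \<tau>_def \<tau>'_def using t u gu by (auto intro!: stab_transpose)
  have "k \<in> stab S" unfolding k_def using st g by (intro stab_comp) auto
  moreover have "k t = t" by (simp add: k_def \<tau>_def \<tau>'_def)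
  ultimately have k: "k \<in> stab (insert t S)" by (simp add: stab_iff)
  have vX: "v \<in> carrier V" using subspD(1)[OF C v] .
  have c1: "k \<circ> \<tau> = \<tau>' \<circ> g" and c2: "\<tau>' \<circ> k = g \<circ> \<tau>"
    by (auto simp: k_def \<tau>_def \<tau>'_def fun_eq_iff)
  have "act \<tau>' (act g v) = act k (act \<tau> v)"
    using act_comp[OF \<open>k \<in> stab S\<close> st(1) vX] act_comp[OF st(2) g vX] c1 by simp
  then have "h (act \<tau>' (act g v)) = rf_perm k (h (act \<tau> v))"
    using shomD(4)[OF h k] subspD(5)[OF C st(1) v] by simp
  then have "conjugate t h (g u) (act g v) = rf_perm (\<tau>' \<circ> k) (h (act \<tau> v))"
    using stab_bij[OF k] stab_bij[OF st(2)] by (simp add: conjugate_def \<tau>'_def[symmetric] rf_perm_comp)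
  also have "\<dots> = rf_perm g (conjugate t h u v)"
    unfolding c2 using stab_bij[OF g] stab_bij[OF st(1)] by (simp add: conjugate_def \<tau>_def[symmetric] rf_perm_comp)
  finally show ?thesis .
qed

text \<open>Linearity over \<open>V\<^sub>0\<close> survives because the twist of a scalar by the
  transposition on the vector is undone by the transposition on the value.\<close>

lemma conj_linear:
  assumes C: "subsp S C" and h: "shom (insert t S) d C h" and t: "t \<in> \<Psi> - S" and u: "u \<in> \<Psi> - S"
    and v: "v \<in> C" and w: "w \<in> C" and a: "a \<in> K"
  shows "conjugate t h u v \<in> hom_ratfuns \<Psi> d" "conjugate t h u (v \<oplus> w) = conjugate t h u v + conjugate t h u w"
    "conjugate t h u (a \<odot> v) = a * conjugate t h u v"
proof -
  let ?\<tau> = "transpose t u"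
  have st: "?\<tau> \<in> stab S" using t u by (rule stab_transpose)
  have b: "bij ?\<tau>" using stab_bij[OF st] .
  have c: "act ?\<tau> v \<in> C" "act ?\<tau> w \<in> C" using subspD(5)[OF C st] v w by auto
  have vw: "v \<in> carrier V" "w \<in> carrier V" using subspD(1)[OF C] v w by auto
  show "conjugate t h u v \<in> hom_ratfuns \<Psi> d"
    unfolding conjugate_def using hom_stab[OF st] shomD(1)[OF h] c by blast
  show "conjugate t h u (v \<oplus> w) = conjugate t h u v + conjugate t h u w"
    unfolding conjugate_def using act_add[OF st vw] shomD(2)[OF h c] by (simp add: rf_perm_add[OF b])
  have a': "rf_perm ?\<tau> a \<in> K" using hom_stab[OF st] a by blast
  have "rf_perm ?\<tau> (rf_perm ?\<tau> a) = a" using rf_perm_comp[OF b b, of a] by (simp add: rf_perm_id)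
  then show "conjugate t h u (a \<odot> v) = a * conjugate t h u v"
    unfolding conjugate_def using act_smul[OF st a vw(1)] shomD(3)[OF h a' c(1)] by (simp add: rf_perm_mult[OF b])
qed

text \<open>Beyond the support of \<open>v\<close>, swapping two positions fixes \<open>v\<close>
  and hence carries one value to the other; one value thus determines all.\<close>

lemma conj_generic:
  assumes inf: "infinite \<Psi>" and S: "finite S" "S \<subseteq> \<Psi>"
    and C: "subsp S C" and h: "shom (insert t S) d C h" and t: "t \<in> \<Psi> - S" and v: "v \<in> C"
  obtains T where "finite T" "insert t S \<subseteq> T" "T \<subseteq> \<Psi>"
    "\<And>u. u \<in> \<Psi> - T \<Longrightarrow> conjugate t h u v \<in> hom_ratfuns (insert u T) d"
    "\<And>u u'. u \<in> \<Psi> - T \<Longrightarrow> u' \<in> \<Psi> - T \<Longrightarrow> conjugate t h u' v = rf_perm (transpose u u') (conjugate t h u v)"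
proof -
  have vX: "v \<in> carrier V" using subspD(1)[OF C v] .
  obtain F where F: "finite F" "F \<subseteq> \<Psi>" "\<And>g. g \<in> stab F \<Longrightarrow> act g v = v"
    using smooth_support[OF vX] by blast
  have mv: "conjugate t h u' v = rf_perm (transpose u u') (conjugate t h u v)"
    if "u \<in> \<Psi> - (S \<union> F)" "u' \<in> \<Psi> - (S \<union> F)" for u u'
  proof -
    have s: "transpose u u' \<in> stab (S \<union> F)" using that by (rule stab_transpose)
    then have "transpose u u' \<in> stab S" "transpose u u' \<in> stab F"
      using stab_antimono[of S "S \<union> F"] stab_antimono[of F "S \<union> F"] by auto
    then show ?thesis using conj_equivariant[OF C h t _ _ v, of u "transpose u u'"] that F(3) by auto
  qed
  have "infinite (\<Psi> - (F \<union> insert t S))" using inf F(1) S(1) by (intro Diff_infinite_finite) auto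
  then obtain u0 where u0: "u0 \<in> \<Psi> - (F \<union> insert t S)" using infinite_imp_nonempty by blast
  have "conjugate t h u0 v \<in> hom_ratfuns \<Psi> d"
    using conj_linear(1)[OF C h t _ v v hom_zero] u0 by blast
  then obtain T0 where T0: "finite T0" "T0 \<subseteq> \<Psi>" "conjugate t h u0 v \<in> hom_ratfuns T0 d" by (rule hom_support)
  \<comment> \<open>\<open>T\<close> also contains \<open>u0\<close> and the variables of the value
    at \<open>u0\<close>, so that the value at a new \<open>u\<close> involves no variables but
    \<open>u\<close> and those of \<open>T\<close>.\<close>
  define T where "T = F \<union> insert t S \<union> {u0} \<union> T0"
  show thesis
  proof (rule that[of T])
    show "finite T" "insert t S \<subseteq> T" "T \<subseteq> \<Psi>" using F S T0 t u0 by (auto simp: T_def)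
    fix u assume u: "u \<in> \<Psi> - T"
    then have e: "conjugate t h u v = rf_perm (transpose u0 u) (conjugate t h u0 v)"
      using u0 by (intro mv) (auto simp: T_def)
    have "conjugate t h u0 v \<in> hom_ratfuns (insert u T) d"
      using T0(3) hom_mono[of T0 "insert u T"] by (auto simp: T_def)
    moreover have "transpose u0 u permutes insert u T"
      by (rule permutes_swap_id) (auto simp: T_def)
    ultimately show "conjugate t h u v \<in> hom_ratfuns (insert u T) d"
      unfolding e by (intro hom_perm)
    fix u' assume "u' \<in> \<Psi> - T"
    then show "conjugate t h u' v = rf_perm (transpose u u') (conjugate t h u v)"
      using u by (intro mv) (auto simp: T_def)
  qed
qed

text \<open>The second conclusion keeps track of how \<open>h'\<close> arises; agreement with old
  values and nonvanishing are later read off from it.\<close>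

lemma retract:
  assumes inf: "infinite \<Psi>" and S: "finite S" "S \<subseteq> \<Psi>"
    and C: "subsp S C" and h: "shom (insert t S) d C h" and t: "t \<in> \<Psi> - S"
  obtains h' where "shom S d C h'"
    "\<And>v. v \<in> C \<Longrightarrow> \<exists>T. finite T \<and> (\<forall>u\<in>\<Psi> - T. const_term u (conjugate t h u v) = h' v)"
proof -
  define P where "P v z \<longleftrightarrow> (\<exists>T. finite T \<and> (\<forall>u\<in>\<Psi> - T. const_term u (conjugate t h u v) = z))" for v z
  have ex: "\<exists>z\<in>hom_ratfuns \<Psi> d. P v z" if v: "v \<in> C" for v
  proof -
    obtain T where T: "finite T" "insert t S \<subseteq> T" "T \<subseteq> \<Psi>"
      "\<And>u. u \<in> \<Psi> - T \<Longrightarrow> conjugate t h u v \<in> hom_ratfuns (insert u T) d"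
      "\<And>u u'. u \<in> \<Psi> - T \<Longrightarrow> u' \<in> \<Psi> - T \<Longrightarrow> conjugate t h u' v = rf_perm (transpose u u') (conjugate t h u v)"
      using conj_generic[OF inf S C h t v] by blast
    have "infinite (\<Psi> - T)" using inf T(1) by simp
    then obtain u0 where u0: "u0 \<in> \<Psi> - T" using infinite_imp_nonempty by blast
    define z where "z = const_term u0 (conjugate t h u0 v)"
    \<comment> \<open>The constant term at \<open>u0\<close> no longer contains \<open>u0\<close>,
      and swapping \<open>u0\<close> with \<open>u\<close> fixes \<open>T\<close> pointwise; hence
      all positions give the same \<open>z\<close>.\<close>
    have zT: "z \<in> hom_ratfuns T d" unfolding z_def using T(4)[OF u0] by (rule const_term_hom)
    have "const_term u (conjugate t h u v) = z" if u: "u \<in> \<Psi> - T" for u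
    proof -
      have b: "bij (transpose u0 u)" by simp
      have "const_term u (conjugate t h u v) = rf_perm (transpose u0 u) z"
        using const_term_rf_perm[OF b, of u0] T(5)[OF u0 u] by (simp add: z_def)
      also have "\<dots> = z" using u u0 by (intro rf_perm_fix[OF b zT]) (metis DiffE transpose_apply_other)
      finally show ?thesis .
    qed
    then have "P v z" unfolding P_def using T(1) by blast
    then show ?thesis using zT hom_mono[OF T(3)] by blast
  qed
  have uniq: "z = z'" if P: "P v z" "P v z'" for v z z'
  proof -
    obtain T T' where T: "finite T" "\<forall>u\<in>\<Psi> - T. const_term u (conjugate t h u v) = z"
      "finite T'" "\<forall>u\<in>\<Psi> - T'. const_term u (conjugate t h u v) = z'"
      using P unfolding P_def by blast
    have "infinite (\<Psi> - (T \<union> T'))" using inf T(1,3) by simp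
    then obtain u where "u \<in> \<Psi> - (T \<union> T')" using infinite_imp_nonempty by blast
    then show ?thesis using T by auto
  qed
  define h' where "h' v = (THE z. P v z)" for v
  have h'eq: "h' v = z" if "P v z" for v z
    unfolding h'_def using that uniq by blast
  have Ph': "P v (h' v)" "h' v \<in> hom_ratfuns \<Psi> d" if "v \<in> C" for v
    using ex[OF that] h'eq by auto
  show thesis
  proof (rule that[of h'])
    show "\<exists>T. finite T \<and> (\<forall>u\<in>\<Psi> - T. const_term u (conjugate t h u v) = h' v)" if "v \<in> C" for v
      using Ph'(1)[OF that] unfolding P_def .
    show "shom S d C h'"
    proof (rule shomI)
      fix v assume v: "v \<in> C"
      obtain T where T: "finite T" "\<forall>u\<in>\<Psi> - T. const_term u (conjugate t h u v) = h' v"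
        using Ph'(1)[OF v] unfolding P_def by blast
      show "h' v \<in> hom_ratfuns \<Psi> d" by (rule Ph'(2)[OF v])
      show "h' (v \<oplus> w) = h' v + h' w" if w: "w \<in> C" for w
      proof (rule h'eq)
        obtain T' where T': "finite T'" "\<forall>u\<in>\<Psi> - T'. const_term u (conjugate t h u w) = h' w"
          using Ph'(1)[OF w] unfolding P_def by blast
        show "P (v \<oplus> w) (h' v + h' w)"
          unfolding P_def using T T' S(1) conj_linear(2)[OF C h t _ v w hom_zero]
          by (intro exI[of _ "T \<union> T' \<union> S"]) (auto simp: const_term_add)
      qed
      show "h' (a \<odot> v) = a * h' v" if a: "a \<in> K" for a
      proof (rule h'eq)
        \<comment> \<open>The exceptional positions grow by the variables of \<open>a\<close>;
          elsewhere \<open>a\<close> counts as a constant.\<close>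
        obtain T' where T': "finite T'" "a \<in> hom_ratfuns T' 0" using a by (rule hom_support)
        show "P (a \<odot> v) (a * h' v)"
          unfolding P_def using T T' S(1) conj_linear(3)[OF C h t _ v v a]
          by (intro exI[of _ "T \<union> T' \<union> S"]) (auto simp: const_term_mult_free[OF T'(2)])
      qed
      show "h' (act g v) = rf_perm g (h' v)" if g: "g \<in> stab S" for g
      proof (rule h'eq)
        \<comment> \<open>The exceptional positions for \<open>act g v\<close> come from those for
          \<open>v\<close> by applying \<open>g\<close>; outside them the constant term is
          transported along \<open>g\<close>.\<close>
        have "const_term u (conjugate t h u (act g v)) = rf_perm g (h' v)" if u: "u \<in> \<Psi> - (g ` T \<union> S)" for u
        proof -
          have gP: "g permutes \<Psi>" "\<forall>x\<in>S. g x = x" using g by (auto simp: stab_iff)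
          obtain x where x: "u = g x" using stab_bij[OF g] by (metis bij_pointE)
          have "x \<in> \<Psi> - T" "x \<notin> S" using u x gP permutes_in_image[OF gP(1)] by auto
          then show ?thesis
            unfolding x using conj_equivariant[OF C h t _ g v, of x] T(2)
            by (simp add: const_term_rf_perm[OF stab_bij[OF g]])
        qed
        then show "P (act g v) (rf_perm g (h' v))"
          unfolding P_def using T(1) S(1) by (intro exI[of _ "g ` T \<union> S"]) auto
      qed
    qed
  qed
qed

text \<open>Releases the variables of \<open>R\<close> one at a time. On \<open>A\<close> nothing
  changes: there \<open>h\<close> commutes with the transpositions, so every conjugate is
  \<open>h\<close>, and at a position not occurring in \<open>h v\<close> the constant term is
  \<open>h v\<close> itself.\<close>

lemma retract_extends:
  assumes inf: "infinite \<Psi>" and R: "finite R" "R \<subseteq> \<Psi>" and S: "finite S" "S \<subseteq> \<Psi>"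
    and C: "subsp S C" and h: "shom (R \<union> S) d C h" and A: "subsp S A" "A \<subseteq> C" "shom S d A h"
  shows "\<exists>h'. shom S d C h' \<and> (\<forall>v\<in>A. h' v = h v)"
  using R h A(3)
proof (induction R arbitrary: h rule: finite_induct)
  case empty
  then show ?case by auto
next
  case (insert t R)
  show ?case
  proof (cases "t \<in> R \<union> S")
    case True
    then have "insert t R \<union> S = R \<union> S" by auto
    then show ?thesis using insert by simp
  next
    case False
    let ?S = "R \<union> S"
    have S': "finite ?S" "?S \<subseteq> \<Psi>" using insert S by auto
    have C': "subsp ?S C" using C by (rule subsp_antimono[rotated]) simp
    have h: "shom (insert t ?S) d C h" using insert.prems(2) by simp
    have t: "t \<in> \<Psi> - ?S" using insert.prems(1) False by auto
    obtain h1 where h1: "shom ?S d C h1"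
      "\<And>v. v \<in> C \<Longrightarrow> \<exists>T. finite T \<and> (\<forall>u\<in>\<Psi> - T. const_term u (conjugate t h u v) = h1 v)"
      using retract[OF inf S' C' h t] by blast
    have eq: "h1 v = h v" if v: "v \<in> A" for v
    proof -
      obtain T where T: "finite T" "\<forall>u\<in>\<Psi> - T. const_term u (conjugate t h u v) = h1 v"
        using h1(2) v A(2) by blast
      obtain T' where T': "finite T'" "h v \<in> hom_ratfuns T' d"
        using hom_support[OF shomD(1)[OF insert.prems(3) v]] by blast
      have "infinite (\<Psi> - (T \<union> T' \<union> S))" using inf T(1) T'(1) S(1) by simp
      then obtain u where u: "u \<in> \<Psi> - (T \<union> T' \<union> S)" using infinite_imp_nonempty by blast
      have s: "transpose t u \<in> stab S" using t u by (intro stab_transpose) auto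
      have b: "bij (transpose t u)" using stab_bij[OF s] .
      have "conjugate t h u v = h v"
        unfolding conjugate_def shomD(4)[OF insert.prems(3) s v]
        using rf_perm_comp[OF b b, of "h v"] by (simp add: rf_perm_id)
      moreover have "const_term u (conjugate t h u v) = h1 v" using T(2) u by auto
      moreover have "const_term u (h v) = h v" using const_term_free[OF T'(2)] u by auto
      ultimately show ?thesis by simp
    qed
    have "shom S d A h1" using eq A(1) insert.prems(3) by (rule shom_cong)
    from insert.IH[OF _ h1(1) this] insert.prems(1) obtain h' where
      "shom S d C h'" "\<forall>v\<in>A. h' v = h1 v" by auto
    then show ?thesis using eq by auto
  qed
qed

section \<open>Extension by zero and maximality\<close>

lemma subsp_sum:
  assumes A: "subsp S A" and N: "subsp S N"
  shows "subsp S {a \<oplus> w | a w. a \<in> A \<and> w \<in> N}" (is "subsp S ?B")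
proof (rule subspI)
  note cA = subspD[OF A] and cN = subspD[OF N]
  show "?B \<subseteq> carrier V" using cA(1) cN(1) by auto
  show "\<zero> \<in> ?B" using cA(2) cN(2) by force
  show "v \<oplus> w \<in> ?B" if vw: "v \<in> ?B" "w \<in> ?B" for v w
  proof -
    obtain a b a' b' where ab: "v = a \<oplus> b" "a \<in> A" "b \<in> N" "w = a' \<oplus> b'" "a' \<in> A" "b' \<in> N"
      using vw by blast
    then have "v \<oplus> w = (a \<oplus> a') \<oplus> (b \<oplus> b')" using cA(1) cN(1) by (simp add: a_ac)
    then show ?thesis using ab cA(3) cN(3) by blast
  qed
  show "c \<odot> v \<in> ?B" if c: "c \<in> K" and v: "v \<in> ?B" for c v
  proof -
    obtain a b where ab: "v = a \<oplus> b" "a \<in> A" "b \<in> N" using v by blast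
    then have "c \<odot> v = c \<odot> a \<oplus> c \<odot> b" using c cA(1) cN(1) by (simp add: smul_radd)
    then show ?thesis using ab c cA(4) cN(4) by blast
  qed
  show "act g v \<in> ?B" if g: "g \<in> stab S" and v: "v \<in> ?B" for g v
  proof -
    obtain a b where ab: "v = a \<oplus> b" "a \<in> A" "b \<in> N" using v by blast
    then have "act g v = act g a \<oplus> act g b" using cA(1) cN(1) by (simp add: act_add[OF g])
    then show ?thesis using ab g cA(5) cN(5) by blast
  qed
qed

text \<open>The value on \<open>a \<oplus> w\<close> is \<open>\<phi> a\<close>; the trivial
  intersection makes the decomposition unique.\<close>

lemma extend_by_complement:
  assumes A: "subsp S A" and N: "subsp S N" and AN: "A \<inter> N \<subseteq> {\<zero>}" and \<phi>: "shom S d A \<phi>"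
  obtains B \<psi> where "subsp S B" "shom S d B \<psi>" "A \<subseteq> B" "N \<subseteq> B" "\<And>v. v \<in> A \<Longrightarrow> \<psi> v = \<phi> v"
proof -
  note AX = subspD(1)[OF A] and NX = subspD(1)[OF N]
  define B where "B = {a \<oplus> w | a w. a \<in> A \<and> w \<in> N}"
  define \<psi> where "\<psi> x = (THE y. \<exists>a\<in>A. \<exists>w\<in>N. x = a \<oplus> w \<and> y = \<phi> a)" for x
  have \<psi>eq: "\<psi> (a \<oplus> w) = \<phi> a" if aw: "a \<in> A" "w \<in> N" for a w
    unfolding \<psi>_def
  proof (rule the_equality)
    fix y assume "\<exists>a'\<in>A. \<exists>w'\<in>N. a \<oplus> w = a' \<oplus> w' \<and> y = \<phi> a'"
    then obtain a' w' where y: "a' \<in> A" "w' \<in> N" "a \<oplus> w = a' \<oplus> w'" "y = \<phi> a'" by blast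
    have cl: "a \<in> carrier V" "w \<in> carrier V" "a' \<in> carrier V" "w' \<in> carrier V"
      using aw y AX NX by auto
    have "a = (a \<oplus> w) \<oplus> \<ominus> w" using cl by (simp add: a_assoc r_neg)
    also have "\<dots> = (w' \<ominus> w) \<oplus> a'" unfolding y(3) using cl by (simp add: a_minus_def a_ac)
    finally have "a \<ominus> a' = ((w' \<ominus> w) \<oplus> a') \<ominus> a'" by simp
    also have "\<dots> = w' \<ominus> w" using cl by (simp add: a_minus_def a_assoc r_neg)
    finally have "a \<ominus> a' \<in> A \<inter> N" using subsp_minus[OF A aw(1) y(1)] subsp_minus[OF N y(2) aw(2)] by simp
    then have "a \<ominus> a' = \<zero>" using AN by blast
    then have "(a \<ominus> a') \<oplus> a' = a'" using cl by simp
    then have "a = a'" using cl by (simp add: a_minus_def a_assoc l_neg)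
    then show "y = \<phi> a" using y(4) by simp
  qed (use aw in blast)
  show thesis
  proof (rule that[of B \<psi>])
    show "A \<subseteq> B" unfolding B_def using AX subspD(2)[OF N] by (force intro: exI[of _ "\<zero>"])
    show "N \<subseteq> B" unfolding B_def using NX subspD(2)[OF A] by force
    show "\<psi> v = \<phi> v" if "v \<in> A" for v
      using \<psi>eq[OF that subspD(2)[OF N]] AX[OF that] by simp
    have add: "(a \<oplus> w) \<oplus> (a' \<oplus> w') = (a \<oplus> a') \<oplus> (w \<oplus> w')"
      if "a \<in> A" "w \<in> N" "a' \<in> A" "w' \<in> N" for a w a' w'
      using that AX NX by (simp add: a_ac)
    have sm: "c \<odot> (a \<oplus> w) = c \<odot> a \<oplus> c \<odot> w" if "c \<in> K" "a \<in> A" "w \<in> N" for c a w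
      using that AX NX by (simp add: smul_radd)
    have ac: "act g (a \<oplus> w) = act g a \<oplus> act g w" if "g \<in> stab S" "a \<in> A" "w \<in> N" for g a w
      using that AX NX by (simp add: act_add[OF that(1)])
    note cA = subspD[OF A] and cN = subspD[OF N]
    show "subsp S B" unfolding B_def using A N by (rule subsp_sum)
    show "shom S d B \<psi>"
    proof (rule shomI)
      fix v assume "v \<in> B"
      then obtain a w where v: "v = a \<oplus> w" "a \<in> A" "w \<in> N" unfolding B_def by blast
      show "\<psi> v \<in> hom_ratfuns \<Psi> d" using v \<psi>eq shomD(1)[OF \<phi>] by simp
      show "\<psi> (v \<oplus> v') = \<psi> v + \<psi> v'" if v'B: "v' \<in> B" for v'
      proof -
        obtain a' w' where v': "v' = a' \<oplus> w'" "a' \<in> A" "w' \<in> N" using v'B unfolding B_def by blast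
        show ?thesis unfolding v(1) v'(1) add[OF v(2,3) v'(2,3)]
          using v v' by (simp add: \<psi>eq cA(3) cN(3) shomD(2)[OF \<phi>])
      qed
      show "\<psi> (c \<odot> v) = c * \<psi> v" if "c \<in> K" for c
        unfolding v(1) sm[OF that v(2,3)] using v that by (simp add: \<psi>eq cA(4) cN(4) shomD(3)[OF \<phi>])
      show "\<psi> (act g v) = rf_perm g (\<psi> v)" if "g \<in> stab S" for g
        unfolding v(1) ac[OF that v(2,3)] using v that by (simp add: \<psi>eq cA(5) cN(5) shomD(4)[OF \<phi>])
    qed
  qed
qed

lemma maxhomD:
  assumes "maxhom S d A \<phi>"
  shows "subsp S A" "shom S d A \<phi>"
    "subsp S B \<Longrightarrow> shom S d B \<psi> \<Longrightarrow> A \<subseteq> B \<Longrightarrow> (\<And>v. v \<in> A \<Longrightarrow> \<psi> v = \<phi> v) \<Longrightarrow> B = A"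
  using assms unfolding maxhom_def by blast+

text \<open>Extending by zero along \<open>N\<close> cannot enlarge a maximal domain.\<close>

lemma maxhom_complement:
  assumes "maxhom S d A \<phi>" "subsp S N" "A \<inter> N \<subseteq> {\<zero>}"
  shows "N \<subseteq> A"
proof -
  obtain B \<psi> where "subsp S B" "shom S d B \<psi>" "A \<subseteq> B" "N \<subseteq> B" "\<And>v. v \<in> A \<Longrightarrow> \<psi> v = \<phi> v"
    using extend_by_complement[OF maxhomD(1)[OF assms(1)] assms(2,3) maxhomD(2)[OF assms(1)]] by blast
  then show ?thesis using maxhomD(3)[OF assms(1), of B \<psi>] by blast
qed

lemma lspan_single:
  assumes "v \<in> carrier V" "w \<in> lspan {v}"
  obtains a where "a \<in> K" "w = a \<odot> v"
proof -
  obtain a w' where "a \<in> K" "w' \<in> lspan {}" "w = a \<odot> v \<oplus> w'"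
    using lspan_insert[of v "{}" w] assms by auto
  moreover from this(2) have "w' = \<zero>" by (cases rule: lspan.cases) auto
  ultimately show thesis using that assms(1) by simp
qed

text \<open>A line meets \<open>A\<close> trivially or lies in it. With \<open>S = \<Psi>\<close>,
  where only the identity remains, every vector qualifies; this is the form used for finite
  \<open>\<Psi>\<close>.\<close>

lemma maxhom_contains_fixed:
  assumes m: "maxhom S d A \<phi>" and v: "v \<in> carrier V" "\<And>g. g \<in> stab S \<Longrightarrow> act g v = v"
  shows "v \<in> A"
proof (rule ccontr)
  assume nv: "v \<notin> A"
  have N: "subsp S (lspan {v})" using v by (intro lspan_subsp) auto
  have "A \<inter> lspan {v} \<subseteq> {\<zero>}"
  proof
    fix w assume w: "w \<in> A \<inter> lspan {v}"
    then obtain a where a: "a \<in> K" "w = a \<odot> v" using lspan_single[OF v(1)] by blast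
    have "a = 0" using subsp_smul_cancel[OF maxhomD(1)[OF m], of a v] w a v(1) nv by auto
    then show "w \<in> {\<zero>}" using a v by simp
  qed
  then have "lspan {v} \<subseteq> A" using maxhom_complement[OF m N] by blast
  then show False using nv v lspan_incl[of "{v}" v] by blast
qed

text \<open>\<open>IH\<close> is \<open>maxhom_contains\<close> for fewer new variables. It ranges
  over arbitrary base sets and maximal functionals because it is applied to a larger base
  \<open>R\<close> and to an extension \<open>B\<close> of \<open>A\<close>.\<close>

lemma maxhom_contains_symmetric:
  assumes inf: "infinite \<Psi>" and S: "finite S" "S \<subseteq> \<Psi>" and m: "maxhom S d A \<phi>"
    and T: "finite T" "T \<subseteq> \<Psi> - S" and v: "v \<in> carrier V"
    and sym: "\<And>g. g \<in> stab S \<Longrightarrow> g ` T = T \<Longrightarrow> act g v = v"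
    and IH: "\<And>R T' A' \<phi>' v'. \<lbrakk>finite R; R \<subseteq> \<Psi>; maxhom R d A' \<phi>'; finite T'; T' \<subseteq> \<Psi>; card T' < card T;
      v' \<in> carrier V; \<And>g. g \<in> stab (R \<union> T') \<Longrightarrow> act g v' = v'\<rbrakk> \<Longrightarrow> v' \<in> A'"
  shows "v \<in> A"
proof (rule ccontr)
  assume nv: "v \<notin> A"
  note A = maxhomD(1)[OF m]
  \<comment> \<open>Two permutations with the same image of \<open>T\<close> differ by one that
    preserves \<open>T\<close>, so the translate depends on the image only.\<close>
  have eqv: "act g v = act g' v" if g: "g \<in> stab S" "g' \<in> stab S" and e: "g ` T = g' ` T" for g g'
  proof -
    let ?i = "inv_into UNIV g'"
    have i: "?i \<in> stab S" using g(2) by (rule stab_inv)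
    have "(?i \<circ> g) ` T = ?i ` (g' ` T)" using e by (metis image_comp)
    also have "\<dots> = T" using stab_bij[OF g(2)] by (simp add: image_comp bij_is_inj)
    finally have "act (?i \<circ> g) v = v" using sym[OF stab_comp[OF i g(1)]] by blast
    then have "act ?i (act g v) = v" using act_comp[OF i g(1) v] by simp
    then have "act g' (act ?i (act g v)) = act g' v" by simp
    then show ?thesis using g v by simp
  qed
  define Y where "Y = (\<lambda>g. act g v) ` stab S"
  have YX: "Y \<subseteq> carrier V" unfolding Y_def using v by auto
  have vY: "v \<in> Y" unfolding Y_def using stab_id[of \<Psi> S] v by (force intro: image_eqI[of _ _ id])
  have N: "subsp S (lspan Y)"
  proof (rule lspan_subsp[OF YX])
    fix g y assume g: "g \<in> stab S" and "y \<in> Y"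
    then obtain k where k: "k \<in> stab S" "y = act k v" unfolding Y_def by blast
    then have "act g y = act (g \<circ> k) v" using act_comp[OF g k(1) v] by simp
    then show "act g y \<in> Y" unfolding Y_def using stab_comp[OF g k(1)] by blast
  qed
  have "\<not> A \<inter> lspan Y \<subseteq> {\<zero>}"
    using maxhom_complement[OF m N] lspan_incl[OF YX vY] nv by blast
  then obtain w where w: "w \<in> A" "w \<in> lspan Y" "w \<noteq> \<zero>" by blast
  \<comment> \<open>A shortest expression of \<open>w\<close> by translates has only nonzero
    coefficients, so it can be solved for any chosen \<open>y\<close>.\<close>
  define Q where "Q Z \<longleftrightarrow> finite Z \<and> Z \<subseteq> Y \<and> w \<in> lspan Z" for Z
  have "\<exists>Z. Q Z" unfolding Q_def using lspan_finite[OF w(2)] by blast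
  then obtain Z where Z: "Q Z" "\<And>Z'. Q Z' \<Longrightarrow> card Z \<le> card Z'"
    using ex_has_least_nat[of Q _ card] by blast
  have "Z \<noteq> {}"
  proof
    assume "Z = {}"
    then have "w \<in> lspan {}" using Z(1) by (simp add: Q_def)
    then show False using w(3) by (cases rule: lspan.cases) auto
  qed
  then obtain y where y: "y \<in> Z" by blast
  have Zy: "insert y (Z - {y}) = Z" using y by blast
  have ZX: "Z \<subseteq> carrier V" using Z(1) YX unfolding Q_def by blast
  obtain a w' where aw: "a \<in> K" "w' \<in> lspan (Z - {y})" "w = a \<odot> y \<oplus> w'"
    using lspan_insert[of y "Z - {y}" w] Z(1) ZX unfolding Zy Q_def by blast
  have w'X: "w' \<in> carrier V" using aw(2) ZX lspan_closed[of "Z - {y}"] by blast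
  have yX: "y \<in> carrier V" using y ZX by blast
  have a0: "a \<noteq> 0"
  proof
    assume "a = 0"
    then have "w = w'" using aw(3) w'X yX by simp
    then have "Q (Z - {y})" using Z(1) aw(2) unfolding Q_def by blast
    then have "card Z \<le> card (Z - {y})" by (rule Z(2))
    moreover have "finite Z" using Z(1) unfolding Q_def by blast
    ultimately show False using y by (metis card_Diff1_less not_less)
  qed
  have "\<forall>x\<in>Y. \<exists>g. g \<in> stab S \<and> x = act g v" unfolding Y_def by blast
  then obtain \<gamma> where \<gamma>: "\<And>x. x \<in> Y \<Longrightarrow> \<gamma> x \<in> stab S" "\<And>x. x \<in> Y \<Longrightarrow> x = act (\<gamma> x) v" by metis
  \<comment> \<open>\<open>R\<close> freezes variables of the other translates but none of
    \<open>y\<close>: the others then have fewer new variables, while \<open>y\<close> remains as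
    generic over \<open>R\<close> as it was over \<open>S\<close>.\<close>
  define R where "R = S \<union> ((\<Union>x\<in>Z - {y}. \<gamma> x ` T) - \<gamma> y ` T)"
  have ZY: "Z \<subseteq> Y" "finite Z" using Z(1) unfolding Q_def by auto
  have img: "g ` T \<subseteq> \<Psi> - S" if "g \<in> stab S" for g using stab_image_disjoint[OF that T(2)] .
  have R: "finite R" "R \<subseteq> \<Psi>" "S \<subseteq> R"
  proof -
    have "\<gamma> x ` T \<subseteq> \<Psi>" if "x \<in> Z" for x using img[OF \<gamma>(1), of x] that ZY by blast
    then show "finite R" "R \<subseteq> \<Psi>" "S \<subseteq> R" unfolding R_def using S T(1) ZY by auto
  qed
  have yR: "\<gamma> y ` T \<inter> R = {}" using img[OF \<gamma>(1), of y] y ZY(1) unfolding R_def by blast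
  obtain B \<psi> where B: "maxhom R d B \<psi>" "A \<subseteq> B" "\<And>v. v \<in> A \<Longrightarrow> \<psi> v = \<phi> v"
    using maxhom_exists[OF subsp_antimono[OF R(3) A] shom_antimono[OF R(3) maxhomD(2)[OF m]]] by blast
  note Bs = maxhomD(1)[OF B(1)]
  \<comment> \<open>A translate that shares a variable with \<open>R\<close> has fewer than
    \<open>card T\<close> variables outside \<open>R\<close>.\<close>
  have meets: "act g v \<in> B" if g: "g \<in> stab S" and ne: "g ` T \<inter> R \<noteq> {}" for g
  proof (rule IH[OF R(1,2) B(1)])
    show "finite (g ` T - R)" using T(1) by simp
    show "g ` T - R \<subseteq> \<Psi>" using img[OF g] by blast
    have "card (g ` T - R) < card (g ` T)" using ne T(1) by (intro psubset_card_mono) auto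
    then show "card (g ` T - R) < card T" using card_image_le[OF T(1), of g] by simp
    show "act g v \<in> carrier V" using g v by simp
    fix k assume k: "k \<in> stab (R \<union> (g ` T - R))"
    have kS: "k \<in> stab S" and kT: "\<forall>x\<in>g ` T. k x = x"
      using k R(3) by (auto simp: stab_iff)
    have "(k \<circ> g) ` T = g ` T" using kT by (force simp: image_iff)
    then have "act (k \<circ> g) v = act g v" using eqv[OF stab_comp[OF kS g] g] by blast
    then show "act k (act g v) = act g v" using act_comp[OF kS g v] by simp
  qed
  have yB: "y \<in> B"
  proof -
    have "x \<in> B" if x: "x \<in> Z - {y}" for x
    proof -
      have xY: "x \<in> Y" "y \<in> Y" using x y ZY by auto
      \<comment> \<open>Distinct translates have distinct variable sets of equal size, so
        \<open>x\<close> involves a variable that \<open>y\<close> does not, and this variable lies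
        in \<open>R\<close>.\<close>
      have "\<gamma> x ` T \<noteq> \<gamma> y ` T"
        using eqv[OF \<gamma>(1)[OF xY(1)] \<gamma>(1)[OF xY(2)]] \<gamma>(2)[OF xY(1)] \<gamma>(2)[OF xY(2)] x by auto
      moreover have "card (\<gamma> x ` T) = card (\<gamma> y ` T)"
        using stab_bij[OF \<gamma>(1)[OF xY(1)]] stab_bij[OF \<gamma>(1)[OF xY(2)]]
        by (metis bij_is_inj card_image inj_on_subset subset_UNIV)
      ultimately have "\<not> \<gamma> x ` T \<subseteq> \<gamma> y ` T"
        using T(1) by (metis card_subset_eq finite_imageI)
      then have "\<gamma> x ` T \<inter> R \<noteq> {}" using x unfolding R_def by blast
      then show ?thesis using meets[OF \<gamma>(1)[OF xY(1)]] \<gamma>(2)[OF xY(1)] by simp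
    qed
    then have "lspan (Z - {y}) \<subseteq> B" by (intro lspan_subset[OF Bs]) blast
    then have "a \<odot> y \<in> B"
      using subsp_cancel[OF Bs, of "a \<odot> y" w'] aw w(1) B(2) yX by auto
    then show ?thesis by (rule subsp_smul_cancel[OF Bs _ aw(1) a0 yX])
  qed
  have all: "act g v \<in> B" if g: "g \<in> stab S" for g
  proof (cases "g ` T \<inter> R = {}")
    case True
    have yY: "y \<in> Y" using y ZY by blast
    have "card (\<gamma> y ` T) = card (g ` T)"
      using stab_bij[OF g] stab_bij[OF \<gamma>(1)[OF yY]]
      by (metis bij_is_inj card_image inj_on_subset subset_UNIV)
    \<comment> \<open>The remaining translates have all their variables outside \<open>R\<close>,
      like \<open>y\<close>; a permutation fixing \<open>R\<close> carries \<open>y\<close> to each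
      of them.\<close>
    then obtain r where r: "r permutes (\<gamma> y ` T \<union> g ` T)" "r ` \<gamma> y ` T = g ` T"
      using permutation_exists[of "\<gamma> y ` T" "g ` T"] T(1) by blast
    have rR: "r \<in> stab R"
      using r(1) by (rule stab_permutes) (use True yR img[OF g] img[OF \<gamma>(1)[OF yY]] in blast)
    then have rS: "r \<in> stab S" using stab_antimono[OF R(3)] by blast
    have "act g v = act (r \<circ> \<gamma> y) v"
      using eqv[OF g stab_comp[OF rS \<gamma>(1)[OF yY]]] r(2) by (simp add: image_comp)
    also have "\<dots> = act r y" using act_comp[OF rS \<gamma>(1)[OF yY] v] \<gamma>(2)[OF yY] by simp
    finally show ?thesis using subspD(5)[OF Bs rR yB] by simp
  qed (use meets[OF g] in blast)
  \<comment> \<open>\<open>B\<close> is stable under the smaller group only. \<open>C\<close> is its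
    largest part stable under \<open>stab S\<close>; it contains \<open>A\<close> and
    \<open>v\<close>, and on it \<open>\<psi>\<close> can be retracted to \<open>S\<close>.\<close>
  define C where "C = {x \<in> carrier V. \<forall>g\<in>stab S. act g x \<in> B}"
  have C: "subsp S C"
  proof (rule subspI)
    show "act g x \<in> C" if g: "g \<in> stab S" and x: "x \<in> C" for g x
    proof -
      have "act k (act g x) \<in> B" if "k \<in> stab S" for k
        using act_comp[OF that g, of x] x stab_comp[OF that g] unfolding C_def by auto
      then show ?thesis using g x unfolding C_def by auto
    qed
    show "a \<odot> x \<in> C" if "a \<in> K" "x \<in> C" for a x
      using that hom_stab[of _ \<Psi> S a 0] by (auto simp: C_def act_smul[of _ S] intro!: subspD(4)[OF Bs])
  qed (auto simp: C_def act_add[of _ S] intro!: subspD(2,3)[OF Bs])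
  have AC: "A \<subseteq> C" using subspD(1,5)[OF A] B(2) unfolding C_def by blast
  have CB: "C \<subseteq> B" unfolding C_def using stab_id[of \<Psi> S] by force
  have vC: "v \<in> C" unfolding C_def using v all by blast
  have RS: "R \<union> S = R" using R(3) by blast
  have \<psi>C: "shom (R \<union> S) d C \<psi>" unfolding RS using CB maxhomD(2)[OF B(1)] by (rule shom_subset)
  have "shom S d A \<psi>" using B(3) A maxhomD(2)[OF m] by (rule shom_cong)
  from retract_extends[OF inf R(1,2) S C \<psi>C A AC this] obtain h' where
    "shom S d C h'" "\<forall>v\<in>A. h' v = \<psi> v" by blast
  then have "C = A" using maxhomD(3)[OF m C _ AC] B(3) by auto
  then show False using vC nv by blast
qed

lemma act_finsum:
  assumes g: "g \<in> stab S" and I: "finite I" and w: "\<And>i. i \<in> I \<Longrightarrow> w i \<in> carrier V"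
  shows "act g (\<Oplus>i\<in>I. w i) = (\<Oplus>i\<in>I. act g (w i))"
  using I w
proof (induction I rule: finite_induct)
  case empty
  then show ?case using g by simp
next
  case (insert i I)
  have "(\<Oplus>i\<in>insert i I. w i) = w i \<oplus> (\<Oplus>i\<in>I. w i)"
    "(\<Oplus>i\<in>insert i I. act g (w i)) = act g (w i) \<oplus> (\<Oplus>i\<in>I. act g (w i))"
    using insert g by (auto intro!: finsum_insert)
  then show ?case using insert by (simp add: act_add[OF g] finsum_closed Pi_iff)
qed

text \<open>For scalars \<open>c\<close> in the variables \<open>S \<union> T\<close>, the sum of
  the translates of \<open>c \<odot> v\<close> by the permutations of \<open>T - S\<close> is
  symmetric, so \<open>maxhom_contains_symmetric\<close> puts it into \<open>A\<close>; independence
  of characters recovers \<open>v\<close> from these sums.\<close>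

lemma maxhom_contains:
  assumes inf: "infinite \<Psi>"
  shows "\<lbrakk>finite S; S \<subseteq> \<Psi>; maxhom S d A \<phi>; finite T; T \<subseteq> \<Psi>; v \<in> carrier V;
    \<And>g. g \<in> stab (S \<union> T) \<Longrightarrow> act g v = v\<rbrakk> \<Longrightarrow> v \<in> A"
proof (induction "card T" arbitrary: S T A \<phi> v rule: less_induct)
  case less
  note m = less.prems(3) and vX = less.prems(6)
  define U where "U = T - S"
  have U: "finite U" "U \<subseteq> \<Psi> - S" "card U \<le> card T" and SU: "S \<union> U = S \<union> T"
    using less.prems by (auto simp: U_def intro: card_mono)
  let ?I = "{\<tau>. \<tau> permutes U}"
  have I: "finite ?I" using U(1) by (rule finite_permutations)
  have \<tau>: "\<tau> \<in> stab S" if "\<tau> \<in> ?I" for \<tau> using stab_permutes[OF _ U(2)] that by blast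
  define t where "t c \<tau> = rf_perm \<tau> c \<odot> act \<tau> v" for c \<tau>
  \<comment> \<open>Scalars in these variables only, so that \<open>c \<odot> v\<close> is fixed by
    \<open>stab (S \<union> T)\<close> just like \<open>v\<close>.\<close>
  let ?M = "hom_ratfuns (S \<union> T) 0 :: ('p, 'k) ratfun set"
  have MK: "c \<in> K" if "c \<in> ?M" for c using that hom_mono[of "S \<union> T" \<Psi> 0] less.prems by blast
  have tX: "t c \<tau> \<in> carrier V" if "c \<in> ?M" "\<tau> \<in> ?I" for c \<tau>
    unfolding t_def by (intro smul_closed act_closed[OF \<tau>[OF that(2)] vX] hom_stab[OF \<tau>[OF that(2)]] MK that)
  have comp: "act g (t c \<tau>) = t c (g \<circ> \<tau>)" if "g \<in> stab S" "\<tau> \<in> ?I" "c \<in> ?M" for g \<tau> c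
  proof -
    have "act g (t c \<tau>) = rf_perm g (rf_perm \<tau> c) \<odot> act g (act \<tau> v)"
      unfolding t_def by (intro act_smul[OF that(1)] act_closed[OF \<tau>[OF that(2)] vX] hom_stab[OF \<tau>[OF that(2)]] MK that(3))
    then show ?thesis
      unfolding t_def act_comp[OF that(1) \<tau>[OF that(2)] vX]
      by (simp add: rf_perm_comp[OF stab_bij[OF that(1)] stab_bij[OF \<tau>[OF that(2)]]])
  qed
  have sum_in: "(\<Oplus>\<tau>\<in>?I. t c \<tau>) \<in> A" if c: "c \<in> ?M" for c
  proof (rule maxhom_contains_symmetric[OF inf less.prems(1,2) m U(1,2)])
    show vc: "(\<Oplus>\<tau>\<in>?I. t c \<tau>) \<in> carrier V" using tX[OF c] by (intro finsum_closed) auto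
    show "v' \<in> A'" if "finite R" "R \<subseteq> \<Psi>" "maxhom R d A' \<phi>'" "finite T'" "T' \<subseteq> \<Psi>" "card T' < card U"
      "v' \<in> carrier V" "\<And>g. g \<in> stab (R \<union> T') \<Longrightarrow> act g v' = v'" for R T' A' \<phi>' v'
      using less.hyps[OF _ that(1-5,7,8)] that(6) U(3) by simp
    fix g assume g: "g \<in> stab S" and gU: "g ` U = U"
    \<comment> \<open>\<open>g\<close> is split into the permutation it induces on \<open>U\<close>,
      which permutes the summands, and a factor \<open>k\<close> fixing \<open>S\<close> and
      \<open>U\<close> pointwise, which fixes each summand.\<close>
    define \<rho> where "\<rho> x = (if x \<in> U then g x else x)" for x
    have ginj: "inj g" using stab_bij[OF g] by (rule bij_is_inj)
    have "bij_betw g U U" using gU ginj by (metis bij_betw_def inj_on_subset subset_UNIV)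
    then have "bij_betw \<rho> U U" by (rule bij_betw_cong[THEN iffD1, rotated]) (simp add: \<rho>_def)
    then have \<rho>: "\<rho> permutes U" by (rule bij_imp_permutes) (simp add: \<rho>_def)
    then have \<rho>S: "\<rho> \<in> stab S" by (intro \<tau>) simp
    define k where "k = inv_into UNIV \<rho> \<circ> g"
    have gk: "g = \<rho> \<circ> k" using permutes_inv_o(1)[OF \<rho>] by (simp add: k_def o_assoc)
    have kS: "k \<in> stab S" unfolding k_def using stab_comp[OF stab_inv[OF \<rho>S] g] .
    have kU: "k x = x" if "x \<in> U" for x
      using that permutes_inverses(2)[OF \<rho>, of x] by (simp add: k_def \<rho>_def)
    then have k: "k \<in> stab (S \<union> T)" using kS unfolding SU[symmetric] by (auto simp: stab_iff)
    have tk: "t c (k \<circ> \<tau>) = t c \<tau>" if "\<tau> \<in> ?I" for \<tau>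
    proof -
      let ?i = "inv_into UNIV \<tau>"
      have s: "\<tau> \<in> stab S" using \<tau>[OF that] .
      \<comment> \<open>Conjugation moves \<open>k\<close> past \<open>\<tau>\<close>; the result
        still fixes \<open>S\<close> and, as \<open>\<tau>\<close> preserves \<open>U\<close>, also
        every element of \<open>U\<close>.\<close>
      define l where "l = ?i \<circ> k \<circ> \<tau>"
      have kl: "k \<circ> \<tau> = \<tau> \<circ> l"
        using that permutes_inv_o(1)[of \<tau> U] by (simp add: l_def o_assoc)
      have "l \<in> stab S" unfolding l_def by (intro stab_comp stab_inv s kS)
      moreover have "l x = x" if "x \<in> U" for x
        using that \<open>\<tau> \<in> ?I\<close> kU[of "\<tau> x"] permutes_in_image[of \<tau> U x] permutes_inverses(2)[of \<tau> U x]
        by (simp add: l_def)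
      ultimately have l: "l \<in> stab (S \<union> T)" unfolding SU[symmetric] by (auto simp: stab_iff)
      have "rf_perm (k \<circ> \<tau>) c = rf_perm \<tau> c"
        unfolding kl using rf_perm_fix[OF stab_bij[OF l] c] l stab_bij[OF l] stab_bij[OF s]
        by (simp add: rf_perm_comp stab_iff)
      moreover have "act (k \<circ> \<tau>) v = act \<tau> v"
        unfolding kl using act_comp[OF s \<open>l \<in> stab S\<close> vX] less.prems(7)[OF l] by simp
      ultimately show ?thesis by (simp add: t_def)
    qed
    have "act k (\<Oplus>\<tau>\<in>?I. t c \<tau>) = (\<Oplus>\<tau>\<in>?I. act k (t c \<tau>))"
      by (rule act_finsum[OF kS I]) (use tX[OF c] in blast)
    also have "\<dots> = (\<Oplus>\<tau>\<in>?I. t c \<tau>)"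
      by (rule finsum_cong') (use tX[OF c] comp[OF kS _ c] tk in auto)
    finally have 1: "act k (\<Oplus>\<tau>\<in>?I. t c \<tau>) = (\<Oplus>\<tau>\<in>?I. t c \<tau>)" .
    have im: "(\<lambda>\<tau>. \<rho> \<circ> \<tau>) ` ?I = ?I" using image_compose_permutations_left[OF \<rho>] by (auto simp: image_def)
    have "act \<rho> (\<Oplus>\<tau>\<in>?I. t c \<tau>) = (\<Oplus>\<tau>\<in>?I. act \<rho> (t c \<tau>))"
      by (rule act_finsum[OF \<rho>S I]) (use tX[OF c] in blast)
    also have "\<dots> = (\<Oplus>\<tau>\<in>?I. t c (\<rho> \<circ> \<tau>))"
      by (rule finsum_cong') (use tX[OF c] comp[OF \<rho>S _ c] im in auto)
    also have "\<dots> = (\<Oplus>\<tau>\<in>(\<lambda>\<tau>. \<rho> \<circ> \<tau>) ` ?I. t c \<tau>)"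
    proof (rule finsum_reindex[symmetric])
      show "t c \<in> (\<lambda>\<tau>. \<rho> \<circ> \<tau>) ` ?I \<rightarrow> carrier V" unfolding im using tX[OF c] by blast
      show "inj_on (\<lambda>\<tau>. \<rho> \<circ> \<tau>) ?I"
        by (rule inj_on_subset[OF fun.inj_map[OF permutes_inj[OF \<rho>]]]) simp
    qed
    finally have 2: "act \<rho> (\<Oplus>\<tau>\<in>?I. t c \<tau>) = (\<Oplus>\<tau>\<in>?I. t c \<tau>)" unfolding im .
    show "act g (\<Oplus>\<tau>\<in>?I. t c \<tau>) = (\<Oplus>\<tau>\<in>?I. t c \<tau>)"
      unfolding gk act_comp[OF \<rho>S kS vc] 1 2 ..
  qed
  have "act id v \<in> A"
  proof (rule characters_indep[OF maxhomD(1)[OF m] I, where w = "\<lambda>\<tau>. act \<tau> v" and \<chi> = rf_perm and M = ?M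
        and mul = "(*)" and e\<^sub>0 = 1])
    show "act i v \<in> carrier V" if "i \<in> ?I" for i using \<tau>[OF that] vX by simp
    show "rf_perm i c \<in> K" if "i \<in> ?I" "c \<in> ?M" for i c using hom_stab[OF \<tau>[OF that(1)]] MK that by blast
    show "c * e \<in> ?M" if "c \<in> ?M" "e \<in> ?M" for c e using hom_mult[OF that] by simp
    show "1 \<in> ?M" by (rule hom_one)
    show "rf_perm i (c * e) = rf_perm i c * rf_perm i e" if "i \<in> ?I" for i c e
      using rf_perm_mult[OF stab_bij[OF \<tau>[OF that]]] .
    show "rf_perm i 1 = 1" if "i \<in> ?I" for i using rf_perm_one[OF stab_bij[OF \<tau>[OF that]]] .
    show "\<exists>c\<in>?M. rf_perm i c \<noteq> rf_perm j c" if "i \<in> ?I" "j \<in> ?I" "i \<noteq> j" for i j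
      using permutations_separated[of i U j "S \<union> T"] that by (auto simp: U_def)
    show "(\<Oplus>i\<in>?I. rf_perm i c \<odot> act i v) \<in> A" if "c \<in> ?M" for c
      using sum_in[OF that] by (simp add: t_def)
    show "id \<in> ?I" by (simp add: permutes_id)
  qed
  then show ?case using vX by simp
qed

lemma extension_infinite:
  assumes inf: "infinite \<Psi>" and S: "finite S" "S \<subseteq> \<Psi>" and A: "subsp S A" "shom S d A \<phi>"
  obtains h where "shom S d (carrier V) h" "\<And>v. v \<in> A \<Longrightarrow> h v = \<phi> v"
proof -
  obtain B \<psi> where B: "maxhom S d B \<psi>" "A \<subseteq> B" "\<And>v. v \<in> A \<Longrightarrow> \<psi> v = \<phi> v"
    using maxhom_exists[OF A] by blast
  have "B = carrier V"
  proof
    show "B \<subseteq> carrier V" using subspD(1)[OF maxhomD(1)[OF B(1)]] by blast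
    show "carrier V \<subseteq> B"
    proof
      fix v assume v: "v \<in> carrier V"
      then obtain F where F: "finite F" "F \<subseteq> \<Psi>" "\<And>g. g \<in> stab F \<Longrightarrow> act g v = v"
        using smooth_support by blast
      show "v \<in> B"
      proof (rule maxhom_contains[OF inf S B(1) F(1,2) v])
        fix g assume "g \<in> stab (S \<union> F)"
        then show "act g v = v" using F(3) stab_antimono[of F "S \<union> F" \<Psi>] by blast
      qed
    qed
  qed
  then show thesis using that[of \<psi>] maxhomD(2)[OF B(1)] B(3) by simp
qed

end

section \<open>Cogeneration\<close>

context V0_rep
begin

text \<open>On the line through a vector fixed by \<open>stab S\<close>, taking the coefficient is
  equivariant; this supplies the first functional, of degree zero.\<close>

lemma fixed_functional:
  assumes v: "v \<in> carrier V" "v \<noteq> \<zero>" and fixed: "\<And>g. g \<in> stab S \<Longrightarrow> act g v = v"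
  obtains \<phi> where "subsp S (lspan {v})" "shom S 0 (lspan {v}) \<phi>" "v \<in> lspan {v}" "\<phi> v = 1"
proof -
  have zero: "subsp S {\<zero>}" by (rule subspI) auto
  have inj: "a = b" if "a \<odot> v = b \<odot> v" "a \<in> K" "b \<in> K" for a b
  proof (rule ccontr)
    assume "a \<noteq> b"
    have "a \<odot> v = (a - b) \<odot> v \<oplus> b \<odot> v" using smul_ladd[OF K_diff[OF that(2,3)] that(3) v(1)] by simp
    then have "(a - b) \<odot> v \<oplus> b \<odot> v = \<zero> \<oplus> b \<odot> v" using that v by simp
    then have "(a - b) \<odot> v = \<zero>" using that v by (simp add: K_diff)
    then show False using subsp_smul_cancel[OF zero, of "a - b" v] v that \<open>a \<noteq> b\<close> by (simp add: K_diff)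
  qed
  define \<phi> where "\<phi> w = (THE a. a \<in> K \<and> w = a \<odot> v)" for w
  have \<phi>: "\<phi> (a \<odot> v) = a" if "a \<in> K" for a
    unfolding \<phi>_def using that inj by blast
  have N: "subsp S (lspan {v})" using v fixed by (intro lspan_subsp) auto
  show thesis
  proof (rule that[of \<phi>])
    show "v \<in> lspan {v}" using lspan_incl[of "{v}" v] v by simp
    show "\<phi> v = 1" using \<phi>[of 1] v by (simp add: hom_one)
    show "shom S 0 (lspan {v}) \<phi>"
    proof (rule shomI)
      fix w assume "w \<in> lspan {v}"
      then obtain a where a: "a \<in> K" "w = a \<odot> v" using lspan_single[OF v(1)] by blast
      show "\<phi> w \<in> K" using a \<phi> by simp
      show "\<phi> (w \<oplus> w') = \<phi> w + \<phi> w'" if w': "w' \<in> lspan {v}" for w'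
      proof -
        obtain b where b: "b \<in> K" "w' = b \<odot> v" using w' lspan_single[OF v(1)] by blast
        have "w \<oplus> w' = (a + b) \<odot> v" using a b v smul_ladd by simp
        then show ?thesis using a b \<phi> hom_add[OF a(1) b(1)] by simp
      qed
      show "\<phi> (c \<odot> w) = c * \<phi> w" if "c \<in> K" for c
        using a that \<phi>[OF a(1)] \<phi>[OF K_mult[OF that a(1)]] smul_assoc[OF that a(1) v(1)] by simp
      show "\<phi> (act g w) = rf_perm g (\<phi> w)" if "g \<in> stab S" for g
        using a that \<phi>[OF a(1)] \<phi>[OF hom_stab[OF that a(1)]] act_smul[OF that a(1) v(1)] fixed[OF that] by simp
    qed
  qed (rule N)
qed

text \<open>Permutations fixing \<open>t\<close> fix every power of \<open>t\<close>, so
  multiplication by it costs no equivariance over \<open>insert t S\<close>, only a change of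
  degree.\<close>

lemma shom_twist:
  assumes h: "shom (insert t S) d C h" and t: "t \<in> \<Psi>"
  shows "shom (insert t S) (d + j) C (\<lambda>w. h w * rf_var t powi j)"
proof (rule shomI)
  fix v assume v: "v \<in> C"
  show "h v * rf_var t powi j \<in> hom_ratfuns \<Psi> (d + j)"
    using hom_mult[OF shomD(1)[OF h v] rf_var_powi_hom[OF t]] .
  fix g assume g: "g \<in> stab (insert t S)"
  have "g t = t" using g by (simp add: stab_iff)
  then show "h (act g v) * rf_var t powi j = rf_perm g (h v * rf_var t powi j)"
    using shomD(4)[OF h g v] stab_bij[OF g] by (simp add: rf_perm_mult rf_perm_powi)
qed (auto simp: shomD(2,3)[OF h] algebra_simps)

lemma conj_twist:
  "conjugate t (\<lambda>w. h w * rf_var t powi j) u w = conjugate t h u w * rf_var u powi j"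
  by (simp add: conjugate_def rf_perm_mult rf_perm_powi)

text \<open>On vectors where only finitely many conjugates are nonzero, summing them is legitimate
  and equivariant under \<open>stab S\<close>. The plain sum may cancel at \<open>v\<close>, hence
  the weights \<open>rf_var u ^ e\<close>.\<close>

lemma finite_conj_functional:
  assumes h: "shom (insert t S) d (carrier V) h" and t: "t \<in> \<Psi> - S"
    and v: "v \<in> carrier V" "h v \<noteq> 0" and fin: "finite {u \<in> \<Psi> - S. conjugate t h u v \<noteq> 0}"
  obtains A \<phi> e where "subsp S A" "shom S e A \<phi>" "v \<in> A" "\<phi> v \<noteq> 0"
proof -
  define supp where "supp w = {u \<in> \<Psi> - S. conjugate t h u w \<noteq> 0}" for w
  define A where "A = {w \<in> carrier V. finite (supp w)}"
  define \<mu> where "\<mu> e w = (\<Sum>u\<in>supp w. conjugate t h u w * rf_var u ^ e)" for e w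
  note lin = conj_linear[OF subsp_carrier h t]
  have add: "conjugate t h u (w \<oplus> w') = conjugate t h u w + conjugate t h u w'"
    if "u \<in> \<Psi> - S" "w \<in> carrier V" "w' \<in> carrier V" for u w w'
    using lin(2)[OF that hom_zero] .
  have smul: "conjugate t h u (a \<odot> w) = a * conjugate t h u w"
    if "u \<in> \<Psi> - S" "w \<in> carrier V" "a \<in> K" for u w a
    using lin(3)[OF that(1,2,2,3)] .
  have equiv: "conjugate t h (g u) (act g w) = rf_perm g (conjugate t h u w)"
    if "g \<in> stab S" "u \<in> \<Psi> - S" "w \<in> carrier V" for g u w
    using conj_equivariant[OF subsp_carrier h t that(2,1,3)] .
  \<comment> \<open>Enlarging the index set adds only zeros; this puts two vectors over a common
    index set.\<close>
  have alt: "\<mu> e w = (\<Sum>u\<in>D. conjugate t h u w * rf_var u ^ e)"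
    if "finite D" "supp w \<subseteq> D" "D \<subseteq> \<Psi> - S" for e w D
    unfolding \<mu>_def using that by (intro sum.mono_neutral_left) (auto simp: supp_def)
  have s_add: "supp (w \<oplus> w') \<subseteq> supp w \<union> supp w'" if "w \<in> carrier V" "w' \<in> carrier V" for w w'
    using that by (auto simp: supp_def add)
  have s_smul: "supp (a \<odot> w) \<subseteq> supp w" if "w \<in> carrier V" "a \<in> K" for w a
    using that by (auto simp: supp_def smul)
  have s_act: "supp (act g w) = g ` supp w" if g: "g \<in> stab S" and w: "w \<in> carrier V" for g w
  proof (intro equalityI subsetI)
    fix u assume u: "u \<in> supp (act g w)"
    obtain x where x: "u = g x" using stab_bij[OF g] by (metis bij_pointE)
    have gP: "g permutes \<Psi>" "\<forall>x\<in>S. g x = x" using g by (auto simp: stab_iff)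
    have "x \<in> \<Psi> - S" using u x gP permutes_in_image[OF gP(1)] by (auto simp: supp_def)
    then have "x \<in> supp w" using u x equiv[OF g _ w, of x] stab_bij[OF g] by (auto simp: supp_def rf_perm_zero)
    then show "u \<in> g ` supp w" using x by blast
  next
    fix u assume "u \<in> g ` supp w"
    then obtain x where x: "x \<in> supp w" "u = g x" by blast
    then have "g x \<in> \<Psi> - S" using stab_image_disjoint[OF g, of "{x}"] by (auto simp: supp_def)
    then show "u \<in> supp (act g w)"
      using x equiv[OF g _ w, of x] rf_perm_eq_zero_iff[OF stab_bij[OF g]] by (auto simp: supp_def)
  qed
  have A: "subsp S A"
  proof (rule subspI)
    have "supp \<zero> = {}" using smul[of _ \<zero> 0] by (auto simp: supp_def hom_zero)
    then show "\<zero> \<in> A" by (simp add: A_def)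
    show "w \<oplus> w' \<in> A" if "w \<in> A" "w' \<in> A" for w w'
      using that s_add[of w w'] by (auto simp: A_def intro: finite_subset)
    show "a \<odot> w \<in> A" if "a \<in> K" "w \<in> A" for w a
      using that s_smul[of w a] by (auto simp: A_def intro: finite_subset)
    show "act g w \<in> A" if "g \<in> stab S" "w \<in> A" for g w
      using that s_act[of g w] by (auto simp: A_def)
  qed (auto simp: A_def)
  have hom: "shom S (d + int e) A (\<mu> e)" for e
  proof (rule shomI)
    fix w assume w: "w \<in> A"
    then have wX: "w \<in> carrier V" "finite (supp w)" by (auto simp: A_def)
    show "\<mu> e w \<in> hom_ratfuns \<Psi> (d + int e)"
      unfolding \<mu>_def
    proof (rule hom_sum)
      fix u assume "u \<in> supp w"
      then have u: "u \<in> \<Psi> - S" by (simp add: supp_def)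
      then have "rf_var u powi int e \<in> hom_ratfuns \<Psi> (int e)" by (intro rf_var_powi_hom) simp
      then show "conjugate t h u w * rf_var u ^ e \<in> hom_ratfuns \<Psi> (d + int e)"
        using hom_mult[OF lin(1)[OF u wX(1) wX(1) hom_zero]] by (simp del: power_int_of_nat add: power_int_of_nat[symmetric])
    qed
    show "\<mu> e (w \<oplus> w') = \<mu> e w + \<mu> e w'" if "w' \<in> A" for w'
    proof -
      have w'X: "w' \<in> carrier V" "finite (supp w')" using that by (auto simp: A_def)
      let ?D = "supp w \<union> supp w'"
      have D: "finite ?D" "?D \<subseteq> \<Psi> - S" using wX w'X by (auto simp: supp_def)
      have "\<mu> e (w \<oplus> w') = (\<Sum>u\<in>?D. conjugate t h u w * rf_var u ^ e + conjugate t h u w' * rf_var u ^ e)"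
        unfolding alt[OF D(1) s_add[OF wX(1) w'X(1)] D(2)]
        by (rule sum.cong) (use D(2) add[OF _ wX(1) w'X(1)] in \<open>auto simp: algebra_simps\<close>)
      then show ?thesis by (simp add: sum.distrib alt[OF D(1) _ D(2)])
    qed
    show "\<mu> e (a \<odot> w) = a * \<mu> e w" if a: "a \<in> K" for a
    proof -
      have D: "supp w \<subseteq> \<Psi> - S" by (auto simp: supp_def)
      show ?thesis
        unfolding alt[OF wX(2) s_smul[OF wX(1) a] D] \<mu>_def[of e w] sum_distrib_left
        by (rule sum.cong) (use D smul[OF _ wX(1) a] in auto)
    qed
    show "\<mu> e (act g w) = rf_perm g (\<mu> e w)" if g: "g \<in> stab S" for g
    proof -
      have b: "bij g" using stab_bij[OF g] .
      have "\<mu> e (act g w) = (\<Sum>u\<in>supp w. conjugate t h (g u) (act g w) * rf_var (g u) ^ e)"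
        unfolding \<mu>_def[of e "act g w"] s_act[OF g wX(1)]
        by (rule sum.reindex[unfolded o_def]) (rule inj_on_subset[OF bij_is_inj[OF b] subset_UNIV])
      also have "\<dots> = (\<Sum>u\<in>supp w. rf_perm g (conjugate t h u w * rf_var u ^ e))"
      proof (rule sum.cong)
        fix u assume "u \<in> supp w"
        then have "u \<in> \<Psi> - S" by (simp add: supp_def)
        from equiv[OF g this wX(1)] show "conjugate t h (g u) (act g w) * rf_var (g u) ^ e = rf_perm g (conjugate t h u w * rf_var u ^ e)"
          using rf_perm_powi[OF b, of "rf_var u :: ('p, 'k) ratfun" "int e"] b by (simp add: rf_perm_mult)
      qed simp
      also have "\<dots> = rf_perm g (\<mu> e w)" unfolding \<mu>_def by (rule rf_perm_sum[OF b, symmetric])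
      finally show ?thesis .
    qed
  qed
  have "\<exists>e. \<mu> e v \<noteq> 0"
  proof (rule ccontr)
    assume z: "\<not> (\<exists>e. \<mu> e v \<noteq> 0)"
    \<comment> \<open>Distinct variables give distinct characters
      \<open>e \<mapsto> rf_var u ^ e\<close> of the natural numbers (a Vandermonde argument), so if
      all weighted sums vanish, so does each conjugate, in particular the one at \<open>t\<close>,
      which is \<open>h\<close>.\<close>
    have "conjugate t h t v = 0"
    proof (rule characters_indep_field[where I = "supp v" and M = "UNIV :: nat set" and mul = "(+)" and e\<^sub>0 = 0
          and \<chi> = "\<lambda>u e. rf_var u ^ e" and w = "\<lambda>u. conjugate t h u v"])
      show "finite (supp v)" using fin by (simp add: supp_def)
      show "\<exists>c\<in>UNIV. rf_var i ^ c \<noteq> (rf_var j ^ c :: ('p, 'k) ratfun)" if "i \<noteq> j" for i j :: 'p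
        using that rf_var_inj[where 'k = 'k and 'p = 'p] by (intro bexI[of _ 1]) (auto simp: inj_eq)
      show "(\<Sum>u\<in>supp v. rf_var u ^ c * conjugate t h u v) = 0" for c
        using z by (simp add: \<mu>_def mult.commute)
      show "t \<in> supp v" using t v by (simp add: supp_def conjugate_def rf_perm_id)
    qed (auto simp: power_add)
    then show False using v by (simp add: conjugate_def rf_perm_id)
  qed
  then obtain e where "\<mu> e v \<noteq> 0" by blast
  moreover have "v \<in> A" using v fin by (simp add: A_def supp_def)
  ultimately show thesis using that[OF A hom] by blast
qed

text \<open>The variables of \<open>v\<close> start in \<open>S\<close>, where a functional is
  immediate, and are released one at a time into \<open>T\<close>.\<close>

lemma cogenerated_infinite:
  assumes inf: "infinite \<Psi>" and v: "v \<in> carrier V" "v \<noteq> \<zero>"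
  shows "\<lbrakk>finite T; finite S; S \<subseteq> \<Psi>; T \<subseteq> \<Psi>; \<And>g. g \<in> stab (T \<union> S) \<Longrightarrow> act g v = v\<rbrakk> \<Longrightarrow>
    \<exists>d h. shom S d (carrier V) h \<and> h v \<noteq> 0"
proof (induction T arbitrary: S rule: finite_induct)
  case empty
  obtain \<phi> where \<phi>: "subsp S (lspan {v})" "shom S 0 (lspan {v}) \<phi>" "v \<in> lspan {v}" "\<phi> v = 1"
    using fixed_functional[OF v, of S] empty by auto
  obtain h where "shom S 0 (carrier V) h" "\<And>w. w \<in> lspan {v} \<Longrightarrow> h w = \<phi> w"
    using extension_infinite[OF inf empty(1,2) \<phi>(1,2)] by blast
  then show ?case using \<phi>(3,4) by (metis zero_neq_one)
next
  case (insert t T)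
  show ?case
  proof (cases "t \<in> S")
    case True
    then have "insert t T \<union> S = T \<union> S" by auto
    then show ?thesis using insert by auto
  next
    case False
    then have t: "t \<in> \<Psi> - S" using insert.prems by auto
    have eq: "T \<union> insert t S = insert t T \<union> S" by auto
    obtain d h where h: "shom (insert t S) d (carrier V) h" "h v \<noteq> 0"
      using insert.IH[of "insert t S"] insert.prems unfolding eq by auto
    obtain T' where T': "finite T'" "insert t S \<subseteq> T'" "T' \<subseteq> \<Psi>"
      "\<And>u. u \<in> \<Psi> - T' \<Longrightarrow> conjugate t h u v \<in> hom_ratfuns (insert u T') d"
      "\<And>u u'. u \<in> \<Psi> - T' \<Longrightarrow> u' \<in> \<Psi> - T' \<Longrightarrow> conjugate t h u' v = rf_perm (transpose u u') (conjugate t h u v)"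
      using conj_generic[OF inf insert.prems(1,2) subsp_carrier h(1) t v(1)] by blast
    have "infinite (\<Psi> - T')" using inf T'(1) by simp
    then obtain u where u: "u \<in> \<Psi> - T'" using infinite_imp_nonempty by blast
    show ?thesis
    \<comment> \<open>All generic positions behave alike: either only finitely many conjugates are
      nonzero at \<open>v\<close>, or the value is nonzero at every generic position and has a
      nonzero Laurent coefficient.\<close>
    proof (cases "conjugate t h u v = 0")
      case True
      then have "conjugate t h u' v = 0" if "u' \<in> \<Psi> - T'" for u'
        using T'(5)[OF u that] by (simp add: rf_perm_zero)
      then have "{u \<in> \<Psi> - S. conjugate t h u v \<noteq> 0} \<subseteq> T'" by blast
      then have "finite {u \<in> \<Psi> - S. conjugate t h u v \<noteq> 0}" using T'(1) by (rule finite_subset)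
      then obtain A \<phi> e where A: "subsp S A" "shom S e A \<phi>" "v \<in> A" "\<phi> v \<noteq> 0"
        using finite_conj_functional[OF h(1) t v(1) h(2)] by blast
      obtain h' where "shom S e (carrier V) h'" "\<And>w. w \<in> A \<Longrightarrow> h' w = \<phi> w"
        using extension_infinite[OF inf insert.prems(1,2) A(1,2)] by blast
      then show ?thesis using A(3,4) by metis
    next
      case False
      then obtain j where j: "const_term u (conjugate t h u v * rf_var u powi j) \<noteq> 0"
        by (rule const_term_powi_neq_zero)
      \<comment> \<open>Twisting by \<open>rf_var t powi j\<close> multiplies the conjugate at
        \<open>u\<close> by the same power of \<open>rf_var u\<close>, which brings the nonzero
        coefficient to index zero.\<close>
      let ?h = "\<lambda>w. h w * rf_var t powi j"
      have "shom (insert t S) (d + j) (carrier V) ?h" using h(1) t by (intro shom_twist) auto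
      then obtain h' where h': "shom S (d + j) (carrier V) h'"
        "\<And>w. w \<in> carrier V \<Longrightarrow> \<exists>T. finite T \<and> (\<forall>u\<in>\<Psi> - T. const_term u (conjugate t ?h u w) = h' w)"
        using retract[OF inf insert.prems(1,2) subsp_carrier _ t] by blast
      from h'(2)[OF v(1)] obtain F where F: "finite F" "\<forall>u\<in>\<Psi> - F. const_term u (conjugate t ?h u v) = h' v" by blast
      \<comment> \<open>The exponent was found at \<open>u\<close>, but \<open>h' v\<close> is known
        only through positions outside \<open>F\<close>; a swap transports the nonvanishing to such
        a \<open>u'\<close>.\<close>
      have "infinite (\<Psi> - (T' \<union> F))" using inf T'(1) F(1) by simp
      then obtain u' where u': "u' \<in> \<Psi> - (T' \<union> F)" using infinite_imp_nonempty by blast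
      let ?\<sigma> = "transpose u u'"
      have "conjugate t ?h u' v = rf_perm ?\<sigma> (conjugate t h u v * rf_var u powi j)"
        unfolding conj_twist using T'(5)[OF u, of u'] u' by (simp add: rf_perm_mult rf_perm_powi)
      moreover have "h' v = const_term u' (conjugate t ?h u' v)" using F(2) u' by auto
      ultimately have "h' v = rf_perm ?\<sigma> (const_term u (conjugate t h u v * rf_var u powi j))"
        using const_term_rf_perm[of ?\<sigma> u "conjugate t h u v * rf_var u powi j"] by simp
      then have "h' v \<noteq> 0" using j by (simp add: rf_perm_eq_zero_iff)
      then show ?thesis using h'(1) by blast
    qed
  qed
qed

section \<open>Finite sets of variables\<close>

lemma extension_linear:
  assumes "subsp \<Psi> A" "shom \<Psi> d A \<phi>"
  obtains h where "shom \<Psi> d (carrier V) h" "\<And>v. v \<in> A \<Longrightarrow> h v = \<phi> v"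
proof -
  obtain B \<psi> where B: "maxhom \<Psi> d B \<psi>" "A \<subseteq> B" "\<And>v. v \<in> A \<Longrightarrow> \<psi> v = \<phi> v"
    using maxhom_exists[OF assms] by blast
  have "v \<in> B" if "v \<in> carrier V" for v
    using maxhom_contains_fixed[OF B(1) that] that by (simp add: stab_all)
  then have "B = carrier V" using subspD(1)[OF maxhomD(1)[OF B(1)]] by blast
  then show thesis using that[of \<psi>] maxhomD(2)[OF B(1)] B(3) by simp
qed

text \<open>The sum of the conjugates of \<open>w \<mapsto> c * h w\<close> over the whole group.
  The weight \<open>c\<close> takes the place of the reciprocal of the group order, which need not
  exist in positive characteristic.\<close>

definition average :: "('p, 'k) ratfun \<Rightarrow> ('v \<Rightarrow> ('p, 'k) ratfun) \<Rightarrow> 'v \<Rightarrow> ('p, 'k) ratfun"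
  where "average c h w = (\<Sum>g | g permutes \<Psi>. rf_perm g c * rf_perm g (h (act (inv_into UNIV g) w)))"

lemma shom_average:
  assumes h: "shom \<Psi> d (carrier V) h" and c: "c \<in> K"
  shows "shom {} d (carrier V) (average c h)"
proof (rule shomI)
  fix w assume w: "w \<in> carrier V"
  have st: "g \<in> stab {}" "inv_into UNIV g \<in> stab {}" "bij g" if "g permutes \<Psi>" for g
    using that by (auto simp: stab_iff permutes_inv permutes_bij)
  show "average c h w \<in> hom_ratfuns \<Psi> d"
    unfolding average_def
  proof (rule hom_sum)
    fix g assume "g \<in> {g. g permutes \<Psi>}"
    then have g: "g permutes \<Psi>" by simp
    have "rf_perm g (h (act (inv_into UNIV g) w)) \<in> hom_ratfuns \<Psi> d"
      using hom_perm[OF g] shomD(1)[OF h] act_closed[OF st(2)[OF g] w] by blast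
    from hom_mult[OF hom_perm[OF g c] this]
    show "rf_perm g c * rf_perm g (h (act (inv_into UNIV g) w)) \<in> hom_ratfuns \<Psi> d" by simp
  qed
  show "average c h (w \<oplus> w') = average c h w + average c h w'" if w': "w' \<in> carrier V" for w'
    unfolding average_def sum.distrib[symmetric]
  proof (rule sum.cong)
    fix g assume "g \<in> {g. g permutes \<Psi>}"
    then have g: "g permutes \<Psi>" by simp
    let ?i = "inv_into UNIV g"
    have "h (act ?i (w \<oplus> w')) = h (act ?i w) + h (act ?i w')"
      using act_add[OF st(2)[OF g] w w'] shomD(2)[OF h] act_closed[OF st(2)[OF g]] w w' by simp
    then show "rf_perm g c * rf_perm g (h (act ?i (w \<oplus> w'))) =
      rf_perm g c * rf_perm g (h (act ?i w)) + rf_perm g c * rf_perm g (h (act ?i w'))"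
      using st(3)[OF g] by (simp add: rf_perm_add distrib_left)
  qed simp
  show "average c h (a \<odot> w) = a * average c h w" if a: "a \<in> K" for a
    unfolding average_def sum_distrib_left
  proof (rule sum.cong)
    fix g assume "g \<in> {g. g permutes \<Psi>}"
    then have g: "g permutes \<Psi>" by simp
    let ?i = "inv_into UNIV g"
    have "h (act ?i (a \<odot> w)) = rf_perm ?i a * h (act ?i w)"
      using act_smul[OF st(2)[OF g] a w] shomD(3)[OF h hom_stab[OF st(2)[OF g] a]] act_closed[OF st(2)[OF g] w] by simp
    moreover have "rf_perm g (rf_perm ?i a) = a"
      using rf_perm_comp[OF st(3)[OF g] stab_bij[OF st(2)[OF g]], of a] permutes_inv_o(1)[OF g] by (simp add: rf_perm_id)
    ultimately show "rf_perm g c * rf_perm g (h (act ?i (a \<odot> w))) = a * (rf_perm g c * rf_perm g (h (act ?i w)))"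
      using st(3)[OF g] by (simp add: rf_perm_mult)
  qed simp
  show "average c h (act k w) = rf_perm k (average c h w)" if k: "k \<in> stab {}" for k
  proof -
    have kP: "k permutes \<Psi>" using k by (simp add: stab_iff)
    have "average c h (act k w) =
      (\<Sum>g | g permutes \<Psi>. rf_perm (k \<circ> g) c * rf_perm (k \<circ> g) (h (act (inv_into UNIV (k \<circ> g)) (act k w))))"
      unfolding average_def by (rule setum_permutations_compose_left[OF kP])
    also have "\<dots> = (\<Sum>g | g permutes \<Psi>. rf_perm k (rf_perm g c * rf_perm g (h (act (inv_into UNIV g) w))))"
    proof (rule sum.cong)
      fix g assume "g \<in> {g. g permutes \<Psi>}"
      then have g: "g permutes \<Psi>" by simp
      have i: "inv_into UNIV (k \<circ> g) = inv_into UNIV g \<circ> inv_into UNIV k"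
        using st(3)[OF g] st(3)[OF kP] by (simp add: o_inv_distrib)
      have "act (inv_into UNIV (k \<circ> g)) (act k w) = act (inv_into UNIV g) w"
        unfolding i act_comp[OF st(2)[OF g] st(2)[OF kP] act_closed[OF k w]] using act_inv(1)[OF k w] by simp
      then show "rf_perm (k \<circ> g) c * rf_perm (k \<circ> g) (h (act (inv_into UNIV (k \<circ> g)) (act k w))) =
        rf_perm k (rf_perm g c * rf_perm g (h (act (inv_into UNIV g) w)))"
        using st(3)[OF g] st(3)[OF kP] by (simp add: rf_perm_comp rf_perm_mult)
    qed simp
    also have "\<dots> = rf_perm k (average c h w)"
      unfolding average_def by (rule rf_perm_sum[OF st(3)[OF kP], symmetric])
    finally show ?thesis .
  qed
qed

text \<open>Distinct permutations are distinct characters of \<open>V\<^sub>0\<close>, so a sum with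
  a nonzero coefficient cannot vanish for every \<open>c\<close>.\<close>

lemma character_sum_neq_zero:
  assumes fin: "finite \<Psi>" and z: "g\<^sub>0 permutes \<Psi>" "z g\<^sub>0 \<noteq> 0"
  obtains c where "c \<in> K" "(\<Sum>g | g permutes \<Psi>. rf_perm g c * z g) \<noteq> (0 :: ('p, 'k) ratfun)"
proof (rule ccontr)
  assume a: "\<not> thesis"
  have "z g\<^sub>0 = 0"
  proof (rule characters_indep_field[where I = "{g. g permutes \<Psi>}" and M = K and mul = "(*)" and e\<^sub>0 = 1
        and \<chi> = rf_perm and w = z])
    show "finite {g. g permutes \<Psi>}" using fin by (rule finite_permutations)
    show "\<exists>c\<in>K. rf_perm i c \<noteq> rf_perm j c" if "i \<in> {g. g permutes \<Psi>}" "j \<in> {g. g permutes \<Psi>}" "i \<noteq> j" for i j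
      using permutations_separated[of i \<Psi> j \<Psi>] that by simp
    show "(\<Sum>g | g permutes \<Psi>. rf_perm g c * z g) = 0" if "c \<in> K" for c
      using a that \<open>\<And>c. c \<in> K \<Longrightarrow> _ \<Longrightarrow> thesis\<close> by blast
  qed (use z in \<open>auto simp: K_mult hom_one permutes_bij rf_perm_mult rf_perm_one\<close>)
  then show False using z by simp
qed

text \<open>Independence of characters gives an element with nonzero trace in any characteristic;
  the trace is invariant, so one may divide by it.\<close>

lemma trace_one:
  assumes fin: "finite \<Psi>"
  obtains c where "c \<in> K" "(\<Sum>g | g permutes \<Psi>. rf_perm g c) = (1 :: ('p, 'k) ratfun)"
proof -
  obtain c where c: "c \<in> K" "(\<Sum>g | g permutes \<Psi>. rf_perm g c * 1) \<noteq> (0 :: ('p, 'k) ratfun)"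
    using character_sum_neq_zero[OF fin permutes_id, of "\<lambda>_. 1"] by auto
  define s where "s = (\<Sum>g | g permutes \<Psi>. rf_perm g c)"
  have s: "s \<in> K" unfolding s_def using hom_perm c(1) by (intro hom_sum) auto
  have inv: "rf_perm k s = s" if k: "k permutes \<Psi>" for k
  proof -
    have "s = (\<Sum>g | g permutes \<Psi>. rf_perm (k \<circ> g) c)"
      unfolding s_def by (rule setum_permutations_compose_left[OF k])
    also have "\<dots> = rf_perm k s"
      unfolding s_def rf_perm_sum[OF permutes_bij[OF k]]
      by (rule sum.cong) (auto simp: rf_perm_comp[OF permutes_bij[OF k]] permutes_bij)
    finally show ?thesis ..
  qed
  show thesis
  proof (rule that[of "c * inverse s"])
    show "c * inverse s \<in> K" using c(1) s by (intro K_mult K_inverse)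
    have "(\<Sum>g | g permutes \<Psi>. rf_perm g (c * inverse s)) = (\<Sum>g | g permutes \<Psi>. rf_perm g c * inverse s)"
      by (rule sum.cong) (auto simp: rf_perm_mult rf_perm_inverse permutes_bij inv)
    also have "\<dots> = s * inverse s" by (simp add: s_def sum_distrib_right)
    finally show "(\<Sum>g | g permutes \<Psi>. rf_perm g (c * inverse s)) = 1" using c(2) by (simp add: s_def)
  qed
qed

text \<open>For finite \<open>\<Psi>\<close> a linear extension is averaged with a weight of trace
  one. On \<open>A\<close> every conjugate of \<open>h\<close> equals \<open>\<phi>\<close>, so the
  average is \<open>\<phi>\<close> there.\<close>

lemma extension:
  assumes A: "subsp {} A" and \<phi>: "shom {} d A \<phi>"
  obtains h where "shom {} d (carrier V) h" "\<And>v. v \<in> A \<Longrightarrow> h v = \<phi> v"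
proof (cases "finite \<Psi>")
  case False
  then show thesis using extension_infinite[OF _ _ _ A \<phi>] that by blast
next
  case True
  have "subsp \<Psi> A" "shom \<Psi> d A \<phi>" using A \<phi> subsp_antimono shom_antimono by blast+
  then obtain h where h: "shom \<Psi> d (carrier V) h" "\<And>v. v \<in> A \<Longrightarrow> h v = \<phi> v"
    using extension_linear by blast
  obtain c where c: "c \<in> K" "(\<Sum>g | g permutes \<Psi>. rf_perm g c) = 1" using trace_one[OF True] by blast
  have "average c h v = \<phi> v" if v: "v \<in> A" for v
  proof -
    have "average c h v = (\<Sum>g | g permutes \<Psi>. rf_perm g c * \<phi> v)"
      unfolding average_def
    proof (rule sum.cong)
      fix g assume "g \<in> {g. g permutes \<Psi>}"
      then have g: "g \<in> stab {}" by (simp add: stab_iff)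
      let ?i = "inv_into UNIV g"
      have iA: "act ?i v \<in> A" using subspD(5)[OF A stab_inv[OF g] v] .
      have "rf_perm g (h (act ?i v)) = \<phi> (act g (act ?i v))"
        using h(2)[OF iA] shomD(4)[OF \<phi> g iA] by simp
      then show "rf_perm g c * rf_perm g (h (act ?i v)) = rf_perm g c * \<phi> v"
        using act_inv(2)[OF g] subspD(1)[OF A v] by simp
    qed simp
    also have "\<dots> = \<phi> v" using c(2) by (simp add: sum_distrib_right[symmetric])
    finally show ?thesis .
  qed
  then show thesis using that shom_average[OF h(1) c(1)] by blast
qed

lemma cogenerated:
  assumes v: "v \<in> carrier V" "v \<noteq> \<zero>"
  obtains d h where "shom {} d (carrier V) h" "h v \<noteq> 0"
proof (cases "finite \<Psi>")
  case False
  obtain T where T: "finite T" "T \<subseteq> \<Psi>" "\<And>g. g \<in> stab T \<Longrightarrow> act g v = v"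
    using smooth_support[OF v(1)] by blast
  then show thesis using cogenerated_infinite[OF False v T(1), of "{}"] that by auto
next
  case True
  obtain \<phi> where \<phi>: "subsp \<Psi> (lspan {v})" "shom \<Psi> 0 (lspan {v}) \<phi>" "v \<in> lspan {v}" "\<phi> v = 1"
    using fixed_functional[OF v, of \<Psi>] v(1) by (auto simp: stab_all)
  obtain h where h: "shom \<Psi> 0 (carrier V) h" "\<And>w. w \<in> lspan {v} \<Longrightarrow> h w = \<phi> w"
    using extension_linear[OF \<phi>(1,2)] by blast
  \<comment> \<open>Here the weight is chosen for \<open>v\<close>: the conjugates of
    \<open>h\<close> are not all zero at \<open>v\<close>, so some weighted sum of them
    survives.\<close>
  define z where "z g = rf_perm g (h (act (inv_into UNIV g) v))" for g
  have "z id = 1" using h(2)[OF \<phi>(3)] \<phi>(4) v(1) by (simp add: z_def rf_perm_id inv_id[unfolded id_def[symmetric]])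
  then obtain c where "c \<in> K" "(\<Sum>g | g permutes \<Psi>. rf_perm g c * z g) \<noteq> 0"
    using character_sum_neq_zero[OF True permutes_id, of z] by auto
  then show thesis using that[OF shom_average[OF h(1)], of c] by (simp add: average_def z_def)
qed

end

section \<open>Finite length\<close>

lemma smooth_V0_rep_iff: "smooth_V0_rep \<Psi> V \<longleftrightarrow> V0_rep \<Psi> V"
  unfolding smooth_V0_rep_def V0_rep_def ..

context V0_rep
begin

lemma rep_hom_iff: "h \<in> rep_hom (Sym \<Psi>) (V0_field \<Psi>) V (V_rep \<Psi> d) \<longleftrightarrow> shom {} d (carrier V) h"
  by (auto simp: rep_hom_def shom_def V_rep_def V0_field_def pointwise_stabilizer_def)

lemma subrep_iff: "subrep (Sym \<Psi>) (V0_field \<Psi>) V U \<longleftrightarrow> subsp {} U"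
proof
  assume "subrep (Sym \<Psi>) (V0_field \<Psi>) V U"
  then have U: "submodule U (V0_field \<Psi>) V" "\<forall>g\<in>carrier (Sym \<Psi>). \<forall>u\<in>U. act g u \<in> U"
    by (auto simp: subrep_def)
  interpret U: submodule U "V0_field \<Psi>" V by (rule U(1))
  show "subsp {} U"
  proof (rule subspI)
    show "U \<subseteq> carrier V" using U.subset by simp
    show "\<zero> \<in> U" using U.one_closed by simp
    show "v \<oplus> w \<in> U" if "v \<in> U" "w \<in> U" for v w using U.m_closed[OF that] by simp
    show "a \<odot> v \<in> U" if "a \<in> K" "v \<in> U" for a v using U.smult_closed[of a v] that by (simp add: V0_field_def)
    show "act g v \<in> U" if "g \<in> stab {}" "v \<in> U" for g v using U(2) that by (simp add: pointwise_stabilizer_def)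
  qed
next
  assume U: "subsp {} U"
  have "submodule U (V0_field \<Psi>) V"
  proof (rule submoduleI)
    show "U \<subseteq> carrier V" "\<zero> \<in> U" using U by (auto simp: subsp_def)
    show "\<ominus> a \<in> U" if "a \<in> U" for a
      using subspD(4)[OF U hom_uminus[OF hom_one] that] minus_smul[OF subspD(1)[OF U that]] by simp
    show "a \<oplus> b \<in> U" if "a \<in> U" "b \<in> U" for a b using subspD(3)[OF U that] .
    show "a \<odot> x \<in> U" if "a \<in> carrier (V0_field \<Psi>)" "x \<in> U" for a x
      using subspD(4)[OF U _ that(2)] that(1) by (simp add: V0_field_def)
  qed
  then show "subrep (Sym \<Psi>) (V0_field \<Psi>) V U"
    using subspD(5)[OF U] by (simp add: subrep_def pointwise_stabilizer_def)
qed

lemma shom_zero: "shom S d U h \<Longrightarrow> \<zero> \<in> U \<Longrightarrow> h \<zero> = 0"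
  using shomD(3)[of S d U h 0 \<zero>] by (simp add: hom_zero)

lemma shom_minus:
  assumes "shom S d (carrier V) h" "v \<in> carrier V" "w \<in> carrier V"
  shows "h (v \<ominus> w) = h v - h w"
  using assms(2,3) shomD(3)[OF assms(1) hom_uminus[OF hom_one] assms(3)]
  by (simp add: a_minus_def shomD(2)[OF assms(1)] minus_smul[symmetric])

lemma minus_eq_zeroD: "v \<in> carrier V \<Longrightarrow> w \<in> carrier V \<Longrightarrow> v \<ominus> w = \<zero> \<Longrightarrow> v = w"
proof -
  assume a: "v \<in> carrier V" "w \<in> carrier V" "v \<ominus> w = \<zero>"
  then have "(v \<ominus> w) \<oplus> w = w" by simp
  then show "v = w" using a(1,2) by (simp add: a_minus_def a_assoc l_neg)
qed

text \<open>\<open>coordinates U n D F\<close>: the functionals \<open>F j\<close>, \<open>j < n\<close>, identify \<open>U\<close> with the direct sum of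
  the spaces of degree \<open>D j\<close>.\<close>

definition coordinates :: "'v set \<Rightarrow> nat \<Rightarrow> (nat \<Rightarrow> int) \<Rightarrow> (nat \<Rightarrow> 'v \<Rightarrow> ('p, 'k) ratfun) \<Rightarrow> bool"
  where "coordinates U n D F \<longleftrightarrow> (\<forall>j<n. shom {} (D j) (carrier V) (F j)) \<and>
    (\<forall>x\<in>U. (\<forall>j<n. F j x = 0) \<longrightarrow> x = \<zero>) \<and>
    (\<forall>y. (\<forall>j<n. y j \<in> hom_ratfuns \<Psi> (D j)) \<longrightarrow> (\<exists>x\<in>U. \<forall>j<n. F j x = y j))"

text \<open>Cogeneration gives one more functional \<open>h\<close>, nonzero on a vector of
  \<open>U'\<close> killed by the old ones. Simplicity of the quotient leaves no room for a common
  kernel in \<open>U'\<close>, and surjectivity persists because the new target is one-dimensional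
  over \<open>V\<^sub>0\<close>.\<close>

lemma coordinates_step:
  assumes U: "subsp {} U" and U': "subsp {} U'" "U \<subset> U'"
    and simple: "\<And>W. subsp {} W \<Longrightarrow> U \<subset> W \<Longrightarrow> W \<subset> U' \<Longrightarrow> False" and c: "coordinates U n D F"
  shows "\<exists>D' F'. coordinates U' (Suc n) D' F'"
proof -
  have hom: "shom {} (D j) (carrier V) (F j)" if "j < n" for j using c that by (simp add: coordinates_def)
  have inj: "x = \<zero>" if "x \<in> U" "\<And>j. j < n \<Longrightarrow> F j x = 0" for x using c that by (simp add: coordinates_def)
  have sur: "\<exists>x\<in>U. \<forall>j<n. F j x = y j" if "\<And>j. j < n \<Longrightarrow> y j \<in> hom_ratfuns \<Psi> (D j)"
    for y :: "nat \<Rightarrow> ('p, 'k) ratfun"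
    using c that by (simp add: coordinates_def)
  obtain z where z: "z \<in> U'" "z \<notin> U" using U'(2) by blast
  have zX: "z \<in> carrier V" using subspD(1)[OF U'(1) z(1)] .
  \<comment> \<open>Correcting \<open>z\<close> by the element of \<open>U\<close> with the same
    coordinates gives a new vector on which all old functionals vanish.\<close>
  obtain x where x: "x \<in> U" "\<forall>j<n. F j x = F j z"
    using sur[of "\<lambda>j. F j z"] shomD(1)[OF hom zX] by blast
  have xX: "x \<in> carrier V" using subspD(1)[OF U x(1)] .
  define v where "v = z \<ominus> x"
  have vX: "v \<in> carrier V" and v: "v \<in> U'" "\<And>j. j < n \<Longrightarrow> F j v = 0"
    unfolding v_def using zX xX subsp_minus[OF U'(1) z(1)] x U'(2) by (auto simp: shom_minus[OF hom])
  have v0: "v \<noteq> \<zero>" unfolding v_def using minus_eq_zeroD[OF zX xX] x(1) z(2) by auto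
  obtain d h where h: "shom {} d (carrier V) h" "h v \<noteq> 0" using cogenerated[OF vX v0] by blast
  define N where "N = {x \<in> U'. (\<forall>j<n. F j x = 0) \<and> h x = 0}"
  have N: "subsp {} N"
  proof (rule subspI)
    note cl = subspD[OF U'(1)]
    show "N \<subseteq> carrier V" using cl(1) unfolding N_def by blast
    show "\<zero> \<in> N" unfolding N_def using cl(2) by (simp add: shom_zero[OF hom] shom_zero[OF h(1)])
    show "a \<oplus> b \<in> N" if "a \<in> N" "b \<in> N" for a b
      using that cl(1,3) by (auto simp: N_def shomD(2)[OF hom] shomD(2)[OF h(1)])
    show "a \<odot> b \<in> N" if "a \<in> K" "b \<in> N" for a b
      using that cl(1,4) by (auto simp: N_def shomD(3)[OF hom] shomD(3)[OF h(1)])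
    show "act g b \<in> N" if "g \<in> stab {}" "b \<in> N" for g b
      using that cl(1,5) stab_bij[OF that(1)] by (auto simp: N_def shomD(4)[OF hom] shomD(4)[OF h(1)] rf_perm_zero)
  qed
  define W where "W = {a \<oplus> w | a w. a \<in> U \<and> w \<in> N}"
  have W: "subsp {} W" unfolding W_def using U N by (rule subsp_sum)
  have UW: "U \<subseteq> W"
  proof
    fix a assume "a \<in> U"
    then have "a = a \<oplus> \<zero>" using subspD(1)[OF U] by simp
    then show "a \<in> W" unfolding W_def using \<open>a \<in> U\<close> subspD(2)[OF N] by blast
  qed
  have NW: "N \<subseteq> W"
  proof
    fix a assume "a \<in> N"
    then have "a = \<zero> \<oplus> a" using subspD(1)[OF N] by simp
    then show "a \<in> W" unfolding W_def using \<open>a \<in> N\<close> subspD(2)[OF U] by blast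
  qed
  have WU': "W \<subseteq> U'" unfolding W_def using subspD(3)[OF U'(1)] U'(2) unfolding N_def by blast
  \<comment> \<open>If \<open>v\<close> were such a sum, its part in \<open>U\<close> would have
    zero coordinates and hence vanish, so that \<open>h v\<close> would be zero.\<close>
  have "v \<notin> W"
  proof
    assume "v \<in> W"
    then obtain a b where ab: "v = a \<oplus> b" "a \<in> U" "b \<in> N" unfolding W_def by blast
    have abX: "a \<in> carrier V" "b \<in> carrier V" using ab subspD(1)[OF U] subspD(1)[OF N] by auto
    have "F j a = 0" if "j < n" for j
      using v(2)[OF that] ab(1,3) shomD(2)[OF hom[OF that] abX] that by (simp add: N_def)
    then have "a = \<zero>" using inj ab(2) by blast
    then show False using ab(1,3) abX h(2) by (simp add: N_def)
  qed
  then have "W = U" using simple[OF W] UW WU' v(1) by blast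
  then have NU: "N \<subseteq> U" using NW by simp
  have "coordinates U' (Suc n) (D(n := d)) (F(n := h))"
    unfolding coordinates_def
  proof (intro conjI allI impI ballI)
    show "shom {} ((D(n := d)) j) (carrier V) ((F(n := h)) j)" if "j < Suc n" for j
      using that hom h(1) by (auto simp: less_Suc_eq)
    show "x = \<zero>" if x: "x \<in> U'" "\<forall>j<Suc n. (F(n := h)) j x = 0" for x
    proof -
      have "F j x = 0" if "j < n" for j using x(2) that by (auto dest!: spec[of _ j])
      moreover have "h x = 0" using x(2) by (auto dest!: spec[of _ n])
      ultimately show ?thesis using inj[of x] NU x(1) by (auto simp: N_def)
    qed
    fix y :: "nat \<Rightarrow> ('p, 'k) ratfun" assume y: "\<forall>j<Suc n. y j \<in> hom_ratfuns \<Psi> ((D(n := d)) j)"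
    have yj: "y j \<in> hom_ratfuns \<Psi> (D j)" if "j < n" for j using y that by (auto dest!: spec[of _ j])
    have yn: "y n \<in> hom_ratfuns \<Psi> d" using y by (auto dest!: spec[of _ n])
    obtain x where x: "x \<in> U" "\<forall>j<n. F j x = y j" using sur[OF yj] by blast
    have xX: "x \<in> carrier V" using subspD(1)[OF U x(1)] .
    \<comment> \<open>Adding a multiple of \<open>v\<close> adjusts the last coordinate and leaves
      the others alone; \<open>a\<close> has degree zero as a quotient of two elements of degree
      \<open>d\<close>.\<close>
    define a where "a = (y n + - h x) * inverse (h v)"
    have "y n + - h x \<in> hom_ratfuns \<Psi> d"
      by (intro hom_add hom_uminus yn shomD(1)[OF h(1)] xX)
    from hom_mult[OF this hom_inverse[OF shomD(1)[OF h(1) vX]]] have a: "a \<in> K" by (simp add: a_def)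
    have "x \<oplus> a \<odot> v \<in> U'" using x(1) U'(2) v(1) subspD(3,4)[OF U'(1)] a by blast
    moreover have "(F(n := h)) j (x \<oplus> a \<odot> v) = y j" if "j < Suc n" for j
    proof (cases "j = n")
      case True
      then show ?thesis using h(2) xX vX a
        by (simp add: shomD(2)[OF h(1)] shomD(3)[OF h(1)]) (simp add: a_def mult.assoc)
    next
      case False
      then have "j < n" using that by simp
      then show ?thesis using False xX vX a x(2) v(2)
        by (simp add: shomD(2)[OF hom] shomD(3)[OF hom])
    qed
    ultimately show "\<exists>x\<in>U'. \<forall>j<Suc n. (F(n := h)) j x = y j" by blast
  qed
  then show ?thesis by blast
qed

lemma finite_length_coordinates:
  assumes "finite_length (Sym \<Psi>) (V0_field \<Psi>) V"
  obtains n D F where "coordinates (carrier V) n D F"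
proof -
  obtain n U where *: "U 0 = {\<zero>} \<and> U n = carrier V \<and> (\<forall>i\<le>n. subsp {} (U i)) \<and>
      (\<forall>i<n. U i \<subset> U (Suc i) \<and> \<not> (\<exists>W. subsp {} W \<and> U i \<subset> W \<and> W \<subset> U (Suc i)))"
    using assms unfolding finite_length_def subrep_iff by (elim exE) (rule that)
  have U: "U 0 = {\<zero>}" "U n = carrier V" using * by simp_all
  have sub: "subsp {} (U i)" if "i \<le> n" for i using * that by simp
  have less: "U i \<subset> U (Suc i)" if "i < n" for i using * that by simp
  have simple: False if "i < n" "subsp {} W" "U i \<subset> W" "W \<subset> U (Suc i)" for i W using * that by blast
  have "\<exists>D F. coordinates (U i) i D F" if "i \<le> n" for i
    using that
  proof (induction i)
    case 0
    then show ?case using U(1) by (auto simp: coordinates_def)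
  next
    case (Suc i)
    then obtain D F where c: "coordinates (U i) i D F" by auto
    show ?case
      using Suc.prems by (intro coordinates_step[OF sub sub less simple c]) auto
  qed
  then show thesis using that U(2) by (metis order_refl)
qed

text \<open>Finiteness of the support of \<open>y\<close> is automatic: where
  \<open>m d = 0\<close>, the only extensional function is the zero vector of the power.\<close>

lemma mem_dsum_iff:
  fixes m :: "int \<Rightarrow> nat"
  assumes "finite {d. m d \<noteq> 0}"
  shows "y \<in> carrier (rep_dsum UNIV (\<lambda>d. rep_power (V_rep \<Psi> d) {..<m d})) \<longleftrightarrow>
    (\<forall>d. y d \<in> {..<m d} \<rightarrow>\<^sub>E hom_ratfuns \<Psi> d)"
proof -
  have "finite {d. y d \<noteq> (\<lambda>i\<in>{..<m d}. 0)}" if y: "\<forall>d. y d \<in> {..<m d} \<rightarrow>\<^sub>E hom_ratfuns \<Psi> d"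
  proof (rule finite_subset[OF _ assms])
    show "{d. y d \<noteq> (\<lambda>i\<in>{..<m d}. 0)} \<subseteq> {d. m d \<noteq> 0}"
    proof (intro subsetI CollectI notI)
      fix d assume d: "d \<in> {d. y d \<noteq> (\<lambda>i\<in>{..<m d}. 0)}" and m: "m d = 0"
      have "y d \<in> {..<m d} \<rightarrow>\<^sub>E hom_ratfuns \<Psi> d" using y by blast
      then show False using d m by (auto simp: PiE_empty_domain restrict_def)
    qed
  qed
  then show ?thesis
    by (auto simp: rep_dsum_def rep_prod_def rep_power_def V_rep_def)
qed

text \<open>Separates the bookkeeping of restricted functions from the mathematics: existence and
  uniqueness of the decomposition become statements on families of functionals.\<close>

lemma dsum_hom_iff:
  fixes m :: "int \<Rightarrow> nat"
  assumes m: "finite {d. m d \<noteq> 0}"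
  shows "f \<in> rep_hom (Sym \<Psi>) (V0_field \<Psi>) V (rep_dsum UNIV (\<lambda>d. rep_power (V_rep \<Psi> d) {..<m d})) \<longleftrightarrow>
    (\<forall>x\<in>carrier V. \<forall>d. f x d \<in> extensional {..<m d}) \<and>
    (\<forall>d. \<forall>i<m d. shom {} d (carrier V) (\<lambda>x. f x d i))" (is "?L \<longleftrightarrow> ?R")
proof
  assume L: ?L
  have c: "f x d \<in> {..<m d} \<rightarrow>\<^sub>E hom_ratfuns \<Psi> d" if "x \<in> carrier V" for x d
  proof -
    have "f x \<in> carrier (rep_dsum UNIV (\<lambda>d. rep_power (V_rep \<Psi> d) {..<m d}))"
      using L that by (auto simp: rep_hom_def)
    then show ?thesis unfolding mem_dsum_iff[OF m] by blast
  qed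
  have "shom {} d (carrier V) (\<lambda>x. f x d i)" if i: "i < m d" for d i
    using L c i
    by (intro shomI)
       (auto simp: rep_hom_def rep_dsum_def rep_prod_def rep_power_def V_rep_def V0_field_def pointwise_stabilizer_def)
  then show ?R using c by (auto simp: PiE_def)
next
  assume R: ?R
  have extn: "f x d \<in> extensional {..<m d}" if "x \<in> carrier V" for x d using R that by blast
  have hom: "shom {} d (carrier V) (\<lambda>x. f x d i)" if "i < m d" for d i using R that by blast
  have eqI: "f x = (\<lambda>d. \<lambda>i\<in>{..<m d}. z d i)" if "x \<in> carrier V" "\<And>d i. i < m d \<Longrightarrow> f x d i = z d i" for x z
  proof (intro ext)
    fix d i
    show "f x d i = (\<lambda>i\<in>{..<m d}. z d i) i"
      using that extn[OF that(1), of d] by (auto simp: extensional_def)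
  qed
  have "f x \<in> carrier (rep_dsum UNIV (\<lambda>d. rep_power (V_rep \<Psi> d) {..<m d}))" if "x \<in> carrier V" for x
    unfolding mem_dsum_iff[OF m] using extn[OF that] shomD(1)[OF hom that] by (auto simp: PiE_iff)
  moreover have "f (v \<oplus> w) = f v \<oplus>\<^bsub>rep_dsum UNIV (\<lambda>d. rep_power (V_rep \<Psi> d) {..<m d})\<^esub> f w"
    if vw: "v \<in> carrier V" "w \<in> carrier V" for v w
    using eqI[of "v \<oplus> w" "\<lambda>d i. f v d i + f w d i"] vw shomD(2)[OF hom vw]
    by (simp add: rep_dsum_def rep_prod_def rep_power_def V_rep_def restrict_UNIV)
  moreover have "f (a \<odot> v) = a \<odot>\<^bsub>rep_dsum UNIV (\<lambda>d. rep_power (V_rep \<Psi> d) {..<m d})\<^esub> f v"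
    if av: "a \<in> K" "v \<in> carrier V" for a v
    using eqI[of "a \<odot> v" "\<lambda>d i. a * f v d i"] av shomD(3)[OF hom av]
    by (simp add: rep_dsum_def rep_prod_def rep_power_def V_rep_def restrict_UNIV)
  moreover have "f (act g v) = gact (rep_dsum UNIV (\<lambda>d. rep_power (V_rep \<Psi> d) {..<m d})) g (f v)"
    if gv: "g \<in> stab {}" "v \<in> carrier V" for g v
    using eqI[of "act g v" "\<lambda>d i. rf_perm g (f v d i)"] gv shomD(4)[OF hom gv]
    by (simp add: rep_dsum_def rep_prod_def rep_power_def V_rep_def restrict_UNIV)
  ultimately show ?L
    by (auto simp: rep_hom_def V0_field_def pointwise_stabilizer_def)
qed

text \<open>The coordinates are sorted by degree: \<open>m d\<close> counts those with
  \<open>D j = d\<close>, and \<open>\<beta> d\<close> numbers them.\<close>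

lemma coordinates_dsum:
  assumes c: "coordinates (carrier V) n D F"
  shows "\<exists>m :: int \<Rightarrow> nat. finite {d. m d \<noteq> 0} \<and>
    rep_iso (Sym \<Psi>) (V0_field \<Psi>) V (rep_dsum UNIV (\<lambda>d. rep_power (V_rep \<Psi> d) {..<m d}))"
proof -
  define J where "J d = {j. j < n \<and> D j = d}" for d
  define m where "m d = card (J d)" for d
  have finJ: "finite (J d)" for d by (simp add: J_def)
  have "\<forall>d. \<exists>b. bij_betw b {..<m d} (J d)"
    using ex_bij_betw_nat_finite[OF finJ] by (simp add: m_def atLeast0LessThan)
  then obtain \<beta> where \<beta>: "\<And>d. bij_betw (\<beta> d) {..<m d} (J d)" by metis
  have fin: "finite {d. m d \<noteq> 0}"
  proof (rule finite_subset)
    show "{d. m d \<noteq> 0} \<subseteq> D ` {..<n}" using finJ by (auto simp: m_def J_def card_eq_0_iff)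
  qed simp
  have \<beta>J: "\<beta> d i \<in> J d" if "i < m d" for d i using \<beta>[of d] that by (auto simp: bij_betw_def)
  have J\<beta>: "\<exists>i<m (D j). \<beta> (D j) i = j" if "j < n" for j
  proof -
    have "j \<in> J (D j)" using that by (simp add: J_def)
    then show ?thesis using \<beta>[of "D j"] by (metis bij_betw_def imageE lessThan_iff)
  qed
  define f where "f x = (\<lambda>d. \<lambda>i\<in>{..<m d}. F (\<beta> d i) x)" for x
  have hom: "f \<in> rep_hom (Sym \<Psi>) (V0_field \<Psi>) V (rep_dsum UNIV (\<lambda>d. rep_power (V_rep \<Psi> d) {..<m d}))"
    unfolding dsum_hom_iff[OF fin]
  proof (intro conjI ballI allI impI)
    show "f x d \<in> extensional {..<m d}" for x d by (simp add: f_def)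
    fix d i assume i: "i < m d"
    then have "shom {} d (carrier V) (F (\<beta> d i))"
      using c \<beta>J[OF i] by (auto simp: coordinates_def J_def)
    then show "shom {} d (carrier V) (\<lambda>x. f x d i)" using i by (simp add: f_def)
  qed
  have eq: "F j x = f x (D j) i" if "i < m (D j)" "\<beta> (D j) i = j" for i j x
    using that by (simp add: f_def)
  have "inj_on f (carrier V)"
  proof (rule inj_onI)
    fix x x' assume x: "x \<in> carrier V" "x' \<in> carrier V" "f x = f x'"
    have "F j (x \<ominus> x') = 0" if j: "j < n" for j
    proof -
      have "shom {} (D j) (carrier V) (F j)" using c j by (simp add: coordinates_def)
      moreover obtain i where "i < m (D j)" "\<beta> (D j) i = j" using J\<beta>[OF j] by blast
      ultimately show ?thesis using shom_minus[of "{}" "D j" "F j" x x'] eq[of i j] x by simp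
    qed
    then have "x \<ominus> x' = \<zero>" using c x by (simp add: coordinates_def)
    then show "x = x'" using minus_eq_zeroD x by blast
  qed
  moreover have "f ` carrier V = carrier (rep_dsum UNIV (\<lambda>d. rep_power (V_rep \<Psi> d) {..<m d}))"
  proof
    show "f ` carrier V \<subseteq> carrier (rep_dsum UNIV (\<lambda>d. rep_power (V_rep \<Psi> d) {..<m d}))"
      using hom by (auto simp: rep_hom_def)
    show "carrier (rep_dsum UNIV (\<lambda>d. rep_power (V_rep \<Psi> d) {..<m d})) \<subseteq> f ` carrier V"
    proof
      fix y :: "int \<Rightarrow> nat \<Rightarrow> ('p, 'k) ratfun"
      assume "y \<in> carrier (rep_dsum UNIV (\<lambda>d. rep_power (V_rep \<Psi> d) {..<m d}))"
      then have y: "y d \<in> {..<m d} \<rightarrow>\<^sub>E hom_ratfuns \<Psi> d" for d unfolding mem_dsum_iff[OF fin] by blast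
      define z where "z j = y (D j) (inv_into {..<m (D j)} (\<beta> (D j)) j)" for j
      have z\<beta>: "z (\<beta> d i) = y d i" if i: "i < m d" for d i
      proof -
        have "D (\<beta> d i) = d" using \<beta>J[OF i] by (simp add: J_def)
        moreover have "inv_into {..<m d} (\<beta> d) (\<beta> d i) = i"
          using \<beta>[of d] i by (intro inv_into_f_f) (auto simp: bij_betw_def)
        ultimately show ?thesis by (simp add: z_def)
      qed
      have "z j \<in> hom_ratfuns \<Psi> (D j)" if j: "j < n" for j
      proof -
        obtain i where i: "i < m (D j)" "\<beta> (D j) i = j" using J\<beta>[OF j] by blast
        then have "z j = y (D j) i" using z\<beta>[OF i(1)] by simp
        then show ?thesis using y[of "D j"] i(1) by auto
      qed
      then obtain x where x: "x \<in> carrier V" "\<forall>j<n. F j x = z j"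
        using c unfolding coordinates_def by blast
      have "f x = y"
      proof (intro ext)
        fix d i
        show "f x d i = y d i"
        proof (cases "i < m d")
          case True
          then show ?thesis using x(2) \<beta>J[OF True] z\<beta>[OF True] by (simp add: f_def J_def)
        next
          case False
          then show ?thesis using PiE_arb[OF y[of d], of i] by (simp add: f_def)
        qed
      qed
      then show "y \<in> f ` carrier V" using x(1) by blast
    qed
  qed
  ultimately have "bij_betw f (carrier V) (carrier (rep_dsum UNIV (\<lambda>d. rep_power (V_rep \<Psi> d) {..<m d})))"
    by (simp add: bij_betw_def)
  then show ?thesis using fin hom unfolding rep_iso_def by blast
qed

end

section \<open>Uniqueness of the multiplicities\<close>

text \<open>Move all variables of \<open>q = P / Q\<close> to new ones. Comparing degrees in the old
  variables on both sides of the resulting polynomial identity shows that \<open>P\<close> and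
  \<open>Q\<close> have equal degree. For finite nonempty \<open>\<Psi>\<close> the sum of all
  variables is an invariant of degree one, and uniqueness of the multiplicities fails.\<close>

lemma invariant_hom_ratfun:
  fixes q :: "('p, 'k::field) ratfun"
  assumes inf: "infinite \<Psi>" and q: "q \<in> hom_ratfuns \<Psi> c" "c \<noteq> 0"
    and inv: "\<And>g. g permutes \<Psi> \<Longrightarrow> rf_perm g q = q"
  shows "q = 0"
proof (rule ccontr)
  assume "q \<noteq> 0"
  with q(1) obtain P Q m n where PQ: "P \<noteq> 0" "P \<in> mpolys \<Psi>" "Q \<in> mpolys \<Psi>" "Q \<noteq> 0"
    "mhomogeneous m P" "mhomogeneous n Q" "int m - int n = c" "q = Fract P Q"
    by (auto elim: hom_ratfunsE)
  define T where "T = mvars P \<union> mvars Q"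
  have T: "finite T" "T \<subseteq> \<Psi>" using PQ(2,3) by (auto simp: T_def mpolys_def mvars_def)
  have "infinite (\<Psi> - T)" using inf T(1) by simp
  then obtain T' where T': "T' \<subseteq> \<Psi> - T" "finite T'" "card T' = card T"
    using infinite_arbitrarily_large by metis
  obtain g where g: "g permutes (T \<union> T')" "g ` T = T'"
    using permutation_exists[OF T(1) T'(2)] T'(3) by metis
  have gP: "g permutes \<Psi>" using g(1) by (rule permutes_subset) (use T T' in auto)
  have b: "bij g" using gP by (rule permutes_bij)
  have "Fract (mperm g P) (mperm g Q) = Fract P Q"
    using inv[OF gP] PQ(4,8) b by (simp add: rf_perm_Fract)
  then have e: "mperm g P * Q = P * mperm g Q" using PQ(4) b by (simp add: eq_fract)
  \<comment> \<open>\<open>w\<close> is the degree of a monomial in the variables \<open>T\<close>: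
    the full degree on monomials of \<open>P\<close> and \<open>Q\<close>, and zero on those of
    their renamed copies.\<close>
  define w where "w a = (\<Sum>x\<in>T. Poly_Mapping.lookup a x)" for a :: "'p \<Rightarrow>\<^sub>0 nat"
  have w_add: "w (a + a') = w a + w a'" for a a' by (simp add: w_def lookup_add sum.distrib)
  have w_in: "w a = k" if "a \<in> Poly_Mapping.keys (mcoeffs R)" "mhomogeneous k R" "mvars R \<subseteq> T" for a k and R :: "('p, 'k) mpoly"
  proof -
    have "Poly_Mapping.keys a \<subseteq> T" using that(1,3) unfolding mvars_def by blast
    then have "w a = mdeg a" using mdeg_superset[OF T(1)] by (simp add: w_def)
    then show ?thesis using that(1,2) by (simp add: mhomogeneous_def)
  qed
  have w_out: "w a = 0" if "a \<in> Poly_Mapping.keys (mcoeffs (mperm g R))" "mvars R \<subseteq> T" for a and R :: "('p, 'k) mpoly"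
    unfolding w_def
  proof (rule sum.neutral, rule ballI)
    fix x assume x: "x \<in> T"
    obtain y where y: "x = g y" using b by (metis bij_pointE)
    have "Poly_Mapping.map_key g a \<in> Poly_Mapping.keys (mcoeffs R)" using that(1) keys_mperm[OF b] by blast
    then have "Poly_Mapping.keys (Poly_Mapping.map_key g a) \<subseteq> T" using that(2) unfolding mvars_def by blast
    moreover have "y \<notin> T" using x y g(2) T'(1) by blast
    ultimately have "Poly_Mapping.lookup (Poly_Mapping.map_key g a) y = 0" by (auto simp: in_keys_iff)
    then show "Poly_Mapping.lookup a x = 0" using y by (simp add: lookup_map_key bij_is_inj[OF b])
  qed
  have keys_prod: "\<exists>a\<in>Poly_Mapping.keys (mcoeffs R). \<exists>a'\<in>Poly_Mapping.keys (mcoeffs R'). s = a + a'"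
    if "s \<in> Poly_Mapping.keys (mcoeffs (R * R'))" for s and R R' :: "('p, 'k) mpoly"
    using that Poly_Mapping.keys_mult[of "mcoeffs R" "mcoeffs R'"] unfolding times_mpoly.rep_eq by blast
  have "P * mperm g Q \<noteq> 0" using PQ(1,4) b by simp
  then have "mcoeffs (P * mperm g Q) \<noteq> 0" by (metis mcoeffs_inject zero_mpoly.rep_eq)
  then obtain s where s: "s \<in> Poly_Mapping.keys (mcoeffs (P * mperm g Q))" by (metis ex_in_conv keys_eq_empty)
  have "w s = m" using keys_prod[OF s] w_in[OF _ PQ(5)] w_out[of _ Q] by (auto simp: w_add T_def)
  moreover have "w s = n" using keys_prod[OF s[folded e]] w_in[OF _ PQ(6)] w_out[of _ P] by (auto simp: w_add T_def)
  ultimately show False using PQ(7) q(2) by simp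
qed

text \<open>Fewer equations than unknowns, by Gaussian elimination. The subfield is a subset
  \<open>L\<close> of the type, so membership of the solution in it has to be carried along.\<close>

lemma nontrivial_relation:
  fixes q :: "'i \<Rightarrow> 'j \<Rightarrow> 'f::field"
  assumes L: "0 \<in> L" "1 \<in> L" "\<And>a b. a \<in> L \<Longrightarrow> b \<in> L \<Longrightarrow> a - b \<in> L" "\<And>a b. a \<in> L \<Longrightarrow> b \<in> L \<Longrightarrow> a * b \<in> L"
      "\<And>a. a \<in> L \<Longrightarrow> inverse a \<in> L"
    and "finite J" "finite I" "card J < card I" "\<And>i j. i \<in> I \<Longrightarrow> j \<in> J \<Longrightarrow> q i j \<in> L"
  shows "\<exists>c. (\<forall>i\<in>I. c i \<in> L) \<and> (\<exists>i\<in>I. c i \<noteq> 0) \<and> (\<forall>j\<in>J. (\<Sum>i\<in>I. c i * q i j) = 0)"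
  using assms(6-9)
proof (induction J arbitrary: I q rule: finite_induct)
  case empty
  then have "I \<noteq> {}" by auto
  then show ?case using L(2) by (intro exI[of _ "\<lambda>_. 1"]) auto
next
  case (insert j J)
  have cJ: "card (insert j J) = Suc (card J)" using insert.hyps by simp
  show ?case
  proof (cases "\<forall>i\<in>I. q i j = 0")
    case True
    have "\<exists>c. (\<forall>i\<in>I. c i \<in> L) \<and> (\<exists>i\<in>I. c i \<noteq> 0) \<and> (\<forall>j\<in>J. (\<Sum>i\<in>I. c i * q i j) = 0)"
      using insert.prems cJ by (intro insert.IH) auto
    then show ?thesis using True by auto
  next
    case False
    then obtain p where p: "p \<in> I" "q p j \<noteq> 0" by blast
    let ?I = "I - {p}"
    \<comment> \<open>Elimination of the equation \<open>j\<close> by means of the pivot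
      \<open>p\<close>; the coefficient of \<open>p\<close> is restored afterwards in
      \<open>c'\<close>.\<close>
    define q' where "q' i k = q i k - q i j * inverse (q p j) * q p k" for i k
    have cI: "finite ?I" "card J < card ?I" using insert.prems(1,2) cJ p(1) by auto
    have qL: "q i k \<in> L" if "i \<in> I" "k \<in> insert j J" for i k using insert.prems(3) that by blast
    have "\<exists>c. (\<forall>i\<in>?I. c i \<in> L) \<and> (\<exists>i\<in>?I. c i \<noteq> 0) \<and> (\<forall>k\<in>J. (\<Sum>i\<in>?I. c i * q' i k) = 0)"
      using qL p(1) by (intro insert.IH[OF cI]) (auto simp: q'_def intro!: L)
    then obtain c where c: "\<forall>i\<in>?I. c i \<in> L" "\<exists>i\<in>?I. c i \<noteq> 0" "\<forall>k\<in>J. (\<Sum>i\<in>?I. c i * q' i k) = 0" by blast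
    define r where "r = (\<Sum>i\<in>?I. c i * (q i j * inverse (q p j)))"
    define c' where "c' = c(p := 0 - r)"
    have sumL: "sum f A \<in> L" if "\<And>i. i \<in> A \<Longrightarrow> f i \<in> L" for f and A :: "'i set"
      using that
    proof (induction A rule: infinite_finite_induct)
      case (insert x A)
      then have "f x - (0 - sum f A) \<in> L" by (intro L) auto
      then show ?case using insert by simp
    qed (auto simp: L)
    have rL: "r \<in> L" unfolding r_def using c(1) qL p(1) by (intro sumL) (auto intro!: L)
    have split: "(\<Sum>i\<in>I. c' i * q i k) = (\<Sum>i\<in>?I. c i * q i k) - r * q p k" for k
      using insert.prems(1) p(1) by (subst sum.remove[of I p]) (auto simp: c'_def intro!: sum.cong)
    have "(\<Sum>i\<in>I. c' i * q i k) = 0" if k: "k \<in> insert j J" for k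
    proof (cases "k = j")
      case True
      then show ?thesis unfolding split using p(2) by (simp add: r_def sum_distrib_right mult.assoc)
    next
      case False
      have "(\<Sum>i\<in>?I. c i * q i k) - r * q p k = (\<Sum>i\<in>?I. c i * q' i k)"
        unfolding r_def sum_distrib_right sum_subtractf[symmetric]
        by (rule sum.cong) (auto simp: q'_def algebra_simps)
      also have "\<dots> = 0" using c(3) k False by blast
      finally show ?thesis unfolding split .
    qed
    moreover have "\<forall>i\<in>I. c' i \<in> L" using c(1) L(3)[OF L(1) rL] by (auto simp: c'_def)
    moreover have "\<exists>i\<in>I. c' i \<noteq> 0" using c(2) by (auto simp: c'_def)
    ultimately show ?thesis by blast
  qed
qed

context V0_rep
begin

lemma shom_finsum:
  assumes h: "shom S d (carrier V) h" and "finite I" "\<And>i. i \<in> I \<Longrightarrow> w i \<in> carrier V"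
  shows "h (\<Oplus>i\<in>I. w i) = (\<Sum>i\<in>I. h (w i))"
  using assms(2,3)
proof (induction I rule: finite_induct)
  case empty
  then show ?case using shom_zero[OF h] by simp
next
  case (insert i I)
  have "(\<Oplus>i\<in>insert i I. w i) = w i \<oplus> (\<Oplus>i\<in>I. w i)"
    using insert by (intro finsum_insert) auto
  moreover have "(\<Oplus>i\<in>I. w i) \<in> carrier V" using insert by (intro finsum_closed) auto
  ultimately show ?case using insert by (simp add: shomD(2)[OF h])
qed

text \<open>The vectors \<open>X i\<close>, which correspond to \<open>rf_var t powi d\<close> in
  the copies of \<open>V\<^sub>d\<close>, all transform by the same factor. Under the other
  isomorphism they can have components only in degree \<open>d\<close>, so more than
  \<open>m' d\<close> of them would be linearly dependent over \<open>V\<^sub>0\<close>.\<close>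

lemma multiplicity_le:
  fixes m m' :: "int \<Rightarrow> nat"
  assumes inf: "infinite \<Psi>" and m: "finite {d. m d \<noteq> 0}" and m': "finite {d. m' d \<noteq> 0}"
    and f: "f \<in> rep_hom (Sym \<Psi>) (V0_field \<Psi>) V (rep_dsum UNIV (\<lambda>d. rep_power (V_rep \<Psi> d) {..<m d}))"
      "bij_betw f (carrier V) (carrier (rep_dsum UNIV (\<lambda>d. rep_power (V_rep \<Psi> d) {..<m d})))"
    and f': "f' \<in> rep_hom (Sym \<Psi>) (V0_field \<Psi>) V (rep_dsum UNIV (\<lambda>d. rep_power (V_rep \<Psi> d) {..<m' d}))"
      "bij_betw f' (carrier V) (carrier (rep_dsum UNIV (\<lambda>d. rep_power (V_rep \<Psi> d) {..<m' d})))"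
  shows "m d \<le> m' d"
proof (rule ccontr)
  assume "\<not> m d \<le> m' d"
  then have lt: "m' d < m d" by simp
  have hom: "shom {} e (carrier V) (\<lambda>x. f x e i)" if "i < m e" for e i
    using f(1) that unfolding dsum_hom_iff[OF m] by blast
  have hom': "shom {} e (carrier V) (\<lambda>x. f' x e i)" if "i < m' e" for e i
    using f'(1) that unfolding dsum_hom_iff[OF m'] by blast
  have extn: "f x e \<in> extensional {..<m e}" if "x \<in> carrier V" for x e
    using f(1) that unfolding dsum_hom_iff[OF m] by blast
  have extn': "f' x e \<in> extensional {..<m' e}" if "x \<in> carrier V" for x e
    using f'(1) that unfolding dsum_hom_iff[OF m'] by blast
  have inj: "x = x'" if x: "x \<in> carrier V" "x' \<in> carrier V" "\<And>e i. i < m e \<Longrightarrow> f x e i = f x' e i" for x x'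
  proof -
    have "f x = f x'"
    proof (rule ext)
      fix e show "f x e = f x' e" by (rule extensionalityI[OF extn[OF x(1)] extn[OF x(2)]]) (use x(3) in auto)
    qed
    then show ?thesis using f(2) x(1,2) by (meson bij_betw_def inj_onD)
  qed
  have inj': "x = x'" if x: "x \<in> carrier V" "x' \<in> carrier V" "\<And>e i. i < m' e \<Longrightarrow> f' x e i = f' x' e i" for x x'
  proof -
    have "f' x = f' x'"
    proof (rule ext)
      fix e show "f' x e = f' x' e" by (rule extensionalityI[OF extn'[OF x(1)] extn'[OF x(2)]]) (use x(3) in auto)
    qed
    then show ?thesis using f'(2) x(1,2) by (meson bij_betw_def inj_onD)
  qed
  obtain t where t: "t \<in> \<Psi>" using inf infinite_imp_nonempty by blast
  \<comment> \<open>Any nonzero element of \<open>V\<^sub>d\<close> would do as a basis vector over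
    \<open>V\<^sub>0\<close>.\<close>
  define b where "b = (rf_var t powi d :: ('p, 'k) ratfun)"
  have b: "b \<in> hom_ratfuns \<Psi> d" "b \<noteq> 0" unfolding b_def using t by (auto intro: rf_var_powi_hom)
  have "\<exists>x\<in>carrier V. \<forall>e. \<forall>k<m e. f x e k = (if e = d \<and> k = i then b else 0)" for i
  proof -
    define y where "y e = (\<lambda>k\<in>{..<m e}. if e = d \<and> k = i then b else 0)" for e
    have "y \<in> carrier (rep_dsum UNIV (\<lambda>d. rep_power (V_rep \<Psi> d) {..<m d}))"
      unfolding mem_dsum_iff[OF m] using b(1) by (auto simp: y_def hom_zero)
    then have "y \<in> f ` carrier V" by (simp add: bij_betw_imp_surj_on[OF f(2)])
    then obtain x where "x \<in> carrier V" "f x = y" by blast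
    then show ?thesis by (intro bexI[of _ x]) (auto simp: y_def)
  qed
  then obtain X where X: "\<And>i. X i \<in> carrier V"
    "\<And>i e k. k < m e \<Longrightarrow> f (X i) e k = (if e = d \<and> k = i then b else 0)"
    by metis
  have scale: "act g (X i) = (rf_perm g b * inverse b) \<odot> X i" if g: "g permutes \<Psi>" for g i
  proof (rule inj)
    have gs: "g \<in> stab {}" using g by (simp add: stab_iff)
    have a: "rf_perm g b * inverse b \<in> K" using hom_mult[OF hom_perm[OF g b(1)] hom_inverse[OF b(1)]] by simp
    show "act g (X i) \<in> carrier V" "(rf_perm g b * inverse b) \<odot> X i \<in> carrier V"
      using X(1) a gs by auto
    show "f (act g (X i)) e k = f ((rf_perm g b * inverse b) \<odot> X i) e k" if "k < m e" for e k
      unfolding shomD(4)[OF hom[OF that] gs X(1)] shomD(3)[OF hom[OF that] a X(1)] X(2)[OF that]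
      using b(2) permutes_bij[OF g] by (simp add: rf_perm_zero)
  qed
  \<comment> \<open>Divided by \<open>b\<close>, the component becomes an invariant of degree
    \<open>e - d\<close>, which is zero by \<open>invariant_hom_ratfun\<close>.\<close>
  have off: "f' (X i) e k = 0" if k: "k < m' e" and ed: "e \<noteq> d" for i e k
  proof -
    let ?q = "f' (X i) e k * inverse b"
    have "?q \<in> hom_ratfuns \<Psi> (e - d)"
      using hom_mult[OF shomD(1)[OF hom'[OF k] X(1)] hom_inverse[OF b(1)]] by simp
    moreover have "rf_perm g ?q = ?q" if g: "g permutes \<Psi>" for g
    proof -
      have gs: "g \<in> stab {}" using g by (simp add: stab_iff)
      have a: "rf_perm g b * inverse b \<in> K" using hom_mult[OF hom_perm[OF g b(1)] hom_inverse[OF b(1)]] by simp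
      have "rf_perm g (f' (X i) e k) = rf_perm g b * inverse b * f' (X i) e k"
        using shomD(4)[OF hom'[OF k] gs X(1)] shomD(3)[OF hom'[OF k] a X(1)] scale[OF g] by simp
      moreover have "rf_perm g b \<noteq> 0" using b(2) permutes_bij[OF g] by (simp add: rf_perm_eq_zero_iff)
      ultimately show ?thesis
        using permutes_bij[OF g] b(2) by (simp add: rf_perm_mult rf_perm_inverse)
    qed
    ultimately have "?q = 0" using invariant_hom_ratfun[OF inf] ed by (metis eq_iff_diff_eq_0)
    then show ?thesis using b(2) by simp
  qed
  have "\<exists>c. (\<forall>i\<in>{..<m d}. c i \<in> K) \<and> (\<exists>i\<in>{..<m d}. c i \<noteq> 0) \<and>
    (\<forall>j\<in>{..<m' d}. (\<Sum>i\<in>{..<m d}. c i * (f' (X i) d j * inverse b)) = 0)"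
  proof (rule nontrivial_relation)
    show "f' (X i) d j * inverse b \<in> K" if "j \<in> {..<m' d}" for i j
      using hom_mult[OF shomD(1)[OF hom' X(1)] hom_inverse[OF b(1)], of j d i] that by simp
  qed (use lt in \<open>auto simp: hom_zero hom_one K_diff K_mult K_inverse\<close>)
  then obtain c where c: "\<And>i. i < m d \<Longrightarrow> c i \<in> K" "\<exists>i<m d. c i \<noteq> 0"
    "\<And>j. j < m' d \<Longrightarrow> (\<Sum>i<m d. c i * (f' (X i) d j * inverse b)) = 0"
    by (auto simp: lessThan_iff Bex_def Ball_def)
  define x where "x = (\<Oplus>i\<in>{..<m d}. c i \<odot> X i)"
  have xX: "x \<in> carrier V" unfolding x_def using c(1) X(1) by (intro finsum_closed) auto
  have ev: "h x = (\<Sum>i<m d. c i * h (X i))" if "shom {} e (carrier V) h" for e h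
    unfolding x_def using shom_finsum[OF that, of "{..<m d}" "\<lambda>i. c i \<odot> X i"] c(1) X(1) shomD(3)[OF that]
    by simp
  have "x = \<zero>"
  proof (rule inj'[OF xX])
    show "f' x e j = f' \<zero> e j" if j: "j < m' e" for e j
    proof (cases "e = d")
      case True
      have "f' x d j = (\<Sum>i<m d. c i * (f' (X i) d j * inverse b)) * b"
        using ev[OF hom'] j True b(2) by (simp add: sum_distrib_right mult.assoc)
      then show ?thesis using c(3) j True shom_zero[OF hom'[OF j]] by simp
    next
      case False
      then show ?thesis using ev[OF hom'[OF j]] off[OF j] shom_zero[OF hom'[OF j]] by simp
    qed
  qed simp
  \<comment> \<open>Seen through \<open>f\<close>, the same combination has the nonzero component
    \<open>c i * b\<close>.\<close>
  obtain i where i: "i < m d" "c i \<noteq> 0" using c(2) by blast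
  have "f x d i = (\<Sum>k<m d. if k = i then c i * b else 0)"
    unfolding ev[OF hom[OF i(1)]] by (rule sum.cong) (auto simp: X(2)[OF i(1)])
  then have "f x d i = c i * b" using i(1) by simp
  moreover have "f x d i = 0" using \<open>x = \<zero>\<close> shom_zero[OF hom[OF i(1)]] by simp
  ultimately show False using i(2) b(2) by simp
qed

end

text \<open>\<open>A\<close> and \<open>B\<close> may have different carrier types, so
  \<open>f\<close> is transported to the image of \<open>i\<close> inside \<open>B\<close> and
  extended there.\<close>

lemma V_rep_injective:
  fixes A :: "(('p, 'k::field) ratfun, 'p \<Rightarrow> 'p, 'a) rep" and B :: "(('p, 'k) ratfun, 'p \<Rightarrow> 'p, 'b) rep"
  assumes "smooth_V0_rep \<Psi> A" "smooth_V0_rep \<Psi> B"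
    and i: "i \<in> rep_mono (Sym \<Psi>) (V0_field \<Psi>) A B" and f: "f \<in> rep_hom (Sym \<Psi>) (V0_field \<Psi>) A (V_rep \<Psi> d)"
  shows "\<exists>h\<in>rep_hom (Sym \<Psi>) (V0_field \<Psi>) B (V_rep \<Psi> d). \<forall>a\<in>carrier A. h (i a) = f a"
proof -
  interpret A: V0_rep \<Psi> A using assms(1) by (simp add: smooth_V0_rep_iff)
  interpret B: V0_rep \<Psi> B using assms(2) by (simp add: smooth_V0_rep_iff)
  have fs: "A.shom {} d (carrier A) f" using f A.rep_hom_iff by blast
  have cl: "i v \<in> carrier B" if "v \<in> carrier A" for v
    using i that by (auto simp: rep_mono_def rep_hom_def)
  have add: "i (v \<oplus>\<^bsub>A\<^esub> w) = i v \<oplus>\<^bsub>B\<^esub> i w" if "v \<in> carrier A" "w \<in> carrier A" for v w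
    using i that by (auto simp: rep_mono_def rep_hom_def)
  have smul: "i (a \<odot>\<^bsub>A\<^esub> v) = a \<odot>\<^bsub>B\<^esub> i v" if "a \<in> hom_ratfuns \<Psi> 0" "v \<in> carrier A" for a v
    using i that by (auto simp: rep_mono_def rep_hom_def V0_field_def)
  have act: "i (gact A g v) = gact B g (i v)" if "g \<in> pointwise_stabilizer \<Psi> {}" "v \<in> carrier A" for g v
    using i that by (auto simp: rep_mono_def rep_hom_def pointwise_stabilizer_def)
  have zero: "i \<zero>\<^bsub>A\<^esub> = \<zero>\<^bsub>B\<^esub>" using smul[of 0 "\<zero>\<^bsub>A\<^esub>"] cl[of "\<zero>\<^bsub>A\<^esub>"] by (simp add: hom_zero)
  define \<phi> where "\<phi> w = f (inv_into (carrier A) i w)" for w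
  have \<phi>: "\<phi> (i v) = f v" if "v \<in> carrier A" for v
    using i that by (simp add: \<phi>_def rep_mono_def)
  have U: "B.subsp {} (i ` carrier A)"
  proof (rule B.subspI)
    show "i ` carrier A \<subseteq> carrier B" using cl by blast
    show "\<zero>\<^bsub>B\<^esub> \<in> i ` carrier A" using zero by (metis A.zero_closed imageI)
    show "v \<oplus>\<^bsub>B\<^esub> w \<in> i ` carrier A" if "v \<in> i ` carrier A" "w \<in> i ` carrier A" for v w
      using that by (auto simp: add[symmetric])
    show "a \<odot>\<^bsub>B\<^esub> v \<in> i ` carrier A" if "a \<in> hom_ratfuns \<Psi> 0" "v \<in> i ` carrier A" for a v
      using that by (auto simp: smul[symmetric])
    show "gact B g v \<in> i ` carrier A" if "g \<in> pointwise_stabilizer \<Psi> {}" "v \<in> i ` carrier A" for g v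
      using that by (auto simp: act[symmetric])
  qed
  have "B.shom {} d (i ` carrier A) \<phi>"
  proof (rule B.shomI)
    fix v assume "v \<in> i ` carrier A"
    then obtain x where x: "x \<in> carrier A" "v = i x" by blast
    show "\<phi> v \<in> hom_ratfuns \<Psi> d" using x \<phi> A.shomD(1)[OF fs] by simp
    show "\<phi> (v \<oplus>\<^bsub>B\<^esub> w) = \<phi> v + \<phi> w" if "w \<in> i ` carrier A" for w
      using that x by (auto simp: add[symmetric] \<phi> A.shomD(2)[OF fs])
    show "\<phi> (a \<odot>\<^bsub>B\<^esub> v) = a * \<phi> v" if "a \<in> hom_ratfuns \<Psi> 0" for a
      using that x by (auto simp: smul[symmetric] \<phi> A.shomD(3)[OF fs])
    show "\<phi> (gact B g v) = rf_perm g (\<phi> v)" if "g \<in> pointwise_stabilizer \<Psi> {}" for g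
      using that x by (auto simp: act[symmetric] \<phi> A.shomD(4)[OF fs])
  qed
  then obtain h where h: "B.shom {} d (carrier B) h" "\<And>v. v \<in> i ` carrier A \<Longrightarrow> h v = \<phi> v"
    using B.extension[OF U] by blast
  then show ?thesis using B.rep_hom_iff \<phi> by (intro bexI[of _ h]) auto
qed

text \<open>Each nonzero vector indexes the functional chosen for it, filed under its degree; thus
  the index sets are subsets of the carrier of \<open>V\<close> itself.\<close>

lemma embeds_into_product:
  fixes V :: "(('p, 'k::field) ratfun, 'p \<Rightarrow> 'p, 'v) rep"
  assumes "smooth_V0_rep \<Psi> V"
  shows "\<exists>(I :: int \<Rightarrow> 'v set) e.
    e \<in> rep_mono (Sym \<Psi>) (V0_field \<Psi>) V (rep_prod UNIV (\<lambda>d. rep_power (V_rep \<Psi> d) (I d)))"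
proof -
  interpret V0_rep \<Psi> V using assms by (simp add: smooth_V0_rep_iff)
  have "\<forall>v. \<exists>d h. v \<in> carrier V - {\<zero>\<^bsub>V\<^esub>} \<longrightarrow> shom {} d (carrier V) h \<and> h v \<noteq> 0"
    using cogenerated by (metis DiffE singletonI)
  then obtain D H where H: "\<And>v. v \<in> carrier V - {\<zero>\<^bsub>V\<^esub>} \<Longrightarrow> shom {} (D v) (carrier V) (H v)"
    "\<And>v. v \<in> carrier V - {\<zero>\<^bsub>V\<^esub>} \<Longrightarrow> H v v \<noteq> 0" by metis
  define I where "I d = {v \<in> carrier V - {\<zero>\<^bsub>V\<^esub>}. D v = d}" for d
  define e where "e w = (\<lambda>d. \<lambda>v\<in>I d. H v w)" for w
  have hom: "shom {} d (carrier V) (H v)" if "v \<in> I d" for d v using H(1) that by (auto simp: I_def)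
  have "e \<in> rep_hom (Sym \<Psi>) (V0_field \<Psi>) V (rep_prod UNIV (\<lambda>d. rep_power (V_rep \<Psi> d) (I d)))"
    by (auto simp: rep_hom_def rep_prod_def rep_power_def V_rep_def V0_field_def e_def fun_eq_iff restrict_def
        shomD(1)[OF hom] shomD(2)[OF hom] shomD(3)[OF hom] shomD(4)[OF hom] pointwise_stabilizer_def)
  moreover have "inj_on e (carrier V)"
  proof (rule inj_onI, rule ccontr)
    fix x y assume xy: "x \<in> carrier V" "y \<in> carrier V" "e x = e y" "x \<noteq> y"
    \<comment> \<open>Two distinct vectors are separated by the functional chosen for their
      difference.\<close>
    let ?v = "x \<ominus>\<^bsub>V\<^esub> y"
    have v: "?v \<in> carrier V - {\<zero>\<^bsub>V\<^esub>}" using xy minus_eq_zeroD by auto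
    then have "?v \<in> I (D ?v)" by (simp add: I_def)
    then have "H ?v x = H ?v y" using fun_cong[OF fun_cong[OF xy(3), of "D ?v"], of ?v] by (simp add: e_def)
    then show False using shom_minus[OF H(1)[OF v] xy(1,2)] H(2)[OF v] by simp
  qed
  ultimately show ?thesis unfolding rep_mono_def by blast
qed

theorem theorem1p3:
  fixes \<Psi> :: "'p set"
  shows
    "(\<forall>d. smooth_V0_rep \<Psi> (V_rep \<Psi> d :: (('p, 'k::field) ratfun, 'p \<Rightarrow> 'p, ('p, 'k) ratfun) rep)) \<and>
     (\<forall>d (A :: (('p, 'k) ratfun, 'p \<Rightarrow> 'p, 'a) rep) (B :: (('p, 'k) ratfun, 'p \<Rightarrow> 'p, 'b) rep).
       smooth_V0_rep \<Psi> A \<longrightarrow> smooth_V0_rep \<Psi> B \<longrightarrow>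
       (\<forall>i \<in> rep_mono (Sym \<Psi>) (V0_field \<Psi>) A B. \<forall>f \<in> rep_hom (Sym \<Psi>) (V0_field \<Psi>) A (V_rep \<Psi> d).
         \<exists>h \<in> rep_hom (Sym \<Psi>) (V0_field \<Psi>) B (V_rep \<Psi> d). \<forall>a\<in>carrier A. h (i a) = f a)) \<and>
     (\<forall>V :: (('p, 'k) ratfun, 'p \<Rightarrow> 'p, 'v) rep. smooth_V0_rep \<Psi> V \<longrightarrow>
       (\<exists>(I :: int \<Rightarrow> 'v set) e.
         e \<in> rep_mono (Sym \<Psi>) (V0_field \<Psi>) V (rep_prod UNIV (\<lambda>d. rep_power (V_rep \<Psi> d) (I d))))) \<and>
     (\<forall>V :: (('p, 'k) ratfun, 'p \<Rightarrow> 'p, 'v) rep.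
       smooth_V0_rep \<Psi> V \<longrightarrow> finite_length (Sym \<Psi>) (V0_field \<Psi>) V \<longrightarrow>
       (\<exists>m :: int \<Rightarrow> nat. finite {d. m d \<noteq> 0} \<and>
         rep_iso (Sym \<Psi>) (V0_field \<Psi>) V (rep_dsum UNIV (\<lambda>d. rep_power (V_rep \<Psi> d) {..<m d}))) \<and>
       (infinite \<Psi> \<longrightarrow> (\<exists>!m :: int \<Rightarrow> nat. finite {d. m d \<noteq> 0} \<and>
         rep_iso (Sym \<Psi>) (V0_field \<Psi>) V (rep_dsum UNIV (\<lambda>d. rep_power (V_rep \<Psi> d) {..<m d})))))"
proof (intro conjI allI impI ballI)
  show "smooth_V0_rep \<Psi> (V_rep \<Psi> d :: (('p, 'k) ratfun, 'p \<Rightarrow> 'p, ('p, 'k) ratfun) rep)" for d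
    by (rule smooth_V0_rep_V_rep)
next
  fix d i f and A :: "(('p, 'k) ratfun, 'p \<Rightarrow> 'p, 'a) rep" and B :: "(('p, 'k) ratfun, 'p \<Rightarrow> 'p, 'b) rep"
  assume "smooth_V0_rep \<Psi> A" "smooth_V0_rep \<Psi> B" "i \<in> rep_mono (Sym \<Psi>) (V0_field \<Psi>) A B"
    "f \<in> rep_hom (Sym \<Psi>) (V0_field \<Psi>) A (V_rep \<Psi> d)"
  then show "\<exists>h\<in>rep_hom (Sym \<Psi>) (V0_field \<Psi>) B (V_rep \<Psi> d). \<forall>a\<in>carrier A. h (i a) = f a"
    by (rule V_rep_injective)
next
  fix V :: "(('p, 'k) ratfun, 'p \<Rightarrow> 'p, 'v) rep"
  assume V: "smooth_V0_rep \<Psi> V"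
  then show "\<exists>(I :: int \<Rightarrow> 'v set) e.
    e \<in> rep_mono (Sym \<Psi>) (V0_field \<Psi>) V (rep_prod UNIV (\<lambda>d. rep_power (V_rep \<Psi> d) (I d)))"
    by (rule embeds_into_product)
  interpret V0_rep \<Psi> V using V by (simp add: smooth_V0_rep_iff)
  assume fl: "finite_length (Sym \<Psi>) (V0_field \<Psi>) V"
  let ?P = "\<lambda>m :: int \<Rightarrow> nat. finite {d. m d \<noteq> 0} \<and>
    rep_iso (Sym \<Psi>) (V0_field \<Psi>) V (rep_dsum UNIV (\<lambda>d. rep_power (V_rep \<Psi> d) {..<m d}))"
  obtain n D F where "coordinates (carrier V) n D F" by (rule finite_length_coordinates[OF fl])
  then have ex: "\<exists>m. ?P m" by (rule coordinates_dsum)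
  then show "\<exists>m. ?P m" .
  assume inf: "infinite \<Psi>"
  have le: "m d \<le> m' d" if "?P m" "?P m'" for m m' d
  proof -
    from that obtain f f' where
      f: "f \<in> rep_hom (Sym \<Psi>) (V0_field \<Psi>) V (rep_dsum UNIV (\<lambda>d. rep_power (V_rep \<Psi> d) {..<m d}))"
        "bij_betw f (carrier V) (carrier (rep_dsum UNIV (\<lambda>d. rep_power (V_rep \<Psi> d) {..<m d})))" and
      f': "f' \<in> rep_hom (Sym \<Psi>) (V0_field \<Psi>) V (rep_dsum UNIV (\<lambda>d. rep_power (V_rep \<Psi> d) {..<m' d}))"
        "bij_betw f' (carrier V) (carrier (rep_dsum UNIV (\<lambda>d. rep_power (V_rep \<Psi> d) {..<m' d})))"
      unfolding rep_iso_def by blast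
    from multiplicity_le[OF inf _ _ f f'] that show ?thesis by blast
  qed
  show "\<exists>!m. ?P m"
  proof (rule ex_ex1I[OF ex])
    fix m m' assume "?P m" "?P m'"
    then show "m = m'" using le[of m m'] le[of m' m] by (intro ext order_antisym) blast+
  qed
qed

end
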